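(* Let $r\ge0$ be an integer. (1) If $k=4r+4$ and $k'=\lfloor\frac{k-1}2\rfloor=2r+1$, then \[ \sum_{j=0}^{r}\binom{k/2}{2j}(-1)^{j}\pi^{2j}\,\mathrm{IKM}_{k}(2j,2i) = \begin{cases} (-1)^r\pi^{2r+2}\,\mathrm{IKM}_{k}(2r+2,2i) & \text{if } 0\leq i\leq r, \\ (-1)^r\pi^{2r+2}\,\mathrm{IKM}_{k}^{\mathrm{reg}}(2r+2,2i) & \text{if } r+1\leq i\leq k'. \end{cases} \] (2) If $k=4r+2$, then \[ \sum_{j=0}^{r}\binom{k/2}{2j}(-1)^{j}\pi^{2j}\,\mathrm{IKM}_{k}(2j,2i) = \begin{cases} 0 & \text{if } 0\leq i\leq r-1, \\ \gamma_{k,i-r}\,2^{2i-2r} \displaystyle\sum_{j=0}^{r}\binom{k/2}{2j}(-1)^{j}\pi^{2j}\,\mathrm{IKM}_{k}(2j,2r) & \text{if } r+1\leq i\leq 2r. \end{cases} \]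
   Context: $I_0(t),K_0(t)$ are the modified Bessel functions of order $0$. The Bessel moments are $\mathrm{IKM}_{k}(a,b)=\int_{0}^{\infty}I_{0}(t)^{a}K_{0}(t)^{k-a}t^{b}\,\mathrm{d}t$ (whenever the integral converges). For $k$ even, the rational numbers $\gamma_{k,n}$ ($n\ge 0$) are defined by the formal power series identity $\Big(\sum_{n\ge 0}\frac{((2n-1)!!)^3}{2^{5n}\,n!}w^n\Big)^{k/2}=\sum_{n\ge0}\gamma_{k,n}w^n$, with $(-1)!!=1$. Equivalently, $(I_0(t)K_0(t))^{k/2}\sim 2^{-k/2}\sum_{n\ge 0}\gamma_{k,n}4^n t^{-2n-k/2}$ as $t\to+\infty$. For $k=4r+4$ and $j\ge r+1$, the regularized Bessel moment is \[ \mathrm{IKM}^{\mathrm{reg}}_{k}\left(\tfrac{k}{2},2j\right)=\lim_{t\rightarrow\infty}\left(\int_{0}^{t}(I_{0}(s)K_{0}(s))^{2r+2}s^{2j}\,\mathrm{d}s-\sum_{m=0}^{j-r-1}\frac{\gamma_{k,j-r-1-m}\,t^{2m+1}}{2^{k-2j+2m}(2m+1)}\right). \] *)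

theory Defs
  imports "HOL-Analysis.Analysis" "HOL-Computational_Algebra.Formal_Power_Series"
begin

text \<open>
  Modified Bessel functions of order 0 on the positive real axis. The integral for \<open>K\<^sub>0\<close> diverges
  at \<open>t = 0\<close>, so \<open>bessel_K0\<close> is meaningful for \<open>t > 0\<close> only; the moments below integrate
  over open-ended intervals starting at 0.
\<close>

definition bessel_I0 :: "real \<Rightarrow> real" where
  "bessel_I0 t = (\<Sum>n. (t / 2) ^ (2 * n) / (fact n)\<^sup>2)"

definition bessel_K0 :: "real \<Rightarrow> real" where
  "bessel_K0 t = (LBINT u:{0..}. exp (- t * cosh u))"

definition IKM_integrand :: "nat \<Rightarrow> nat \<Rightarrow> nat \<Rightarrow> real \<Rightarrow> real" where
  "IKM_integrand k a b t = bessel_I0 t ^ a * bessel_K0 t ^ (k - a) * t ^ b"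

text \<open>
  The Bessel moment (used for \<open>a \<le> k\<close>). The integrand is positive, so absolute (Lebesgue)
  integrability is the same as convergence of the improper integral.
\<close>

definition IKM_converges :: "nat \<Rightarrow> nat \<Rightarrow> nat \<Rightarrow> bool" where
  "IKM_converges k a b \<longleftrightarrow> set_integrable lborel {0<..} (IKM_integrand k a b)"

definition IKM :: "nat \<Rightarrow> nat \<Rightarrow> nat \<Rightarrow> real" where
  "IKM k a b = (LBINT t:{0<..}. IKM_integrand k a b t)"

text \<open>\<open>(2n - 1)!! = 1 \<cdot> 3 \<cdots> (2n - 1)\<close>, with \<open>(-1)!! = 1\<close>\<close>

definition odd_double_fact :: "nat \<Rightarrow> nat" where
  "odd_double_fact n = (\<Prod>l<n. 2 * l + 1)"

text \<open>
  For even \<open>k\<close> these are the numbers \<open>\<gamma>\<close> in the asymptotic expansion, as \<open>t \<rightarrow> \<infinity>\<close>,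
  of \<open>(I\<^sub>0(t) K\<^sub>0(t))^(k/2)\<close>, namely \<open>2^(-k/2) \<Sum>n. \<gamma>(k,n) 4^n t^(-2n-k/2)\<close>.
\<close>

definition IK_coeff :: "nat \<Rightarrow> nat \<Rightarrow> rat" where
  "IK_coeff k n = fps_nth
     (Abs_fps (\<lambda>m. of_nat (odd_double_fact m) ^ 3 / (2 ^ (5 * m) * fact m)) ^ (k div 2)) n"

text \<open>
  The regularized moment of index \<open>(k/2, 2j)\<close> for \<open>k = 4r + 4\<close> and \<open>j \<ge> r + 1\<close>: the divergent part
  of the asymptotic expansion of the truncated integral is subtracted before passing to the limit.
\<close>

definition IKM_reg_truncated :: "nat \<Rightarrow> nat \<Rightarrow> real \<Rightarrow> real" where
  "IKM_reg_truncated r j t =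
     (LBINT s:{0<..t}. (bessel_I0 s * bessel_K0 s) ^ (2 * r + 2) * s ^ (2 * j))
     - (\<Sum>m = 0..j - r - 1. of_rat (IK_coeff (4 * r + 4) (j - r - 1 - m)) * t ^ (2 * m + 1)
          / (2 powi (int (4 * r + 4) - 2 * int j + 2 * int m) * real (2 * m + 1)))"

definition IKM_reg_converges :: "nat \<Rightarrow> nat \<Rightarrow> bool" where
  "IKM_reg_converges r j \<longleftrightarrow>
     (\<forall>t>0. set_integrable lborel {0<..t}
        (\<lambda>s. (bessel_I0 s * bessel_K0 s) ^ (2 * r + 2) * s ^ (2 * j))) \<and>
     (\<exists>L. (IKM_reg_truncated r j \<longlongrightarrow> L) at_top)"

definition IKM_reg :: "nat \<Rightarrow> nat \<Rightarrow> real" where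
  "IKM_reg r j = Lim at_top (IKM_reg_truncated r j)"

end

theory Submission
  imports Defs "HOL-Complex_Analysis.Complex_Analysis" "HOL-Real_Asymp.Real_Asymp"
begin

text \<open>
  In the upper half plane let \<open>P(z) = K\<^sub>0(z) K\<^sub>0(-z) = K\<^sub>0(z) (K\<^sub>0(z) + \<i> \<pi> I\<^sub>0(z))\<close>. On the positive real
  axis the real part of \<open>P\<^sup>N x\<^bsup>2i\<^esup>\<close>, with \<open>N = k/2\<close>, is the combination of Bessel moment integrands in the
  statement, while on the positive imaginary axis \<open>P\<close> is real, so that \<open>P\<^sup>N z\<^bsup>2i\<^esup> dz\<close> is purely imaginary.
  Hence the integral over \<open>(0, R]\<close> is given by the quarter circle from \<open>R\<close> to \<open>\<i> R\<close> alone, where \<open>P\<close> has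
  the expansion \<open>(\<i> \<pi> / 2z) \<Sum> \<gamma>\<^sub>n (4/z\<^sup>2)\<^sup>n\<close>. For even \<open>N\<close> its powers yield the counterterms of the
  regularized moment; for odd \<open>N\<close> only the term in \<open>1/z\<close> contributes.

  The expansion, uniform in the closed quadrant, follows from the third-order equation satisfied by \<open>P\<close>
  as soon as \<open>P\<close> is known to be bounded. Boundedness holds for \<open>Re z \<ge> 1\<close> by the integral
  representations, for \<open>Re z \<le> -1\<close> by reflection, and in between by Phragmen-Lindelof.
\<close>

section \<open>Laplace integrals and the Bessel system\<close>

text \<open>The obstacle is the imaginary axis: the integral for K0(z) needs
  \<open>Re z > 0\<close>, so estimates drawn from it do not reach the closed quadrant uniformly.
  The product is chosen because the exponentials of K0(z) and K0(-z) cancel; what remains solves a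
  linear equation of its own, and that equation is insensitive to the direction of z. The summand
  \<i> pi I0 comes from \<open>Ln (-z) = Ln z - \<i> * pi\<close> in the upper half plane, as K0
  contains the term \<open>- Ln z * I0\<close>.

  Expanding (K0 + \<i> pi I0)^N and taking the real part gives the weights
  \<open>(N choose 2j) * (-1)^j * pi^(2j)\<close>. For even N the term j = N/2 has as many factors
  I0 as K0, hence no exponential decay; it is the one that stands on the right of (1), with its sign
  reversed by the move. For odd N every term decays exponentially, and the sum is an explicit
  multiple of \<gamma>(k, i-r) 4^(i-r); since \<gamma>(k,0) = 1, comparison with i = r eliminates
  the common factor. At the origin the singularity is a power of a logarithm, so a small contour
  around it contributes nothing in the limit.\<close>

lemma norm_exp_minus_one_minus_le:
  fixes s :: complex
  shows "norm (exp s - 1 - s) \<le> norm s ^ 2 * exp (norm s)"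
proof -
  have "norm (exp s - (\<Sum>i\<le>1. s ^ i / fact i)) \<le> exp (norm s) * (norm s ^ Suc 1) / fact 1"
    by (rule Taylor_exp_field)
  thus ?thesis by (simp add: power2_eq_square algebra_simps)
qed

lemma exp_abs_le_sum: "exp \<bar>x::real\<bar> \<le> exp x + exp (-x)"
  by (cases "x \<ge> 0") auto

text \<open>The second-order Taylor remainder of the exponential bounds the error of the difference
  quotient by a constant times \<open>norm w\<close>. The absolute values in the integrability
  hypothesis let \<open>h\<close> change sign: it is \<open>cosh\<close> for K0 and
  \<open>- cos\<close> for I0.\<close>

lemma has_field_derivative_Laplace_moment:
  fixes h :: "'a \<Rightarrow> real" and z :: complex
  assumes h: "h \<in> borel_measurable M"
    and int: "\<And>n x. x > 0 \<Longrightarrow> integrable M (\<lambda>u. \<bar>h u\<bar> ^ n * exp (- x * h u))"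
    and z: "Re z > 0"
  shows "((\<lambda>z. \<integral>u. of_real (h u) ^ n * exp (- z * of_real (h u)) \<partial>M) has_field_derivative
           - (\<integral>u. of_real (h u) ^ Suc n * exp (- z * of_real (h u)) \<partial>M)) (at z)"
proof -
  define g where "g = (\<lambda>n z. \<integral>u. complex_of_real (h u) ^ n * exp (- z * of_real (h u)) \<partial>M)"
  have [measurable]: "h \<in> borel_measurable M" by (fact h)
  have gint: "integrable M (\<lambda>u. complex_of_real (h u) ^ n * exp (- w * of_real (h u)))"
    if "Re w > 0" for w n
  proof (rule Bochner_Integration.integrable_bound [OF int[of "Re w" n, OF that]])
    show "(\<lambda>u. complex_of_real (h u) ^ n * exp (- w * of_real (h u))) \<in> borel_measurable M"
      by measurable
  qed (auto simp: norm_mult norm_power)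
  \<comment> \<open>Half of \<open>Re z\<close> keeps both abscissas \<open>Re z - d\<close> and
    \<open>Re z + d\<close> positive. They arise because \<open>exp \<bar>d * h u\<bar>\<close> is
    at most the sum of the two exponentials of opposite sign.\<close>
  define d where "d = Re z / 2"
  have d: "d > 0" "d < Re z" using z by (auto simp: d_def)
  let ?dom = "\<lambda>u. \<bar>h u\<bar> ^ (n+2) * exp (- (Re z - d) * h u) + \<bar>h u\<bar> ^ (n+2) * exp (- (Re z + d) * h u)"
  define B where "B = (\<integral>u. ?dom u \<partial>M)"
  have Bint: "integrable M (\<lambda>u. ?dom u)"
    using int[of "Re z - d" "n+2"] int[of "Re z + d" "n+2"] d by (intro Bochner_Integration.integrable_add) auto
  have key: "norm (g n (z + w) - g n z + w * g (Suc n) z) \<le> norm w ^ 2 * B" if w: "norm w < d" for w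
  proof -
    let ?rem = "\<lambda>u. of_real (h u) ^ n * exp (- z * of_real (h u)) * (exp (- w * h u) - 1 - (- w * h u))"
    have "\<bar>Re w\<bar> < d" using w abs_Re_le_cmod[of w] by linarith
    hence pos: "Re (z + w) > 0" using d_def d by auto
    have "g n (z + w) - g n z + w * g (Suc n) z =
      (\<integral>u. of_real (h u) ^ n * exp (- (z+w) * of_real (h u)) - of_real (h u) ^ n * exp (- z * of_real (h u))
          + w * (of_real (h u) ^ Suc n * exp (- z * of_real (h u))) \<partial>M)"
      unfolding g_def
      using gint[OF pos, of n] gint[OF z, of n] gint[OF z, of "Suc n"] by simp
    also have "\<dots> = (\<integral>u. ?rem u \<partial>M)"
      by (intro Bochner_Integration.integral_cong refl) (simp add: algebra_simps exp_add exp_diff exp_minus field_simps)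
    also have "norm \<dots> \<le> (\<integral>u. norm w ^ 2 * (?dom u) \<partial>M)"
    proof (rule order.trans[OF integral_norm_bound integral_mono])
      show int1: "integrable M (\<lambda>u. norm w ^ 2 * (?dom u))"
        using Bint by auto
      show bd: "norm (?rem u)
        \<le> norm w ^ 2 * (?dom u)" for u
      proof -
        have "norm (exp (- w * h u) - 1 - (- w * h u)) \<le> norm (- w * h u) ^ 2 * exp (norm (- w * h u))"
          by (rule norm_exp_minus_one_minus_le)
        also have "exp (norm (- w * h u)) \<le> exp \<bar>d * h u\<bar>"
          using w d by (auto simp: norm_mult abs_mult intro!: mult_right_mono)
        also have "\<dots> \<le> exp (d * h u) + exp (- (d * h u))" by (rule exp_abs_le_sum)
        finally have "norm (exp (- w * h u) - 1 - (- w * h u)) \<le> norm (- w * h u) ^ 2 * (exp (d * h u) + exp (- (d * h u)))"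
          by (simp add: mult_left_mono)
        hence "norm (?rem u)
           \<le> (\<bar>h u\<bar> ^ n * exp (- Re z * h u)) * (norm (- w * h u) ^ 2 * (exp (d * h u) + exp (- (d * h u))))"
          unfolding norm_mult[of "_ * _"] by (intro mult_mono) (auto simp: norm_mult norm_power)
        also have "\<dots> = norm w ^ 2 * (?dom u)"
          by (simp add: norm_mult power_mult_distrib power_add power2_abs algebra_simps exp_add exp_diff exp_minus field_simps del: power_Suc add_2_eq_Suc')
        finally show ?thesis .
      qed
      show "integrable M (\<lambda>u. norm (?rem u))"
        by (rule integrable_norm, rule Bochner_Integration.integrable_bound [OF int1]) (use bd in \<open>auto intro!: AE_I2 order.trans[OF bd]\<close>)
    qed
    also have "\<dots> = norm w ^ 2 * B" unfolding B_def by (rule integral_mult_right_zero)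
    finally show ?thesis .
  qed
  have "(g n has_field_derivative - g (Suc n) z) (at z)"
    unfolding DERIV_def
  proof (rule LIM_zero_cancel, rule Lim_null_comparison)
    show "\<forall>\<^sub>F w in at 0. norm ((g n (z + w) - g n z) / w - - g (Suc n) z) \<le> norm w * B"
      unfolding eventually_at
    proof (intro exI[of _ d] conjI ballI impI)
      fix w :: complex assume w: "w \<noteq> 0 \<and> dist w 0 < d"
      have "(g n (z + w) - g n z) / w - - g (Suc n) z = (g n (z + w) - g n z + w * g (Suc n) z) / w"
        using w by (simp add: field_simps)
      also have "norm \<dots> \<le> norm w ^ 2 * B / norm w"
        unfolding norm_divide using key[of w] w by (intro divide_right_mono) auto
      finally show "norm ((g n (z + w) - g n z) / w - - g (Suc n) z) \<le> norm w * B"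
        using w by (simp add: power2_eq_square)
    qed (use d in auto)
    show "((\<lambda>w. norm w * B) \<longlongrightarrow> 0) (at 0)"
      by (auto intro!: tendsto_eq_intros)
  qed
  thus ?thesis by (simp add: g_def)
qed

text \<open>
  With \<open>\<theta> = z d/dz\<close>, the modified Bessel equation is \<open>\<theta>\<^sup>2 f = z\<^sup>2 f\<close>; the second
  component \<open>f1\<close> is \<open>\<theta> f\<close>. Below, a trailing \<open>1\<close> in a name marks this Euler derivative.
\<close>

definition bessel_sys :: "complex set \<Rightarrow> (complex \<Rightarrow> complex) \<Rightarrow> (complex \<Rightarrow> complex) \<Rightarrow> bool" where
  "bessel_sys S f f1 \<longleftrightarrow> (\<forall>z\<in>S. (f has_field_derivative f1 z / z) (at z) \<and> (f1 has_field_derivative z * f z) (at z))"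

section \<open>Power series solutions at the origin, in the variable z^2/4\<close>

definition I_fps :: "complex fps" where "I_fps = Abs_fps (\<lambda>n. 1 / (fact n)\<^sup>2)"

text \<open>The harmonic numbers come from differentiating the Frobenius series with respect to its
  exponent; this is the part of K0 without logarithm, up to a multiple of I0.\<close>

definition E_fps :: "complex fps" where "E_fps = Abs_fps (\<lambda>n. harm n / (fact n)\<^sup>2)"

lemma fps_conv_radius_infinite:
  fixes f :: "complex fps"
  assumes "\<And>n. norm (fps_nth f n) \<le> 1 / fact n"
  shows "fps_conv_radius f = \<infinity>"
  unfolding fps_conv_radius_def
proof (rule conv_radius_inftyI'')
  fix z :: complex
  have "summable (\<lambda>n. norm z ^ n /\<^sub>R fact n)"
    using exp_converges[of "norm z"] by (simp add: sums_iff)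
  moreover have "norm (fps_nth f n * z ^ n) \<le> norm z ^ n /\<^sub>R fact n" for n
    using mult_right_mono[OF assms[of n], of "norm z ^ n"]
    by (simp add: norm_mult norm_power field_simps)
  ultimately show "summable (\<lambda>n. fps_nth f n * z ^ n)"
    by (rule summable_comparison_test')
qed

lemma norm_I_fps_nth_le: "norm (fps_nth I_fps n) \<le> 1 / fact n"
proof -
  have "fact n * 1 \<le> fact n * (fact n :: real)" by (intro mult_mono) auto
  thus ?thesis
    by (simp add: I_fps_def norm_divide norm_power norm_mult power2_eq_square field_simps)
qed

lemma fps_conv_radius_I_fps [simp]: "fps_conv_radius I_fps = \<infinity>"
  by (rule fps_conv_radius_infinite[OF norm_I_fps_nth_le])

lemma harm_le_fact: "harm n \<le> (fact n :: real)"
proof (induction n)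
  case (Suc n)
  show ?case
  proof (cases "n = 0")
    case False
    have "inverse (real (Suc n)) \<le> 1" by (simp add: field_simps)
    also have "1 \<le> real n * fact n" using mult_mono[of 1 "real n" 1 "fact n"] False by auto
    finally show ?thesis using Suc by (simp add: harm_Suc algebra_simps)
  qed (auto simp: harm_def)
qed (auto simp: harm_def)

lemma norm_E_fps_nth_le: "norm (fps_nth E_fps n) \<le> 1 / fact n"
proof -
  have "norm (harm n :: complex) = (harm n :: real)"
    using norm_of_real[of "harm n", where ?'a = complex] harm_nonneg[of n, where ?'a = real]
    by (simp add: of_real_harm)
  thus ?thesis
    using harm_le_fact[of n]
    by (simp add: E_fps_def norm_divide norm_power norm_mult power2_eq_square field_simps)
qed

lemma fps_conv_radius_E_fps [simp]: "fps_conv_radius E_fps = \<infinity>"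
  by (rule fps_conv_radius_infinite[OF norm_E_fps_nth_le])

text \<open>The operator is d/dx x d/dx, so it shifts the coefficients by one and multiplies them by
  a square.\<close>

lemma bessel_operator_nth:
  "(fps_X * fps_deriv (fps_deriv f) + fps_deriv f) $ n = (of_nat (Suc n))\<^sup>2 * f $ Suc n"
  for f :: "'a :: comm_ring_1 fps"
  by (cases n) (auto simp: power2_eq_square algebra_simps)

lemma I_fps_ode: "fps_X * fps_deriv (fps_deriv I_fps) + fps_deriv I_fps = I_fps"
proof (rule fps_ext)
  fix n show "(fps_X * fps_deriv (fps_deriv I_fps) + fps_deriv I_fps) $ n = I_fps $ n"
    unfolding bessel_operator_nth
    by (simp add: I_fps_def fact_Suc power_mult_distrib del: of_nat_Suc)
qed

text \<open>The inhomogeneous term is the increment \<open>1 / (n + 1)\<close> of the harmonic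
  numbers, divided by the square of \<open>fact n\<close>: exactly the coefficient of the derivative
  of \<open>I_fps\<close>.\<close>

lemma E_fps_ode: "fps_X * fps_deriv (fps_deriv E_fps) + fps_deriv E_fps = E_fps + fps_deriv I_fps"
proof (rule fps_ext)
  fix n
  have "(of_nat (Suc n))\<^sup>2 * E_fps $ Suc n = harm (Suc n) / (fact n)\<^sup>2"
    by (simp add: E_fps_def fact_Suc power_mult_distrib del: of_nat_Suc)
  also have "\<dots> = E_fps $ n + fps_deriv I_fps $ n"
    by (simp add: E_fps_def I_fps_def fact_Suc power_mult_distrib harm_Suc divide_simps power2_eq_square del: of_nat_Suc)
  finally show "(fps_X * fps_deriv (fps_deriv E_fps) + fps_deriv E_fps) $ n = (E_fps + fps_deriv I_fps) $ n"
    unfolding bessel_operator_nth by simp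
qed

definition cI :: "complex \<Rightarrow> complex" where "cI z = eval_fps I_fps (z\<^sup>2 / 4)"
definition cI1 :: "complex \<Rightarrow> complex" where "cI1 z = z\<^sup>2 / 2 * eval_fps (fps_deriv I_fps) (z\<^sup>2 / 4)"
definition cE :: "complex \<Rightarrow> complex" where "cE z = eval_fps E_fps (z\<^sup>2 / 4)"
definition cE1 :: "complex \<Rightarrow> complex" where "cE1 z = z\<^sup>2 / 2 * eval_fps (fps_deriv E_fps) (z\<^sup>2 / 4)"

lemma fps_conv_radius_deriv_infinite [simp]:
  "fps_conv_radius f = \<infinity> \<Longrightarrow> fps_conv_radius (fps_deriv (f :: complex fps)) = \<infinity>"
  using fps_conv_radius_deriv[of f] by (cases "fps_conv_radius (fps_deriv f)") auto

lemma eval_fps_at_square: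
  assumes "fps_conv_radius (f :: complex fps) = \<infinity>"
  shows "((\<lambda>z. eval_fps f (z\<^sup>2 / 4)) has_field_derivative (z / 2 * eval_fps (fps_deriv f) (z\<^sup>2 / 4))) (at z)"
proof -
  have "((\<lambda>z. eval_fps f (z\<^sup>2 / 4)) has_field_derivative (eval_fps (fps_deriv f) (z\<^sup>2 / 4) * (z / 2))) (at z)"
    by (rule DERIV_chain2[OF has_field_derivative_eval_fps]) (auto intro!: derivative_eq_intros simp: assms)
  thus ?thesis by (simp add: mult_ac)
qed

lemma eval_fps_bessel_operator:
  assumes "fps_conv_radius (f :: complex fps) = \<infinity>"
  shows "eval_fps (fps_X * fps_deriv (fps_deriv f) + fps_deriv f) x
           = x * eval_fps (fps_deriv (fps_deriv f)) x + eval_fps (fps_deriv f) x"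
proof -
  have "fps_conv_radius (fps_X * fps_deriv (fps_deriv f)) \<ge> \<infinity>"
    using fps_conv_radius_mult[of fps_X "fps_deriv (fps_deriv f)"] assms by simp
  thus ?thesis
    using assms by (subst eval_fps_add) (auto simp: eval_fps_mult)
qed

lemma cI_sys: "bessel_sys (-{0}) cI cI1"
  unfolding bessel_sys_def
proof (intro ballI conjI)
  fix z :: complex assume "z \<in> -{0}"
  thus "(cI has_field_derivative cI1 z / z) (at z)"
    unfolding cI_def[abs_def] cI1_def
    by (rule_tac DERIV_cong[OF eval_fps_at_square]) (auto simp: power2_eq_square)
  have "(cI1 has_field_derivative
      z * (z\<^sup>2 / 4 * eval_fps (fps_deriv (fps_deriv I_fps)) (z\<^sup>2 / 4) + eval_fps (fps_deriv I_fps) (z\<^sup>2 / 4))) (at z)"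
    unfolding cI1_def[abs_def]
    by (rule derivative_eq_intros eval_fps_at_square refl | simp add: field_simps power2_eq_square)+
  also have "z\<^sup>2 / 4 * eval_fps (fps_deriv (fps_deriv I_fps)) (z\<^sup>2 / 4) + eval_fps (fps_deriv I_fps) (z\<^sup>2 / 4) = cI z"
    unfolding cI_def by (subst eval_fps_bessel_operator[symmetric]) (simp_all add: I_fps_ode)
  finally show "(cI1 has_field_derivative z * cI z) (at z)" .
qed

text \<open>
  The Frobenius solution: the harmonic coefficients of \<open>cE\<close> are exactly what compensates
  \<open>\<theta>\<^sup>2 (Ln z \<cdot> I) - z\<^sup>2 Ln z \<cdot> I = 2 \<theta> I\<close>.
\<close>

definition cY :: "complex \<Rightarrow> complex" where "cY z = cE z - Ln z * cI z"
definition cY1 :: "complex \<Rightarrow> complex" where "cY1 z = cE1 z - cI z - Ln z * cI1 z"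

lemma cY_sys: "bessel_sys (-\<real>\<^sub>\<le>\<^sub>0) cY cY1"
  unfolding bessel_sys_def
proof (intro ballI conjI)
  fix z :: complex assume z: "z \<in> -\<real>\<^sub>\<le>\<^sub>0"
  hence nz: "z \<noteq> 0" by auto
  have I: "(cI has_field_derivative cI1 z / z) (at z)" "(cI1 has_field_derivative z * cI z) (at z)"
    using cI_sys nz by (auto simp: bessel_sys_def)
  have E: "(cE has_field_derivative cE1 z / z) (at z)"
    unfolding cE_def[abs_def] cE1_def
    by (rule DERIV_cong[OF eval_fps_at_square]) (auto simp: power2_eq_square)
  have "(cE1 has_field_derivative
      z * (z\<^sup>2 / 4 * eval_fps (fps_deriv (fps_deriv E_fps)) (z\<^sup>2 / 4) + eval_fps (fps_deriv E_fps) (z\<^sup>2 / 4))) (at z)"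
    unfolding cE1_def[abs_def]
    by (rule derivative_eq_intros eval_fps_at_square refl | simp add: field_simps power2_eq_square)+
  also have "z\<^sup>2 / 4 * eval_fps (fps_deriv (fps_deriv E_fps)) (z\<^sup>2 / 4) + eval_fps (fps_deriv E_fps) (z\<^sup>2 / 4)
      = cE z + 2 * cI1 z / z\<^sup>2"
    unfolding cE_def cI1_def using nz
    by (subst eval_fps_bessel_operator[symmetric]) (simp_all add: E_fps_ode eval_fps_add)
  finally have E1: "(cE1 has_field_derivative z * (cE z + 2 * cI1 z / z\<^sup>2)) (at z)" .
  have L: "(Ln has_field_derivative 1 / z) (at z)"
    using z by (auto intro!: derivative_eq_intros simp: field_simps)
  show "(cY has_field_derivative cY1 z / z) (at z)"
    unfolding cY_def[abs_def] cY1_def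
    by (rule derivative_eq_intros L I E refl)+ (use nz in \<open>simp add: field_simps\<close>)
  show "(cY1 has_field_derivative z * cY z) (at z)"
    unfolding cY_def cY1_def[abs_def]
    by (rule derivative_eq_intros L I E1 refl)+ (use nz in \<open>simp add: field_simps power2_eq_square\<close>)
qed

section \<open>Wronskians and decomposition in a basis of solutions\<close>

lemma bessel_sys_mono: "bessel_sys S f f1 \<Longrightarrow> T \<subseteq> S \<Longrightarrow> bessel_sys T f f1"
  by (auto simp: bessel_sys_def)

text \<open>With Euler derivatives in place of ordinary ones the Wronskian loses its usual factor
  1/z: the system has trace zero.\<close>

lemma bessel_sys_wronskian_const:
  assumes f: "bessel_sys S f f1" and g: "bessel_sys S g g1" and S: "open S" "connected S" "0 \<notin> S"
  shows "\<exists>c. \<forall>z\<in>S. f z * g1 z - g z * f1 z = c"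
proof -
  have "((\<lambda>z. f z * g1 z - g z * f1 z) has_field_derivative 0) (at z)" if z: "z \<in> S" for z
  proof -
    have nz: "z \<noteq> 0" using that S by auto
    have d: "(f has_field_derivative f1 z / z) (at z)" "(f1 has_field_derivative z * f z) (at z)"
      "(g has_field_derivative g1 z / z) (at z)" "(g1 has_field_derivative z * g z) (at z)"
      using f g that by (auto simp: bessel_sys_def)
    show ?thesis
      by (rule derivative_eq_intros d refl)+ (use nz in \<open>simp add: field_simps\<close>)
  qed
  thus ?thesis
    by (intro has_field_derivative_0_imp_constant_on[of S, unfolded constant_on_def]) (use S in auto)
qed

text \<open>Cramer's rule at a single point. As \<open>a\<close> and \<open>b\<close> are
  Wronskians, they do not depend on \<open>z\<close>, and the formula becomes an identity of
  functions.\<close>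

lemma bessel_sys_decompose:
  assumes w: "f z * g1 z - g z * f1 z = -1" "f z * h1 z - h z * f1 z = a" "h z * g1 z - g z * h1 z = b"
  shows "h z = - (b * f z + a * (g z :: complex))"
proof -
  have "h z * (f z * g1 z - g z * f1 z) = f z * (h z * g1 z - g z * h1 z) + g z * (f z * h1 z - h z * f1 z)"
    by (simp add: algebra_simps)
  hence "- h z = b * f z + a * g z" unfolding w by (simp add: mult_ac)
  thus ?thesis by (metis add.inverse_inverse)
qed

section \<open>The integral over the half line for K0\<close>

lemma cosh_power_exp_bound:
  fixes x :: real
  assumes "x > 0"
  shows "\<exists>B>0. \<forall>u\<ge>0. cosh u ^ n * exp (- x * cosh u) \<le> B * exp (-u)"
proof -
  define m where "m = Suc n"
  \<comment> \<open>From (1 + y/m)^m \<le> e^y with y = x cosh u. Taking m = n + 1 leaves one power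
    of \<open>cosh u\<close> to spare, and \<open>exp u \<le> 2 * cosh u\<close> turns it into
    \<open>exp (- u)\<close>; hence the factor 2.\<close>
  define B where "B = 2 * (real m / x) ^ m"
  have "cosh u ^ n * exp (- x * cosh u) \<le> B * exp (-u)" if "u \<ge> 0" for u
  proof -
    have c: "cosh u > 0" "exp u \<le> 2 * cosh u" using cosh_real_pos[of u] by (auto simp: cosh_def)
    have "(x * cosh u / real m) ^ m \<le> (1 + x * cosh u / real m) ^ m"
      using assms c by (intro power_mono) (auto simp: m_def)
    also have "\<dots> \<le> exp (x * cosh u)"
      using assms c by (intro exp_ge_one_plus_x_over_n_power_n) (auto simp: m_def intro: order.trans[of _ 0])
    finally have "cosh u ^ m \<le> (real m / x) ^ m * exp (x * cosh u)"
      using assms by (simp add: power_divide power_mult_distrib field_simps m_def del: power_Suc of_nat_Suc)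
    hence "cosh u ^ m * exp (- x * cosh u) \<le> (real m / x) ^ m"
      by (simp add: exp_minus field_simps)
    hence "cosh u ^ n * exp (- x * cosh u) * cosh u \<le> B / 2"
      by (simp add: m_def B_def mult_ac)
    also have "B / 2 * 1 \<le> B / 2 * (2 * cosh u * exp (-u))"
      using c assms by (intro mult_left_mono) (auto simp: exp_minus field_simps B_def m_def)
    finally have "cosh u ^ n * exp (- x * cosh u) * cosh u \<le> (B * exp (-u)) * cosh u"
      by (simp add: mult_ac)
    thus ?thesis using c by (subst (asm) mult_le_cancel_right_pos)
  qed
  moreover have "B > 0" using assms by (auto simp: B_def m_def)
  ultimately show ?thesis by blast
qed

lemma set_integrable_exp_minus: "set_integrable lborel {0<..} (\<lambda>u::real. exp (-u))"
proof -
  have "(\<lambda>u::real. exp (-u)) absolutely_integrable_on {0..}"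
    using integrable_on_exp_minus_to_infinity[of 1 0]
    by (intro nonnegative_absolutely_integrable_1) auto
  hence "(\<lambda>u::real. exp (-u)) absolutely_integrable_on {0<..}"
    by (rule set_integrable_subset) auto
  thus ?thesis unfolding set_integrable_def
    by (subst (asm) integrable_completion) auto
qed

text \<open>Restricting the measure instead of the integrand gives the integrals the form of
  \<open>has_field_derivative_Laplace_moment\<close>.\<close>

abbreviation "half_line \<equiv> restrict_space lborel {0::real<..}"

lemma integrable_half_line_iff: "integrable half_line f \<longleftrightarrow> set_integrable lborel {0<..} f"
  for f :: "real \<Rightarrow> 'a :: {banach, second_countable_topology}"
  unfolding set_integrable_def by (subst integrable_restrict_space) auto

lemma integral_half_line: "integral\<^sup>L half_line f = (LBINT u:{0<..}. f u)"
  for f :: "real \<Rightarrow> 'a :: {banach, second_countable_topology}"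
  unfolding set_lebesgue_integral_def by (subst integral_restrict_space) auto

lemma borel_measurable_half_line:
  "f \<in> borel_measurable borel \<Longrightarrow> f \<in> borel_measurable half_line"
  by (rule measurable_restrict_space1) simp

lemma cosh_measurable [measurable]: "(cosh :: real \<Rightarrow> real) \<in> borel_measurable borel"
  by (intro borel_measurable_continuous_onI continuous_intros)
lemma sinh_measurable [measurable]: "(sinh :: real \<Rightarrow> real) \<in> borel_measurable borel"
  by (intro borel_measurable_continuous_onI continuous_intros)

lemma integrable_cosh_exp:
  assumes "x > 0"
  shows "integrable half_line (\<lambda>u. \<bar>cosh u\<bar> ^ n * exp (- x * cosh u))"
proof -
  obtain B where B: "\<And>u. u \<ge> 0 \<Longrightarrow> cosh u ^ n * exp (- x * cosh u) \<le> B * exp (-u)"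
    using cosh_power_exp_bound[OF assms, of n] by blast
  have i: "integrable half_line (\<lambda>u. B * exp (-u))"
    using set_integrable_exp_minus unfolding integrable_half_line_iff[symmetric] by simp
  show ?thesis
  proof (rule Bochner_Integration.integrable_bound[OF i])
    show "AE u in half_line. norm (\<bar>cosh u\<bar> ^ n * exp (- x * cosh u)) \<le> norm (B * exp (-u))"
      by (rule AE_I2) (use B in \<open>fastforce simp: space_restrict_space intro: order.trans[OF _ abs_ge_self]\<close>)
  qed (rule borel_measurable_half_line, measurable)
qed

text \<open>For \<open>Re z > 0\<close>, \<open>Kint 0\<close> is K0 and \<open>Kint 1\<close> is K1
  = - K0'.\<close>

definition Kint :: "nat \<Rightarrow> complex \<Rightarrow> complex" where
  "Kint n z = (\<integral>u. of_real (cosh u) ^ n * exp (- z * of_real (cosh u)) \<partial>half_line)"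

lemma integrable_Kint:
  assumes "Re z > 0"
  shows "integrable half_line (\<lambda>u. of_real (cosh u) ^ n * exp (- z * of_real (cosh u)))"
proof (rule Bochner_Integration.integrable_bound [OF integrable_cosh_exp[OF assms, of n]])
  show "(\<lambda>u. complex_of_real (cosh u) ^ n * exp (- z * of_real (cosh u))) \<in> borel_measurable half_line"
    by (rule borel_measurable_half_line) measurable
qed (auto simp: norm_mult norm_power)

lemma Kint_has_field_derivative:
  "Re z > 0 \<Longrightarrow> (Kint n has_field_derivative - Kint (Suc n) z) (at z)"
  unfolding Kint_def[abs_def]
  by (rule has_field_derivative_Laplace_moment) (assumption | rule integrable_cosh_exp borel_measurable_half_line cosh_measurable)+

lemma sinh_exp_tendsto_0:
  assumes "Re z > 0"
  shows "((\<lambda>u. of_real (sinh u) * exp (- z * of_real (cosh u))) \<longlongrightarrow> 0) at_top"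
proof -
  obtain B where B: "\<And>u. u \<ge> 0 \<Longrightarrow> cosh u ^ 1 * exp (- Re z * cosh u) \<le> B * exp (-u)"
    using cosh_power_exp_bound[OF assms, of 1] by blast
  show ?thesis
  proof (rule Lim_null_comparison)
    show "\<forall>\<^sub>F u in at_top. norm (of_real (sinh u) * exp (- z * of_real (cosh u))) \<le> B * exp (-u)"
      using eventually_ge_at_top[of 0]
    proof eventually_elim
      case (elim u)
      have "\<bar>sinh u\<bar> \<le> cosh u" using elim by (simp add: sinh_le_cosh_real)
      hence "\<bar>sinh u\<bar> * exp (- Re z * cosh u) \<le> cosh u * exp (- Re z * cosh u)"
        by (intro mult_right_mono) auto
      also note B[OF elim, unfolded power_one_right]
      finally show ?case by (simp add: norm_mult)
    qed
    show "((\<lambda>u. B * exp (- u)) \<longlongrightarrow> 0) at_top" by real_asymp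
  qed
qed

lemma cosh_square_identity: "complex_of_real (cosh u) ^ 2 = 1 + of_real (sinh u) ^ 2"
  by (metis cosh_square_eq add.commute of_real_1 of_real_add of_real_power)

text \<open>The integrand of the combination is, up to sign, the derivative in \<open>u\<close> of
  \<open>sinh u * exp (- z * cosh u)\<close>, which vanishes at both ends.\<close>

lemma Kint_ode:
  assumes "Re z > 0"
  shows "z * Kint 2 z - Kint 1 z = z * Kint 0 z"
proof -
  let ?f = "\<lambda>u. of_real (cosh u) * exp (- z * of_real (cosh u)) - z * of_real (sinh u) ^ 2 * exp (- z * of_real (cosh u))"
  have eq: "?f u
     = of_real (cosh u) ^ 1 * exp (- z * of_real (cosh u)) - z * (of_real (cosh u) ^ 2 * exp (- z * of_real (cosh u)))
       + z * (of_real (cosh u) ^ 0 * exp (- z * of_real (cosh u)))" for u :: real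
    by (simp add: cosh_square_identity algebra_simps)
  have "(LBINT u=ereal 0..\<infinity>. ?f u) = 0 - 0"
  proof (rule interval_integral_FTC_integrable[where F = "\<lambda>u. of_real (sinh u) * exp (- z * of_real (cosh u))"])
    fix x :: real
    have S: "((\<lambda>u. complex_of_real (sinh u)) has_vector_derivative of_real (cosh x)) (at x)"
      by (intro has_vector_derivative_of_real) (auto intro!: derivative_eq_intros)
    have C: "((\<lambda>u. - z * complex_of_real (cosh u)) has_vector_derivative - z * of_real (sinh x)) (at x)"
      by (intro has_vector_derivative_mult_right has_vector_derivative_of_real) (auto intro!: derivative_eq_intros)
    have E: "((\<lambda>u. exp (- z * of_real (cosh u))) has_vector_derivative (- z * of_real (sinh x)) * exp (- z * of_real (cosh x))) (at x)"
      using field_vector_diff_chain_at[OF C DERIV_exp] by (simp add: o_def)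
    show "((\<lambda>u. of_real (sinh u) * exp (- z * of_real (cosh u))) has_vector_derivative ?f x) (at x)"
      using has_vector_derivative_mult[OF S E] by (simp add: algebra_simps power2_eq_square)
    show "isCont (\<lambda>u. ?f u) x"
      by (intro continuous_intros)
    show "set_integrable lborel (einterval (ereal 0) \<infinity>) (\<lambda>u. ?f u)"
      unfolding eq einterval_eq integrable_half_line_iff[symmetric]
      by (intro Bochner_Integration.integrable_add Bochner_Integration.integrable_diff integrable_mult_right integrable_Kint assms)
  next
    have "isCont (\<lambda>u. complex_of_real (sinh u) * exp (- z * of_real (cosh u))) 0" by (intro continuous_intros)
    hence "((\<lambda>u. complex_of_real (sinh u) * exp (- z * of_real (cosh u))) \<longlongrightarrow> 0) (at 0)" unfolding isCont_def by simp
    thus "(((\<lambda>u. of_real (sinh u) * exp (- z * of_real (cosh u))) \<circ> real_of_ereal) \<longlongrightarrow> 0) (at_right (ereal 0))"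
      unfolding ereal_tendsto_simps by (rule filterlim_mono) (auto simp: at_within_le_at)
    show "(((\<lambda>u. of_real (sinh u) * exp (- z * of_real (cosh u))) \<circ> real_of_ereal) \<longlongrightarrow> 0) (at_left \<infinity>)"
      unfolding ereal_tendsto_simps by (rule sinh_exp_tendsto_0) fact
  qed auto
  moreover have hb: "has_bochner_integral half_line (\<lambda>u. of_real (cosh u) ^ n * exp (- z * of_real (cosh u))) (Kint n z)" for n
    unfolding Kint_def by (rule has_bochner_integral_integrable[OF integrable_Kint[OF assms]])
  hence "has_bochner_integral half_line (\<lambda>u. of_real (cosh u) ^ 1 * exp (- z * of_real (cosh u))
       - z * (of_real (cosh u) ^ 2 * exp (- z * of_real (cosh u))) + z * (of_real (cosh u) ^ 0 * exp (- z * of_real (cosh u))))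
     (Kint 1 z - z * Kint 2 z + z * Kint 0 z)"
    by (intro has_bochner_integral_add has_bochner_integral_diff has_bochner_integral_mult_right hb)
  hence "(LBINT u=ereal 0..\<infinity>. ?f u)
     = Kint 1 z - z * Kint 2 z + z * Kint 0 z"
    unfolding eq interval_integral_to_infinity_eq integral_half_line[symmetric]
    by (rule has_bochner_integral_integral_eq)
  ultimately have "Kint 1 z - z * Kint 2 z + z * Kint 0 z = 0" by simp
  thus ?thesis by (simp add: algebra_simps)
qed

lemma Kint_sys: "bessel_sys {z. Re z > 0} (Kint 0) (\<lambda>z. - z * Kint 1 z)"
  unfolding bessel_sys_def
proof (intro ballI conjI)
  fix z assume "z \<in> {z. Re z > 0}"
  hence z: "Re z > 0" by simp
  hence nz: "z \<noteq> 0" by auto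
  show "(Kint 0 has_field_derivative (- z * Kint 1 z) / z) (at z)"
    using Kint_has_field_derivative[OF z, of 0] nz by simp
  have "((\<lambda>z. - z * Kint 1 z) has_field_derivative - Kint 1 z + z * Kint 2 z) (at z)"
    by (rule derivative_eq_intros Kint_has_field_derivative z refl)+ (simp add: numeral_2_eq_2)
  also have "- Kint 1 z + z * Kint 2 z = z * Kint 0 z" using Kint_ode[OF z] by simp
  finally show "((\<lambda>z. - z * Kint 1 z) has_field_derivative z * Kint 0 z) (at z)" .
qed

lemma norm_Kint_le:
  assumes "Re z > 0"
  shows "norm (Kint n z) \<le> (\<integral>u. cosh u ^ n * exp (- Re z * cosh u) \<partial>half_line)"
proof -
  have "norm (Kint n z) \<le> (\<integral>u. norm (of_real (cosh u) ^ n * exp (- z * of_real (cosh u))) \<partial>half_line)"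
    unfolding Kint_def by (rule integral_norm_bound)
  also have "(\<lambda>u. norm (of_real (cosh u) ^ n * exp (- z * of_real (cosh u)))) = (\<lambda>u. cosh u ^ n * exp (- Re z * cosh u))"
    by (rule ext) (simp add: norm_mult norm_power)
  finally show ?thesis .
qed

lemma Kint_of_real:
  "Kint n (of_real t) = of_real (\<integral>u. cosh u ^ n * exp (- t * cosh u) \<partial>half_line)"
proof -
  have "(\<lambda>u. of_real (cosh u) ^ n * exp (- of_real t * of_real (cosh u))) = (\<lambda>u. complex_of_real (cosh u ^ n * exp (- t * cosh u)))"
  proof
    fix u :: real
    show "of_real (cosh u) ^ n * exp (- of_real t * of_real (cosh u)) = complex_of_real (cosh u ^ n * exp (- t * cosh u))"
      using exp_of_real[of "- t * cosh u", where ?'a = complex]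
      unfolding of_real_mult of_real_minus of_real_power by (rule arg_cong)
  qed
  thus ?thesis unfolding Kint_def by (simp only: integral_complex_of_real)
qed

text \<open>Valid for every real \<open>t\<close>: the two sides are the same Lebesgue integral,
  including its default value, since their domains differ by the null set {0}.\<close>

lemma bessel_K0_eq_Kint: "of_real (bessel_K0 t) = Kint 0 (of_real t)"
proof -
  have "bessel_K0 t = (LBINT u:{0<..}. exp (- t * cosh u))"
    unfolding bessel_K0_def set_lebesgue_integral_def
  proof (rule integral_cong_AE)
    show "AE u in lborel. indicator {0..} u *\<^sub>R exp (- t * cosh u) = indicator {0<..} u *\<^sub>R exp (- t * cosh u)"
      using AE_lborel_singleton[of "0::real"] by eventually_elim (simp add: indicator_def)
  qed measurable
  also have "\<dots> = (\<integral>u. cosh u ^ 0 * exp (- t * cosh u) \<partial>half_line)"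
    unfolding integral_half_line by simp
  finally show ?thesis by (simp only: Kint_of_real)
qed

section \<open>Identification of the integrals with series solutions\<close>

text \<open>With \<open>sinh\<close> in place of \<open>cosh\<close> the integrand has an elementary
  primitive. This is the comparison integral for \<open>Kint 1\<close> near 0.\<close>

lemma sinh_exp_integral:
  fixes t :: real
  assumes t: "t > 0"
  shows "integrable half_line (\<lambda>u. t * sinh u * exp (- t * cosh u))"
    and "(\<integral>u. t * sinh u * exp (- t * cosh u) \<partial>half_line) = exp (- t)"
proof -
  show int: "integrable half_line (\<lambda>u. t * sinh u * exp (- t * cosh u))"
  proof (rule Bochner_Integration.integrable_bound[OF integrable_mult_right[OF integrable_cosh_exp[OF t, of 1], of t]])
    show "(\<lambda>u. t * sinh u * exp (- t * cosh u)) \<in> borel_measurable half_line"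
      by (rule borel_measurable_half_line) measurable
    show "AE u in half_line. norm (t * sinh u * exp (- t * cosh u)) \<le> norm (t * (\<bar>cosh u\<bar> ^ 1 * exp (- t * cosh u)))"
      using t by (intro AE_I2) (auto simp: space_restrict_space abs_mult sinh_le_cosh_real intro!: mult_left_mono mult_right_mono)
  qed
  have "(LBINT u=ereal 0..\<infinity>. t * sinh u * exp (- t * cosh u)) = 0 - (- exp (- t))"
  proof (rule interval_integral_FTC_integrable[where F = "\<lambda>u. - exp (- t * cosh u)"])
    fix x :: real
    show "((\<lambda>u. - exp (- t * cosh u)) has_vector_derivative t * sinh x * exp (- t * cosh x)) (at x)"
      unfolding has_real_derivative_iff_has_vector_derivative[symmetric]
      by (auto intro!: derivative_eq_intros)
    show "isCont (\<lambda>u. t * sinh u * exp (- t * cosh u)) x"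
      by (intro continuous_intros)
    show "set_integrable lborel (einterval (ereal 0) \<infinity>) (\<lambda>u. t * sinh u * exp (- t * cosh u))"
      unfolding einterval_eq integrable_half_line_iff[symmetric] by (rule int)
  next
    have "isCont (\<lambda>u. - exp (- t * cosh u)) 0" by (intro continuous_intros)
    hence "((\<lambda>u. - exp (- t * cosh u)) \<longlongrightarrow> - exp (- t)) (at 0)" unfolding isCont_def by simp
    thus "(((\<lambda>u. - exp (- t * cosh u)) \<circ> real_of_ereal) \<longlongrightarrow> - exp (- t)) (at_right (ereal 0))"
      unfolding ereal_tendsto_simps by (rule filterlim_mono) (auto simp: at_within_le_at)
    obtain B where B: "\<And>u. u \<ge> 0 \<Longrightarrow> cosh u ^ 0 * exp (- t * cosh u) \<le> B * exp (-u)"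
      using cosh_power_exp_bound[OF t, of 0] by blast
    have "((\<lambda>u. - exp (- t * cosh u)) \<longlongrightarrow> 0) at_top"
    proof (rule Lim_null_comparison)
      show "\<forall>\<^sub>F u in at_top. norm (- exp (- t * cosh u)) \<le> B * exp (-u)"
        using eventually_ge_at_top[of 0] by eventually_elim (use B in auto)
      show "((\<lambda>u. B * exp (- u)) \<longlongrightarrow> 0) at_top" by real_asymp
    qed
    thus "(((\<lambda>u. - exp (- t * cosh u)) \<circ> real_of_ereal) \<longlongrightarrow> 0) (at_left \<infinity>)"
      unfolding ereal_tendsto_simps .
  qed auto
  thus "(\<integral>u. t * sinh u * exp (- t * cosh u) \<partial>half_line) = exp (- t)"
    unfolding interval_integral_to_infinity_eq integral_half_line by simp
qed

text \<open>Since \<open>cosh u - sinh u = exp (- u)\<close>, the quantity lies between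
  \<open>exp (- t)\<close> and \<open>exp (- t) + t * C\<close>. This limit fixes the Wronskian of
  I0 and K0.\<close>

lemma Kint_1_asymp_0: "((\<lambda>t. of_real t * Kint 1 (of_real t)) \<longlongrightarrow> 1) (at_right 0)"
proof -
  define T where "T = (\<lambda>t. \<integral>u. cosh u ^ 1 * exp (- t * cosh u) \<partial>half_line)"
  define C where "C = (\<integral>u. exp (-u) \<partial>half_line)"
  have ie: "integrable half_line (\<lambda>u. exp (-u))"
    using set_integrable_exp_minus by (simp add: integrable_half_line_iff)
  have bnd: "exp (-t) \<le> t * T t \<and> t * T t \<le> exp (-t) + t * C" if t: "t > 0" for t
  proof -
    have i1: "integrable half_line (\<lambda>u. t * (cosh u ^ 1 * exp (- t * cosh u)))"
      using integrable_mult_right[OF integrable_cosh_exp[OF t, of 1], of t] by simp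
    have eq: "t * T t = (\<integral>u. t * (cosh u ^ 1 * exp (- t * cosh u)) \<partial>half_line)"
      unfolding T_def by (rule integral_mult_right_zero[symmetric])
    have "exp (-t) = (\<integral>u. t * sinh u * exp (- t * cosh u) \<partial>half_line)"
      using sinh_exp_integral(2)[OF t] by simp
    also have "\<dots> \<le> t * T t" unfolding eq
      using t by (intro integral_mono sinh_exp_integral i1) (auto simp: sinh_le_cosh_real)
    finally have 1: "exp (-t) \<le> t * T t" .
    have "t * T t \<le> (\<integral>u. t * sinh u * exp (- t * cosh u) + t * exp (-u) \<partial>half_line)"
      unfolding eq
    proof (rule integral_mono[OF i1])
      show "integrable half_line (\<lambda>u. t * sinh u * exp (- t * cosh u) + t * exp (-u))"
        by (intro Bochner_Integration.integrable_add sinh_exp_integral integrable_mult_right ie t)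
      fix u :: real
      have "cosh u * exp (- t * cosh u) - sinh u * exp (- t * cosh u) = exp (-u) * exp (- t * cosh u)"
        by (simp add: cosh_minus_sinh flip: left_diff_distrib)
      also have "\<dots> \<le> exp (-u) * 1" using t by (intro mult_left_mono) (auto simp: cosh_real_nonneg)
      finally have "cosh u * exp (- t * cosh u) \<le> sinh u * exp (- t * cosh u) + exp (-u)" by simp
      hence "t * (cosh u * exp (- t * cosh u)) \<le> t * (sinh u * exp (- t * cosh u) + exp (-u))"
        using t by (intro mult_left_mono) auto
      thus "t * (cosh u ^ 1 * exp (- t * cosh u)) \<le> t * sinh u * exp (- t * cosh u) + t * exp (-u)"
        by (simp add: algebra_simps)
    qed
    also have "\<dots> = exp (-t) + t * C"
      using Bochner_Integration.integral_add[OF sinh_exp_integral(1)[OF t] integrable_mult_right[OF ie, of t]] sinh_exp_integral(2)[OF t]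
      by (simp add: C_def)
    finally show ?thesis using 1 by simp
  qed
  have "((\<lambda>t. t * T t) \<longlongrightarrow> 1) (at_right 0)"
  proof (rule tendsto_sandwich)
    show "\<forall>\<^sub>F t in at_right 0. exp (-t) \<le> t * T t" "\<forall>\<^sub>F t in at_right 0. t * T t \<le> exp (-t) + t * C"
      using bnd by (auto simp: eventually_at_filter)
    show "((\<lambda>t::real. exp (-t)) \<longlongrightarrow> 1) (at_right 0)" by real_asymp
    show "((\<lambda>t::real. exp (-t) + t * C) \<longlongrightarrow> 1) (at_right 0)" by real_asymp
  qed
  from tendsto_of_real[OF this, where ?'a = complex] show ?thesis
    unfolding Kint_of_real T_def by simp
qed

text \<open>On the positive axis K0 \<le> K1, because \<open>cosh\<close> is at least 1. The factor
  t^2 is what \<open>cI1\<close> provides at the origin.\<close>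

lemma Kint_0_asymp_0: "((\<lambda>t. of_real t ^ 2 * Kint 0 (of_real t)) \<longlongrightarrow> 0) (at_right 0)"
proof (rule Lim_null_comparison)
  show "\<forall>\<^sub>F t in at_right 0. norm (of_real t ^ 2 * Kint 0 (of_real t)) \<le> norm (of_real t * (of_real t * Kint 1 (of_real t)))"
    unfolding eventually_at_filter
  proof (intro always_eventually allI impI)
    fix t :: real assume "t \<noteq> 0" "t \<in> {0<..}"
    hence t: "t > 0" by simp
    have "(\<integral>u. cosh u ^ 0 * exp (- t * cosh u) \<partial>half_line) \<le> (\<integral>u. cosh u ^ 1 * exp (- t * cosh u) \<partial>half_line)"
      using integrable_cosh_exp[OF t, of 0] integrable_cosh_exp[OF t, of 1] 
      by (intro integral_mono) (auto simp: cosh_real_ge_1)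
    moreover have "0 \<le> (\<integral>u. cosh u ^ 0 * exp (- t * cosh u) \<partial>half_line)" by (rule integral_nonneg_AE) simp
    ultimately have "norm (Kint 0 (of_real t)) \<le> norm (Kint 1 (of_real t))"
      unfolding Kint_of_real by simp
    thus "norm (of_real t ^ 2 * Kint 0 (of_real t)) \<le> norm (of_real t * (of_real t * Kint 1 (of_real t)))"
      using t mult_left_mono[of "norm (Kint 0 (of_real t))" "norm (Kint 1 (of_real t))" "t * t"]
      by (simp add: norm_mult power2_eq_square)
  qed
  have "((\<lambda>t. complex_of_real t * (of_real t * Kint 1 (of_real t))) \<longlongrightarrow> 0 * 1) (at_right 0)"
    by (intro tendsto_mult Kint_1_asymp_0) (auto intro!: tendsto_eq_intros)
  thus "((\<lambda>t. norm (complex_of_real t * (of_real t * Kint 1 (of_real t)))) \<longlongrightarrow> 0) (at_right 0)"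
    by (simp add: tendsto_norm_zero)
qed

lemma eval_fps_square_tendsto:
  assumes "fps_conv_radius (f :: complex fps) = \<infinity>"
  shows "((\<lambda>t. eval_fps f ((of_real t)\<^sup>2 / 4)) \<longlongrightarrow> fps_nth f 0) (at_right 0)"
proof -
  have "isCont (\<lambda>z. eval_fps f (z\<^sup>2 / 4)) 0"
    using DERIV_isCont[OF eval_fps_at_square[OF assms]] .
  moreover have "(of_real \<longlongrightarrow> (0::complex)) (at_right (0::real))"
    using tendsto_of_real[OF tendsto_ident_at, of "0::real" "{0<..}", where ?'a = complex] by simp
  ultimately show ?thesis
    using isCont_tendsto_compose[of 0 "\<lambda>z. eval_fps f (z\<^sup>2 / 4)" of_real "at_right 0"] by (simp add: eval_fps_at_0)
qed

lemma cI_tendsto: "((\<lambda>t. cI (of_real t)) \<longlongrightarrow> 1) (at_right 0)"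
proof -
  have "I_fps $ 0 = 1" by (simp add: I_fps_def)
  thus ?thesis unfolding cI_def using eval_fps_square_tendsto[of I_fps] by simp
qed

lemma cI1_small:
  assumes "((\<lambda>t. of_real t ^ 2 * f t) \<longlongrightarrow> 0) (at_right 0)"
  shows "((\<lambda>t. f t * cI1 (of_real t)) \<longlongrightarrow> 0) (at_right 0)"
proof -
  have "((\<lambda>t. (of_real t ^ 2 * f t) * (eval_fps (fps_deriv I_fps) ((of_real t)\<^sup>2 / 4) / 2)) \<longlongrightarrow> 0 * (fps_nth (fps_deriv I_fps) 0 / 2)) (at_right 0)"
    by (intro tendsto_intros assms eval_fps_square_tendsto) auto
  thus ?thesis by (simp add: cI1_def mult_ac)
qed

lemma Ln_small: "((\<lambda>t. of_real t ^ 2 * Ln (of_real t)) \<longlongrightarrow> 0) (at_right 0)"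
proof -
  have "((\<lambda>t. t ^ 2 * ln t) \<longlongrightarrow> (0::real)) (at_right 0)" by real_asymp
  from tendsto_of_real[OF this, where ?'a = complex]
  have "((\<lambda>t. of_real t ^ 2 * complex_of_real (ln t)) \<longlongrightarrow> 0) (at_right 0)" by simp
  thus ?thesis
    by (rule Lim_transform_eventually) (auto simp: eventually_at_filter Ln_of_real)
qed

lemma cE_tendsto: "((\<lambda>t. cE (of_real t)) \<longlongrightarrow> 0) (at_right 0)"
proof -
  have "E_fps $ 0 = 0" by (simp add: E_fps_def harm_def)
  thus ?thesis unfolding cE_def using eval_fps_square_tendsto[of E_fps] by simp
qed

lemma cE1_tendsto: "((\<lambda>t. cE1 (of_real t)) \<longlongrightarrow> 0) (at_right 0)"
  unfolding cE1_def by (rule tendsto_eq_intros eval_fps_square_tendsto refl | simp)+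

lemma cY1_tendsto: "((\<lambda>t. cY1 (of_real t)) \<longlongrightarrow> -1) (at_right 0)"
proof -
  have "((\<lambda>t. cE1 (of_real t) - cI (of_real t) - Ln (of_real t) * cI1 (of_real t)) \<longlongrightarrow> 0 - 1 - 0) (at_right 0)"
    by (intro tendsto_diff cE1_tendsto cI_tendsto cI1_small Ln_small)
  thus ?thesis by (simp add: cY1_def)
qed

lemma cY_small: "((\<lambda>t. of_real t ^ 2 * cY (of_real t)) \<longlongrightarrow> 0) (at_right 0)"
proof -
  have "((\<lambda>t. of_real t ^ 2 * cE (of_real t) - of_real t ^ 2 * Ln (of_real t) * cI (of_real t)) \<longlongrightarrow> 0 ^ 2 * 0 - 0 * 1) (at_right 0)"
    by (intro tendsto_diff tendsto_mult cE_tendsto cI_tendsto Ln_small tendsto_power tendsto_eq_intros) auto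
  thus ?thesis by (simp add: cY_def algebra_simps)
qed

abbreviation "right_half_plane \<equiv> {z. Re z > 0}"

lemma right_half_plane: "open right_half_plane" "connected right_half_plane" "0 \<notin> right_half_plane" "right_half_plane \<subseteq> - \<real>\<^sub>\<le>\<^sub>0"
  by (auto simp: open_halfspace_Re_gt convex_halfspace_Re_gt convex_connected complex_nonpos_Reals_iff)

text \<open>A constant Wronskian is evaluated by letting the argument tend to 0 along the positive
  axis.\<close>

lemma right_half_plane_wronskian:
  assumes f: "bessel_sys right_half_plane f f1" and g: "bessel_sys right_half_plane g g1"
    and lim: "((\<lambda>t. f (of_real t) * g1 (of_real t) - g (of_real t) * f1 (of_real t)) \<longlongrightarrow> c) (at_right 0)"
    and z: "Re z > 0"
  shows "f z * g1 z - g z * f1 z = c"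
proof -
  obtain d where d: "\<And>z. Re z > 0 \<Longrightarrow> f z * g1 z - g z * f1 z = d"
    using bessel_sys_wronskian_const[OF f g right_half_plane(1-3)] by auto
  have "((\<lambda>t. f (of_real t) * g1 (of_real t) - g (of_real t) * f1 (of_real t)) \<longlongrightarrow> d) (at_right 0)"
    by (rule tendsto_eventually) (auto simp: eventually_at_filter d)
  hence "c = d" using lim by (intro tendsto_unique) auto
  thus ?thesis using d z by simp
qed

lemma cI_sys_right_half_plane: "bessel_sys right_half_plane cI cI1" and cY_sys_right_half_plane: "bessel_sys right_half_plane cY cY1"
  using bessel_sys_mono[OF cI_sys] bessel_sys_mono[OF cY_sys] right_half_plane by auto

text \<open>The value -1 is \<theta> applied to the term \<open>- Ln z\<close> of \<open>cY\<close>;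
  everything else vanishes at the origin.\<close>

lemma wronskian_I_Y: "Re z > 0 \<Longrightarrow> cI z * cY1 z - cY z * cI1 z = -1"
proof (rule right_half_plane_wronskian[OF cI_sys_right_half_plane cY_sys_right_half_plane])
  have "((\<lambda>t. cI (of_real t) * cY1 (of_real t) - cY (of_real t) * cI1 (of_real t)) \<longlongrightarrow> 1 * (-1) - 0) (at_right 0)"
    by (intro tendsto_intros cI_tendsto cY1_tendsto cI1_small cY_small)
  thus "((\<lambda>t. cI (of_real t) * cY1 (of_real t) - cY (of_real t) * cI1 (of_real t)) \<longlongrightarrow> -1) (at_right 0)" by simp
qed

lemma wronskian_I_Kint: "Re z > 0 \<Longrightarrow> cI z * (- z * Kint 1 z) - Kint 0 z * cI1 z = -1"
proof (rule right_half_plane_wronskian[OF cI_sys_right_half_plane Kint_sys])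
  have "((\<lambda>t. - (cI (of_real t) * (of_real t * Kint 1 (of_real t))) - Kint 0 (of_real t) * cI1 (of_real t)) \<longlongrightarrow> - (1 * 1) - 0) (at_right 0)"
    by (intro tendsto_intros cI_tendsto Kint_1_asymp_0 cI1_small Kint_0_asymp_0)
  thus "((\<lambda>t. cI (of_real t) * (- of_real t * Kint 1 (of_real t)) - Kint 0 (of_real t) * cI1 (of_real t)) \<longlongrightarrow> -1) (at_right 0)" by simp
qed

text \<open>\<open>Kint 0\<close> and \<open>cY\<close> have the same Wronskian -1 with
  \<open>cI\<close>, so their difference has Wronskian 0 with it and is a multiple of
  \<open>cI\<close>.\<close>

lemma Kint_eq_basis: "\<exists>b. \<forall>z. Re z > 0 \<longrightarrow> Kint 0 z = cY z + b * cI z"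
proof -
  obtain b where b: "\<And>z. Re z > 0 \<Longrightarrow> Kint 0 z * cY1 z - cY z * (- z * Kint 1 z) = b"
    using bessel_sys_wronskian_const[OF Kint_sys cY_sys_right_half_plane right_half_plane(1-3)] by auto
  have "Kint 0 z = cY z + (- b) * cI z" if "Re z > 0" for z
    using bessel_sys_decompose[where f = cI and ?f1.0 = cI1 and g = cY and ?g1.0 = cY1 and h = "Kint 0"
        and ?h1.0 = "\<lambda>z. - z * Kint 1 z", OF wronskian_I_Y wronskian_I_Kint b, OF that that that] by simp
  thus ?thesis by blast
qed

section \<open>The integral over (0, pi) for I0\<close>

abbreviation "Jmeasure \<equiv> restrict_space lborel {0<..<pi}"

lemma finite_measure_Jmeasure: "finite_measure Jmeasure"
  by (rule finite_measureI) (simp add: space_restrict_space emeasure_restrict_space)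

lemma integral_Jmeasure: "integral\<^sup>L Jmeasure f = (LBINT u=ereal 0..ereal pi. f u)"
  for f :: "real \<Rightarrow> 'a :: {banach, second_countable_topology}"
proof -
  have "ereal 0 \<le> ereal pi" by simp
  thus ?thesis
    unfolding set_lebesgue_integral_def einterval_eq
    by (subst integral_restrict_space) (auto simp: interval_lebesgue_integral_le_eq set_lebesgue_integral_def)
qed

lemma integrable_Jmeasure:
  fixes f :: "real \<Rightarrow> 'a :: {banach, second_countable_topology}"
  assumes "continuous_on UNIV f" "\<And>u. norm (f u) \<le> B"
  shows "integrable Jmeasure f"
proof (rule finite_measure.integrable_const_bound[OF finite_measure_Jmeasure, of _ B])
  show "f \<in> borel_measurable Jmeasure"
    by (rule measurable_restrict_space1) (use assms(1) in \<open>simp add: borel_measurable_continuous_onI\<close>)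
qed (use assms in auto)

text \<open>For n = 0 this is pi I0(z). The sign in \<open>- cos\<close> makes it a Laplace integral
  of the same shape as \<open>Kint\<close>.\<close>

definition Jint :: "nat \<Rightarrow> complex \<Rightarrow> complex" where
  "Jint n z = (\<integral>u. complex_of_real (- cos u) ^ n * exp (- z * complex_of_real (- cos u)) \<partial>Jmeasure)"

lemma norm_Jint_integrand_le:
  "norm (complex_of_real (- cos u) ^ n * exp (- z * complex_of_real (- cos u))) \<le> exp \<bar>Re z\<bar>"
proof -
  have "\<bar>- cos u\<bar> ^ n * exp (- Re z * - cos u) \<le> 1 * exp \<bar>Re z\<bar>"
  proof (rule mult_mono)
    have "Re z * cos u \<le> \<bar>Re z\<bar> * \<bar>cos u\<bar>" by (metis abs_ge_self abs_mult)
    also have "\<dots> \<le> \<bar>Re z\<bar> * 1" by (intro mult_left_mono) auto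
    finally show "exp (- Re z * - cos u) \<le> exp \<bar>Re z\<bar>" by simp
  qed (auto intro: power_le_one)
  thus ?thesis by (simp add: norm_mult norm_power)
qed

lemma integrable_cos_exp:
  "integrable Jmeasure (\<lambda>u. \<bar>- cos u\<bar> ^ n * exp (- x * - cos u))"
proof (rule integrable_Jmeasure)
  show "norm (\<bar>- cos u\<bar> ^ n * exp (- x * - cos u)) \<le> exp \<bar>x\<bar>" for u
    using norm_Jint_integrand_le[of u n "of_real x"] by (simp add: norm_mult norm_power)
qed (intro continuous_intros)

lemma integrable_Jint:
  "integrable Jmeasure (\<lambda>u. complex_of_real (- cos u) ^ n * exp (- z * complex_of_real (- cos u)))"
  by (rule integrable_Jmeasure[OF _ norm_Jint_integrand_le]) (intro continuous_intros)

lemma norm_Jint_le: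
  "norm (Jint n z) \<le> measure Jmeasure (space Jmeasure) * exp \<bar>Re z\<bar>"
proof -
  interpret finite_measure Jmeasure by (rule finite_measure_Jmeasure)
  have "norm (Jint n z) \<le> (\<integral>u. norm (complex_of_real (- cos u) ^ n * exp (- z * complex_of_real (- cos u))) \<partial>Jmeasure)"
    unfolding Jint_def by (rule integral_norm_bound)
  also have "\<dots> \<le> (\<integral>u. exp \<bar>Re z\<bar> \<partial>Jmeasure)"
    by (intro integral_mono integrable_norm integrable_Jint norm_Jint_integrand_le) simp
  finally show ?thesis by (simp add: mult_ac)
qed

lemma Jint_has_field_derivative:
  "Re z > 0 \<Longrightarrow> (Jint n has_field_derivative - Jint (Suc n) z) (at z)"
  unfolding Jint_def[abs_def]
  by (rule has_field_derivative_Laplace_moment)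
     (assumption | rule integrable_cos_exp measurable_restrict_space1 | simp)+

text \<open>The integrand of the combination is the derivative of
  \<open>sin u * exp (z * cos u)\<close>, which vanishes at 0 and pi.\<close>

lemma Jint_ode: "z * Jint 2 z - Jint 1 z = z * Jint 0 z"
proof -
  let ?f = "\<lambda>u. of_real (cos u) * exp (z * of_real (cos u)) - z * of_real (sin u) ^ 2 * exp (z * of_real (cos u))"
  have sc: "complex_of_real (sin u) ^ 2 = 1 - of_real (cos u) ^ 2" for u
    by (metis of_real_1 of_real_diff of_real_power sin_squared_eq)
  have eq: "?f u
     = z * (complex_of_real (- cos u) ^ 2 * exp (- z * complex_of_real (- cos u))) - complex_of_real (- cos u) ^ 1 * exp (- z * complex_of_real (- cos u))
       - z * (complex_of_real (- cos u) ^ 0 * exp (- z * complex_of_real (- cos u)))" for u :: real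
    by (simp add: sc algebra_simps)
  have "(LBINT u=ereal 0..ereal pi. ?f u)
          = of_real (sin pi) * exp (z * of_real (cos pi)) - of_real (sin 0) * exp (z * of_real (cos 0))"
  proof (rule interval_integral_FTC_finite[where F = "\<lambda>u. of_real (sin u) * exp (z * of_real (cos u))"])
    fix x :: real
    have S: "((\<lambda>u. complex_of_real (sin u)) has_vector_derivative of_real (cos x)) (at x)"
      by (intro has_vector_derivative_of_real) (auto intro!: derivative_eq_intros)
    have C: "((\<lambda>u. z * complex_of_real (cos u)) has_vector_derivative z * of_real (- sin x)) (at x)"
      by (intro has_vector_derivative_mult_right has_vector_derivative_of_real) (auto intro!: derivative_eq_intros)
    have E: "((\<lambda>u. exp (z * of_real (cos u))) has_vector_derivative (z * of_real (- sin x)) * exp (z * of_real (cos x))) (at x)"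
      using field_vector_diff_chain_at[OF C DERIV_exp] by (simp add: o_def)
    have "((\<lambda>u. of_real (sin u) * exp (z * of_real (cos u))) has_vector_derivative ?f x) (at x)"
      using has_vector_derivative_mult[OF S E] by (simp add: algebra_simps power2_eq_square)
    thus "((\<lambda>u. of_real (sin u) * exp (z * of_real (cos u))) has_vector_derivative ?f x) (at x within {min 0 pi..max 0 pi})"
      by (rule has_vector_derivative_at_within)
  qed (intro continuous_intros)
  hence "(LBINT u=ereal 0..ereal pi. ?f u) = 0"
    by simp
  moreover have hb: "has_bochner_integral Jmeasure (\<lambda>u. complex_of_real (- cos u) ^ n * exp (- z * complex_of_real (- cos u))) (Jint n z)" for n
    unfolding Jint_def by (rule has_bochner_integral_integrable[OF integrable_Jint])
  have "has_bochner_integral Jmeasure (\<lambda>u. z * (complex_of_real (- cos u) ^ 2 * exp (- z * complex_of_real (- cos u)))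
       - complex_of_real (- cos u) ^ 1 * exp (- z * complex_of_real (- cos u)) - z * (complex_of_real (- cos u) ^ 0 * exp (- z * complex_of_real (- cos u))))
     (z * Jint 2 z - Jint 1 z - z * Jint 0 z)"
    by (intro has_bochner_integral_diff has_bochner_integral_mult_right hb)
  hence "(LBINT u=ereal 0..ereal pi. ?f u)
     = z * Jint 2 z - Jint 1 z - z * Jint 0 z"
    unfolding eq integral_Jmeasure[symmetric]
    by (rule has_bochner_integral_integral_eq)
  ultimately show ?thesis by simp
qed

lemma Jint_sys: "bessel_sys right_half_plane (Jint 0) (\<lambda>z. - z * Jint 1 z)"
  unfolding bessel_sys_def
proof (intro ballI conjI)
  fix z assume "z \<in> {z. Re z > 0}"
  hence z: "Re z > 0" by simp
  hence nz: "z \<noteq> 0" by auto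
  show "(Jint 0 has_field_derivative (- z * Jint 1 z) / z) (at z)"
    using Jint_has_field_derivative[OF z, of 0] nz by simp
  have "((\<lambda>z. - z * Jint 1 z) has_field_derivative - Jint 1 z + z * Jint 2 z) (at z)"
    by (rule derivative_eq_intros Jint_has_field_derivative z refl)+ (simp add: numeral_2_eq_2)
  also have "- Jint 1 z + z * Jint 2 z = z * Jint 0 z" using Jint_ode[of z] by simp
  finally show "((\<lambda>z. - z * Jint 1 z) has_field_derivative z * Jint 0 z) (at z)" .
qed

lemma Jint_small: "((\<lambda>t. of_real t ^ m * Jint n (of_real t)) \<longlongrightarrow> 0) (at_right 0)" if "m > 0"
proof (rule Lim_null_comparison)
  have "((\<lambda>t. t ^ m * (measure Jmeasure (space Jmeasure) * exp t)) \<longlongrightarrow> 0 ^ m * (measure Jmeasure (space Jmeasure) * exp 0)) (at_right 0)"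
    by (intro tendsto_intros)
  thus "((\<lambda>t. t ^ m * (measure Jmeasure (space Jmeasure) * exp t)) \<longlongrightarrow> 0) (at_right 0)"
    unfolding zero_power[OF that] mult_zero_left .
  show "\<forall>\<^sub>F t in at_right 0. norm (of_real t ^ m * Jint n (of_real t)) \<le> t ^ m * (measure Jmeasure (space Jmeasure) * exp t)"
    unfolding eventually_at_filter
    by (intro always_eventually) (use norm_Jint_le[of n "of_real _"] in \<open>auto simp: norm_mult norm_power intro!: mult_left_mono order.trans[OF norm_Jint_le]\<close>)
qed

lemma wronskian_I_J: "Re z > 0 \<Longrightarrow> cI z * (- z * Jint 1 z) - Jint 0 z * cI1 z = 0"
proof (rule right_half_plane_wronskian[OF cI_sys_right_half_plane Jint_sys])
  have "((\<lambda>t. - (cI (of_real t) * (of_real t ^ 1 * Jint 1 (of_real t))) - Jint 0 (of_real t) * cI1 (of_real t)) \<longlongrightarrow> - (1 * 0) - 0) (at_right 0)"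
    by (intro tendsto_intros cI_tendsto Jint_small cI1_small) auto
  thus "((\<lambda>t. cI (of_real t) * (- of_real t * Jint 1 (of_real t)) - Jint 0 (of_real t) * cI1 (of_real t)) \<longlongrightarrow> 0) (at_right 0)" by simp
qed

lemma Jint_0_nonzero: "Jint 0 1 \<noteq> 0"
proof -
  interpret finite_measure Jmeasure by (rule finite_measure_Jmeasure)
  have "Jint 0 1 = (\<integral>u. complex_of_real (exp (cos u)) \<partial>Jmeasure)"
    unfolding Jint_def by (simp flip: exp_of_real)
  also have "\<dots> = of_real (\<integral>u. exp (cos u) \<partial>Jmeasure)" by (rule integral_complex_of_real)
  finally have 1: "Jint 0 1 = of_real (\<integral>u. exp (cos u) \<partial>Jmeasure)" .
  have "measure Jmeasure (space Jmeasure) = pi"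
    by (simp add: space_restrict_space measure_restrict_space)
  hence "exp (-1) * pi = (\<integral>u. exp (-1) \<partial>Jmeasure)" by simp
  also have "\<dots> \<le> (\<integral>u. exp (cos u) \<partial>Jmeasure)"
    using integrable_cos_exp[of 0 1] by (intro integral_mono) auto
  finally have "(\<integral>u. exp (cos u) \<partial>Jmeasure) > 0" by (rule less_le_trans[rotated]) simp
  thus ?thesis unfolding 1 by simp
qed

text \<open>Growth like \<open>exp (Re z)\<close> is hidden in the power series but evident in the
  integral. \<open>Jint 0\<close> is bounded near 0, so its Wronskian with \<open>cI\<close> is 0
  and it is a multiple of \<open>cI\<close>; the multiple is nonzero because \<open>Jint 0 1\<close>
  is.\<close>

lemma norm_cI_le: "\<exists>C. \<forall>z. Re z > 0 \<longrightarrow> norm (cI z) \<le> C * exp (Re z)"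
proof -
  obtain b where b: "\<And>z. Re z > 0 \<Longrightarrow> Jint 0 z * cY1 z - cY z * (- z * Jint 1 z) = b"
    using bessel_sys_wronskian_const[OF Jint_sys cY_sys_right_half_plane right_half_plane(1-3)] by auto
  have J: "Jint 0 z = - b * cI z" if "Re z > 0" for z
    using bessel_sys_decompose[where f = cI and ?f1.0 = cI1 and g = cY and ?g1.0 = cY1 and h = "Jint 0"
        and ?h1.0 = "\<lambda>z. - z * Jint 1 z", OF wronskian_I_Y wronskian_I_J b, OF that that that] by simp
  have "b \<noteq> 0" using J[of 1] Jint_0_nonzero by auto
  have "norm (cI z) \<le> measure Jmeasure (space Jmeasure) / norm b * exp (Re z)" if "Re z > 0" for z
  proof -
    have "norm (cI z) = norm (Jint 0 z) / norm b"
      using J[OF that] \<open>b \<noteq> 0\<close> by (simp add: norm_mult)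
    also have "\<dots> \<le> measure Jmeasure (space Jmeasure) * exp (Re z) / norm b"
      using norm_Jint_le[of 0 z] that by (intro divide_right_mono) auto
    finally show ?thesis by simp
  qed
  thus ?thesis by blast
qed

section \<open>The product of two Bessel functions\<close>

lemma bessel_I0_summable: "summable (\<lambda>n. (t / 2) ^ (2 * n) / (fact n)\<^sup>2 :: real)"
proof (rule summable_comparison_test')
  show "summable (\<lambda>n. (t\<^sup>2 / 4) ^ n /\<^sub>R fact n)"
    using exp_converges[of "t\<^sup>2 / 4"] by (simp add: sums_iff)
  fix n :: nat
  have eq: "(t / 2) ^ (2 * n) = (t\<^sup>2 / 4) ^ n" by (simp add: power_mult power_divide)
  have "fact n * 1 \<le> fact n * (fact n :: real)" by (intro mult_mono) auto
  hence "(t\<^sup>2 / 4) ^ n / (fact n)\<^sup>2 \<le> (t\<^sup>2 / 4) ^ n / fact n"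
    by (intro divide_left_mono) (auto simp: power2_eq_square)
  thus "norm ((t / 2) ^ (2 * n) / (fact n)\<^sup>2) \<le> (t\<^sup>2 / 4) ^ n /\<^sub>R fact n"
    unfolding eq by (simp add: field_simps)
qed

lemma bessel_I0_eq_cI: "of_real (bessel_I0 t) = cI (of_real t)"
proof -
  have "of_real (bessel_I0 t) = (\<Sum>n. complex_of_real ((t / 2) ^ (2 * n) / (fact n)\<^sup>2))"
    unfolding bessel_I0_def by (rule suminf_of_real[OF bessel_I0_summable])
  also have "\<dots> = cI (of_real t)"
    unfolding cI_def eval_fps_def
    by (intro suminf_cong) (simp add: I_fps_def power_mult power_divide)
  finally show ?thesis .
qed

lemma bessel_I0_ge_1: "bessel_I0 t \<ge> 1"
  using sum_le_suminf[OF bessel_I0_summable[of t], of "{0}"] by (simp add: bessel_I0_def)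

lemma bessel_K0_nonneg: "bessel_K0 t \<ge> 0"
  unfolding bessel_K0_def set_lebesgue_integral_def by (rule integral_nonneg_AE) simp

lemma cnj_eval_fps:
  assumes "fps_conv_radius (f :: complex fps) = \<infinity>" "\<And>n. cnj (fps_nth f n) = fps_nth f n"
  shows "cnj (eval_fps f z) = eval_fps f (cnj z)"
proof -
  have "(\<lambda>n. fps_nth f n * z ^ n) sums eval_fps f z"
    by (rule sums_eval_fps) (simp add: assms)
  hence "(\<lambda>n. cnj (fps_nth f n * z ^ n)) sums cnj (eval_fps f z)" by (simp only: sums_cnj)
  hence "(\<lambda>n. fps_nth f n * cnj z ^ n) sums cnj (eval_fps f z)" by (simp add: assms)
  thus ?thesis unfolding eval_fps_def by (simp add: sums_iff)
qed

lemma cI_cnj: "cI (cnj z) = cnj (cI z)"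
  unfolding cI_def by (subst cnj_eval_fps[OF fps_conv_radius_I_fps]) (auto simp: I_fps_def)

lemma cE_cnj: "cE (cnj z) = cnj (cE z)"
proof -
  have "cnj (harm n :: complex) = harm n" for n
    by (metis complex_cnj_complex_of_real of_real_harm)
  thus ?thesis
    unfolding cE_def by (subst cnj_eval_fps[OF fps_conv_radius_E_fps]) (auto simp: E_fps_def)
qed

lemma cI_minus: "cI (- z) = cI z" and cE_minus: "cE (- z) = cE z"
  by (auto simp: cI_def cE_def)

text \<open>
  Numerically \<open>kappa\<close> is \<open>ln 2\<close> minus Euler's constant; only its being real matters here, since it
  makes \<open>cK\<close> and \<open>cH\<close> conjugate under the reflection \<open>z \<mapsto> -cnj z\<close>.
\<close>

definition kappa :: real where "kappa = (bessel_K0 1 - Re (cE 1)) / Re (cI 1)"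

definition cK :: "complex \<Rightarrow> complex" where "cK z = cY z + of_real kappa * cI z"
definition cK1 :: "complex \<Rightarrow> complex" where "cK1 z = cY1 z + of_real kappa * cI1 z"
definition cH :: "complex \<Rightarrow> complex" where "cH z = cK z + \<i> * of_real pi * cI z"
definition cH1 :: "complex \<Rightarrow> complex" where "cH1 z = cK1 z + \<i> * of_real pi * cI1 z"

text \<open>The coefficient of \<open>cI\<close> is found at z = 1, where the logarithm vanishes and
  all other values are real.\<close>

lemma Kint_eq_cK:
  assumes "Re z > 0"
  shows "Kint 0 z = cK z"
proof -
  obtain b where b: "\<And>z. Re z > 0 \<Longrightarrow> Kint 0 z = cY z + b * cI z"
    using Kint_eq_basis by blast
  have I: "cI 1 = of_real (bessel_I0 1)" using bessel_I0_eq_cI[of 1] by simp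
  have E: "cE 1 = of_real (Re (cE 1))"
    using cE_cnj[of 1] by (simp add: complex_eq_iff)
  have "bessel_I0 1 > 0" using bessel_I0_ge_1[of 1] by linarith
  have "complex_of_real (bessel_K0 1) = cE 1 + b * cI 1"
    using b[of 1] bessel_K0_eq_Kint[of 1] by (simp add: cY_def)
  hence "b = of_real kappa"
    using \<open>bessel_I0 1 > 0\<close> E I by (simp add: kappa_def field_simps)
  thus ?thesis using b[OF assms] by (simp add: cK_def)
qed

lemma bessel_K0_eq_cK: "t > 0 \<Longrightarrow> of_real (bessel_K0 t) = cK (of_real t)"
  using Kint_eq_cK[of "of_real t"] bessel_K0_eq_Kint[of t] by simp

abbreviation "slit \<equiv> - (\<real>\<^sub>\<le>\<^sub>0 :: complex set)"

lemma bessel_sys_lincomb: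
  assumes "bessel_sys S f f1" "bessel_sys S g g1"
  shows "bessel_sys S (\<lambda>z. f z + c * g z) (\<lambda>z. f1 z + c * g1 z)"
  unfolding bessel_sys_def
proof (intro ballI conjI)
  fix z assume "z \<in> S"
  hence d: "(f has_field_derivative f1 z / z) (at z)" "(f1 has_field_derivative z * f z) (at z)"
      "(g has_field_derivative g1 z / z) (at z)" "(g1 has_field_derivative z * g z) (at z)"
    using assms by (auto simp: bessel_sys_def)
  show "((\<lambda>z. f z + c * g z) has_field_derivative (f1 z + c * g1 z) / z) (at z)"
    by (rule derivative_eq_intros d refl)+ (simp add: add_divide_distrib)
  show "((\<lambda>z. f1 z + c * g1 z) has_field_derivative z * (f z + c * g z)) (at z)"
    by (rule derivative_eq_intros d refl)+ (simp add: algebra_simps)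
qed

lemma cI_sys_slit: "bessel_sys slit cI cI1"
  by (rule bessel_sys_mono[OF cI_sys]) auto

lemma cK_sys: "bessel_sys slit cK cK1"
  using bessel_sys_lincomb[OF cY_sys cI_sys_slit, of "of_real kappa"]
  by (simp add: cK_def[abs_def] cK1_def[abs_def])

lemma cH_sys: "bessel_sys slit cH cH1"
  using bessel_sys_lincomb[OF cK_sys cI_sys_slit, of "\<i> * of_real pi"]
  by (simp add: cH_def[abs_def] cH1_def[abs_def])

text \<open>
  In the upper half plane \<open>cH z = K\<^sub>0(-z)\<close>, so that \<open>cP z = K\<^sub>0(z) K\<^sub>0(-z)\<close>.
\<close>

definition cP :: "complex \<Rightarrow> complex" where "cP z = cK z * cH z"
text \<open>\<open>cQ\<close> and \<open>cU\<close> are \<theta> P and \<theta>^2 P, with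
  derivatives of the factors eliminated by the Bessel system.\<close>

definition cQ :: "complex \<Rightarrow> complex" where "cQ z = cK1 z * cH z + cK z * cH1 z"
definition cU :: "complex \<Rightarrow> complex" where "cU z = 2 * z\<^sup>2 * cP z + 2 * cK1 z * cH1 z"

text \<open>The last claim is \<theta>^3 P = 4 z^2 (P + \<theta> P), the equation satisfied by all
  products of two solutions of the Bessel equation (its symmetric square).\<close>

lemma cP_derivs:
  assumes z: "z \<in> slit"
  shows "(cP has_field_derivative cQ z / z) (at z)" "(cQ has_field_derivative cU z / z) (at z)"
    "(cU has_field_derivative 4 * z * (cP z + cQ z)) (at z)"
proof -
  have nz: "z \<noteq> 0" using z by auto
  have d: "(cK has_field_derivative cK1 z / z) (at z)" "(cK1 has_field_derivative z * cK z) (at z)"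
      "(cH has_field_derivative cH1 z / z) (at z)" "(cH1 has_field_derivative z * cH z) (at z)"
    using z cK_sys cH_sys by (auto simp: bessel_sys_def)
  show P: "(cP has_field_derivative cQ z / z) (at z)"
    unfolding cP_def[abs_def] cQ_def by (rule derivative_eq_intros d refl)+ (use nz in \<open>simp add: field_simps\<close>)
  show "(cQ has_field_derivative cU z / z) (at z)"
    unfolding cQ_def[abs_def] cU_def cP_def by (rule derivative_eq_intros d refl)+ (use nz in \<open>simp add: field_simps power2_eq_square\<close>)
  show "(cU has_field_derivative 4 * z * (cP z + cQ z)) (at z)"
    unfolding cU_def[abs_def] by (rule derivative_eq_intros P d refl)+ (use nz in \<open>simp add: cQ_def cP_def field_simps power2_eq_square\<close>)
qed

lemma cP_holomorphic: "cP holomorphic_on slit"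
  using cP_derivs(1) by (intro holomorphic_on_open[THEN iffD2]) auto

text \<open>
  A first integral of the third-order equation of \<open>cP\<close> (the squared Wronskian); it determines the
  leading coefficient at infinity up to sign.
\<close>

lemma cP_invariant:
  assumes "Re z > 0"
  shows "cQ z ^ 2 + of_real pi ^ 2 = 2 * cP z * (cU z - 2 * z\<^sup>2 * cP z)"
proof -
  have W: "\<And>z. Re z > 0 \<Longrightarrow> cI z * cK1 z - cK z * cI1 z = -1"
  proof -
    fix z :: complex assume z: "Re z > 0"
    show "cI z * cK1 z - cK z * cI1 z = -1"
      using wronskian_I_Y[OF z] by (simp add: cK_def cK1_def algebra_simps)
  qed
  have "cK z * cH1 z - cH z * cK1 z = - \<i> * of_real pi * (cI z * cK1 z - cK z * cI1 z)"
    by (simp add: cH_def cH1_def algebra_simps)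
  hence "cK z * cH1 z - cH z * cK1 z = \<i> * of_real pi" using W[OF assms] by simp
  hence "(cK z * cH1 z - cH z * cK1 z) ^ 2 = - (of_real pi ^ 2)" by (simp add: power_mult_distrib)
  \<comment> \<open>Square of a sum minus square of a difference:
    \<open>4 * cK z * cH z * cK1 z * cH1 z\<close>, where \<open>2 * cK1 z * cH1 z\<close> is
    \<open>cU z - 2 * z\<^sup>2 * cP z\<close>.\<close>
  moreover have "cQ z ^ 2 - (cK z * cH1 z - cH z * cK1 z) ^ 2 = 2 * cP z * (cU z - 2 * z\<^sup>2 * cP z)"
    by (simp add: cQ_def cU_def cP_def power2_eq_square algebra_simps)
  ultimately show ?thesis by simp
qed

text \<open>\<open>cI\<close> and \<open>cE\<close> are even with real coefficients, so the
  reflection only conjugates them. The logarithm picks up an additional \<i> pi, which is the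
  difference between \<open>cK\<close> and \<open>cH\<close>.\<close>

lemma cK_reflect:
  assumes "Im z > 0"
  shows "cK (- cnj z) = cnj (cH z)" "cH (- cnj z) = cnj (cK z)"
proof -
  have z: "z \<noteq> 0" "z \<notin> \<real>\<^sub>\<le>\<^sub>0" using assms by (auto simp: complex_nonpos_Reals_iff)
  have "Ln (- cnj z) = cnj (Ln z) + \<i> * of_real pi"
    using Ln_minus[of "cnj z"] assms z cnj_Ln[OF z(2)] by simp
  thus 1: "cK (- cnj z) = cnj (cH z)"
    by (simp add: cK_def cH_def cY_def cI_minus cE_minus cI_cnj cE_cnj algebra_simps)
  show "cH (- cnj z) = cnj (cK z)"
    unfolding cH_def[of "- cnj z"] 1 by (simp add: cH_def cI_minus cI_cnj)
qed

lemma cP_reflect: "Im z > 0 \<Longrightarrow> cP (- cnj z) = cnj (cP z)"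
  by (simp add: cP_def cK_reflect mult_ac)

text \<open>The points of this half axis are fixed by the reflection z \<mapsto> -cnj z.\<close>

lemma cP_imaginary_axis:
  assumes "y > 0"
  shows "cP (\<i> * of_real y) \<in> \<real>"
proof -
  have "cP (\<i> * of_real y) = cnj (cP (\<i> * of_real y))"
    using cP_reflect[of "\<i> * of_real y"] assms by simp
  thus ?thesis by (metis Reals_cnj_iff)
qed

section \<open>Boundedness of the product\<close>

lemma norm_cK_le: "\<exists>C. \<forall>z. Re z \<ge> 1 \<longrightarrow> norm (cK z) \<le> C * exp (- Re z)"
proof -
  define C where "C = exp 1 * (\<integral>u. exp (- 1 * cosh u) \<partial>half_line)"
  have "norm (cK z) \<le> C * exp (- Re z)" if z: "Re z \<ge> 1" for z
  proof -
    have "norm (cK z) \<le> (\<integral>u. cosh u ^ 0 * exp (- Re z * cosh u) \<partial>half_line)"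
      using norm_Kint_le[of z 0] Kint_eq_cK[of z] z by simp
    also have "\<dots> \<le> (\<integral>u. exp (- (Re z - 1)) * exp (- 1 * cosh u) \<partial>half_line)"
    proof (rule integral_mono)
      show "integrable half_line (\<lambda>u. cosh u ^ 0 * exp (- Re z * cosh u))"
        using integrable_cosh_exp[of "Re z" 0] z by simp
      show "integrable half_line (\<lambda>u. exp (- (Re z - 1)) * exp (- 1 * cosh u))"
        using integrable_cosh_exp[of 1 0] by simp
      fix u :: real
      have "(Re z - 1) * 1 \<le> (Re z - 1) * cosh u"
        using z by (intro mult_left_mono) (auto simp: cosh_real_ge_1)
      thus "cosh u ^ 0 * exp (- Re z * cosh u) \<le> exp (- (Re z - 1)) * exp (- 1 * cosh u)"
        by (simp add: algebra_simps flip: exp_add)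
    qed
    also have "\<dots> = exp (- (Re z - 1)) * (\<integral>u. exp (- 1 * cosh u) \<partial>half_line)"
      by (rule integral_mult_right_zero)
    also have "\<dots> = C * exp (- Re z)" by (simp add: C_def exp_diff exp_minus field_simps)
    finally show ?thesis .
  qed
  thus ?thesis by blast
qed

text \<open>The decay of \<open>cK\<close> like \<open>exp (- Re z)\<close> compensates the growth
  of \<open>cH\<close> like \<open>exp (Re z)\<close>.\<close>

lemma cP_bounded_right: "\<exists>C>0. \<forall>z. Re z \<ge> 1 \<longrightarrow> norm (cP z) \<le> C"
proof -
  obtain A where A: "\<And>z. Re z \<ge> 1 \<Longrightarrow> norm (cK z) \<le> A * exp (- Re z)" using norm_cK_le by blast
  obtain B where B: "\<And>z. Re z > 0 \<Longrightarrow> norm (cI z) \<le> B * exp (Re z)" using norm_cI_le by blast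
  have pos: "A \<ge> 0" "B \<ge> 0"
    using order.trans[OF norm_ge_zero A[of 1]] order.trans[OF norm_ge_zero B[of 1]] by (auto simp: zero_le_mult_iff)
  have "norm (cP z) \<le> A * (A + pi * B) + 1" if z: "Re z \<ge> 1" for z
  proof -
    have "norm (cH z) \<le> norm (cK z) + pi * norm (cI z)"
      unfolding cH_def by (rule order.trans[OF norm_triangle_ineq]) (simp add: norm_mult)
    also have "norm (cK z) \<le> A * exp (Re z)"
      using A[OF z] z pos by (smt (verit) exp_le_cancel_iff mult_left_mono)
    also have "pi * norm (cI z) \<le> pi * (B * exp (Re z))"
      using B[of z] z by (intro mult_left_mono) auto
    finally have H: "norm (cH z) \<le> (A + pi * B) * exp (Re z)" by (simp add: algebra_simps)
    have "norm (cP z) \<le> (A * exp (- Re z)) * ((A + pi * B) * exp (Re z))"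
      unfolding cP_def norm_mult using A[OF z] H pos by (intro mult_mono) auto
    also have "\<dots> = A * (A + pi * B)" by (simp add: exp_minus field_simps)
    finally show ?thesis by simp
  qed
  moreover have "A * (A + pi * B) + 1 > 0" using pos by (intro add_nonneg_pos) auto
  ultimately show ?thesis by blast
qed

lemma norm_eval_fps_le_exp:
  assumes "\<And>n. norm (fps_nth f n) \<le> 1 / fact n"
  shows "norm (eval_fps (f :: complex fps) z) \<le> exp (norm z)"
proof -
  have s: "(\<lambda>n. norm z ^ n /\<^sub>R fact n) sums exp (norm z)" by (rule exp_converges)
  have le: "norm (fps_nth f n * z ^ n) \<le> norm z ^ n /\<^sub>R fact n" for n
    using mult_right_mono[OF assms[of n], of "norm z ^ n"] by (simp add: norm_mult norm_power field_simps)
  have "norm (eval_fps f z) \<le> (\<Sum>n. norm z ^ n /\<^sub>R fact n)"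
    unfolding eval_fps_def using s by (intro norm_suminf_le le) (simp add: sums_iff)
  thus ?thesis using s by (simp add: sums_iff)
qed

lemma norm_cI_le_exp_square: "norm (cI z) \<le> exp (norm z ^ 2 / 4)"
  and norm_cE_le_exp_square: "norm (cE z) \<le> exp (norm z ^ 2 / 4)"
  using norm_eval_fps_le_exp[OF norm_I_fps_nth_le, of "z\<^sup>2 / 4"]
    norm_eval_fps_le_exp[OF norm_E_fps_nth_le, of "z\<^sup>2 / 4"]
  by (simp_all add: cI_def cE_def norm_divide norm_power)

lemma norm_Ln_le: "z \<noteq> 0 \<Longrightarrow> norm (Ln z) \<le> \<bar>ln (norm z)\<bar> + pi"
  using cmod_le[of "Ln z"] Im_Ln_le_pi[of z] mpi_less_Im_Ln[of z] by (simp add: Re_Ln)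

text \<open>An a priori growth bound in all directions, with no cancellation used; it is the growth
  hypothesis for \<open>Phragmen_Lindelof_half_strip\<close>.\<close>

lemma norm_cK_le_exp_square:
  "\<exists>A>0. \<forall>z. norm z \<ge> 1 \<longrightarrow> norm (cK z) \<le> A * exp (norm z ^ 2) \<and> norm (cH z) \<le> A * exp (norm z ^ 2)"
proof -
  define A where "A = 5 + 2 * pi + \<bar>kappa\<bar>"
  have "norm (cK z) \<le> (5 + pi + \<bar>kappa\<bar>) * exp (norm z ^ 2) \<and> norm (cH z) \<le> A * exp (norm z ^ 2)"
    if z: "norm z \<ge> 1" for z
  proof -
    \<comment> \<open>\<open>cI\<close> and \<open>cE\<close> are bounded by \<open>e\<close>, and
      \<open>Ln\<close> by a multiple of it through ln |z| \<le> |z| \<le> |z|^2 \<le> 4 e. Products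
      of two of them stay below a multiple of e^2.\<close>
    define e where "e = exp (norm z ^ 2 / 4)"
    have e1: "e \<ge> 1" by (simp add: e_def)
    have "exp (norm z ^ 2) = e ^ 4" by (simp add: e_def flip: exp_of_nat_mult)
    have e2: "e \<le> e ^ 2" "e ^ 2 \<le> e ^ 4" using e1 by (simp_all add: power_increasing[of 1 2 e, simplified] power_increasing)
    have "norm (Ln z) \<le> ln (norm z) + pi" using norm_Ln_le[of z] z by (cases "z = 0") auto
    also have "ln (norm z) \<le> norm z" using ln_le_minus_one[of "norm z"] z by (cases "z = 0") auto
    also have "norm z \<le> norm z ^ 2" using power_increasing[of 1 2 "norm z"] z by simp
    also have "norm z ^ 2 \<le> 4 * e" using exp_ge_add_one_self[of "norm z ^ 2 / 4"] unfolding e_def by linarith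
    finally have "norm (Ln z) \<le> 4 * e + pi" by simp
    moreover have "1 * pi \<le> e * pi" using e1 by (intro mult_right_mono) auto
    ultimately have "norm (Ln z) \<le> e * (4 + pi)" unfolding distrib_left by linarith
    moreover have I: "norm (cI z) \<le> e" and E: "norm (cE z) \<le> e"
      using norm_cI_le_exp_square norm_cE_le_exp_square by (simp_all add: e_def)
    ultimately have LI: "norm (Ln z * cI z) \<le> (e * (4 + pi)) * e"
      unfolding norm_mult using e1 by (intro mult_mono) auto
    have "norm (cK z) \<le> norm (cE z) + norm (Ln z * cI z) + \<bar>kappa\<bar> * norm (cI z)"
      unfolding cK_def cY_def
      by (rule order.trans[OF norm_triangle_ineq] add_mono norm_triangle_ineq4)+ (simp add: norm_mult)
    also have "\<dots> \<le> e ^ 2 + (e * (4 + pi)) * e + \<bar>kappa\<bar> * e ^ 2"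
      using LI I E e2 by (intro add_mono mult_left_mono) auto
    also have "\<dots> = (5 + pi + \<bar>kappa\<bar>) * e ^ 2" by (simp add: power2_eq_square algebra_simps)
    also have "\<dots> \<le> (5 + pi + \<bar>kappa\<bar>) * e ^ 4" using e2 by (intro mult_left_mono) auto
    finally have K: "norm (cK z) \<le> (5 + pi + \<bar>kappa\<bar>) * e ^ 4" .
    have "norm (cH z) \<le> norm (cK z) + pi * norm (cI z)"
      unfolding cH_def by (rule order.trans[OF norm_triangle_ineq]) (simp add: norm_mult)
    also have "\<dots> \<le> (5 + pi + \<bar>kappa\<bar>) * e ^ 4 + pi * e ^ 4"
      using K I e2 by (intro add_mono mult_left_mono) auto
    also have "\<dots> = A * e ^ 4" by (simp add: A_def algebra_simps)
    finally show ?thesis using K \<open>exp (norm z ^ 2) = e ^ 4\<close> by simp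
  qed
  moreover have "5 + pi + \<bar>kappa\<bar> \<le> A" by (simp add: A_def)
  ultimately have "norm (cK z) \<le> A * exp (norm z ^ 2) \<and> norm (cH z) \<le> A * exp (norm z ^ 2)"
    if "norm z \<ge> 1" for z
    using that by (meson exp_ge_zero mult_right_mono order_trans)
  moreover have "A > 0" using pi_gt_zero by (simp add: A_def add_pos_nonneg)
  ultimately show ?thesis by blast
qed

text \<open>
  The damping factor is \<open>exp(-e z\<^sup>4)\<close>: on the strip the real part of \<open>z\<^sup>4\<close> is at least \<open>-9\<close> and grows
  like \<open>(Im z)\<^sup>4\<close>, which beats the crude bound \<open>exp(B |z|\<^sup>2)\<close> read off the power series.
\<close>

lemma Phragmen_Lindelof_half_strip:
  fixes f :: "complex \<Rightarrow> complex"
  assumes hol: "f holomorphic_on {z. Im z > 0}"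
    and growth: "\<And>z. \<bar>Re z\<bar> \<le> 1 \<Longrightarrow> Im z \<ge> 1 \<Longrightarrow> norm (f z) \<le> A * exp (B * norm z ^ 2)"
    and bound: "\<And>z. \<bar>Re z\<bar> \<le> 1 \<Longrightarrow> Im z \<ge> 1 \<Longrightarrow> \<bar>Re z\<bar> = 1 \<or> Im z = 1 \<Longrightarrow> norm (f z) \<le> M"
    and pos: "M > 0" "A > 0" "B > 0"
    and z0: "\<bar>Re z0\<bar> \<le> 1" "Im z0 \<ge> 1"
  shows "norm (f z0) \<le> M"
proof -
  have Re4: "Re (z ^ 4) = (Im z) ^ 4 - 6 * (Re z) ^ 2 * (Im z) ^ 2 + (Re z) ^ 4" for z
  proof -
    have "z ^ 4 = (z * z) * (z * z)" by (simp add: power4_eq_xxxx mult_ac)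
    thus ?thesis by (simp add: power4_eq_xxxx power2_eq_square) (simp add: algebra_simps)
  qed
  have Re4_ge: "Re (z ^ 4) \<ge> (Im z) ^ 4 - 6 * (Im z) ^ 2" if "\<bar>Re z\<bar> \<le> 1" for z
  proof -
    have "(Re z) ^ 2 \<le> 1" using that by (simp add: abs_square_le_1)
    hence "(Re z) ^ 2 * (Im z) ^ 2 \<le> 1 * (Im z) ^ 2" by (intro mult_right_mono) auto
    moreover have "(Re z) ^ 4 \<ge> 0" by simp
    ultimately show ?thesis unfolding Re4 by linarith
  qed
  have Re4_ge': "Re (z ^ 4) \<ge> - 9" if "\<bar>Re z\<bar> \<le> 1" for z
  proof -
    have "(Im z) ^ 4 - 6 * (Im z) ^ 2 + 9 = ((Im z) ^ 2 - 3) ^ 2"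
      by (simp add: power2_eq_square power4_eq_xxxx algebra_simps)
    moreover have "((Im z) ^ 2 - 3) ^ 2 \<ge> 0" by simp
    ultimately show ?thesis using Re4_ge[OF that] by linarith
  qed
  have eps: "norm (f z0) \<le> M * exp (e * (9 + Re (z0 ^ 4)))" if e: "e > 0" for e :: real
  proof -
    define g where "g = (\<lambda>z. f z * exp (- of_real e * z ^ 4))"
    have ng: "norm (g z) = norm (f z) * exp (- e * Re (z ^ 4))" for z
      by (simp add: g_def norm_mult)
    \<comment> \<open>The quartic damping beats the quadratic growth, so a top edge at a
      sufficiently large height \<open>Y\<close> satisfies the bound \<open>M\<close> as
      well.\<close>
    have "filterlim (\<lambda>y. A * exp (B * (1 + y\<^sup>2)) * exp (- e * (y ^ 4 - 6 * y ^ 2))) (nhds 0) at_top"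
      using e pos by real_asymp
    hence "\<forall>\<^sub>F y in at_top. A * exp (B * (1 + y\<^sup>2)) * exp (- e * (y ^ 4 - 6 * y ^ 2)) < M"
      using order_tendstoD(2) pos by blast
    from eventually_conj[OF this eventually_gt_at_top[of "Im z0"]]
    obtain Y where Y: "A * exp (B * (1 + Y\<^sup>2)) * exp (- e * (Y ^ 4 - 6 * Y ^ 2)) < M" "Y > Im z0"
      by (auto simp: eventually_at_top_linorder)
    define S where "S = cbox (Complex (-1) 1) (Complex 1 Y)"
    have S_sub: "S \<subseteq> {z. Im z > 0}" by (auto simp: S_def in_cbox_complex_iff)
    have holg: "g holomorphic_on {z. Im z > 0}"
      unfolding g_def by (intro holomorphic_intros hol)
    have "norm (g z0) \<le> M * exp (9 * e)"
    proof (rule maximum_modulus_frontier[of g S])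
      show "g holomorphic_on interior S"
        using holg S_sub interior_subset[of S] by (meson holomorphic_on_subset order_trans)
      show "continuous_on (closure S) g"
        using holomorphic_on_imp_continuous_on[OF holg] S_sub
        by (auto simp: S_def intro: continuous_on_subset)
      show "bounded S" by (simp add: S_def)
      show "z0 \<in> S" using z0 Y by (auto simp: S_def in_cbox_complex_iff)
      fix z assume "z \<in> frontier S"
      hence z: "z \<in> S" "z \<notin> box (Complex (-1) 1) (Complex 1 Y)"
        by (auto simp: S_def frontier_def interior_cbox)
      hence z1: "\<bar>Re z\<bar> \<le> 1" "Im z \<ge> 1" "Im z \<le> Y" "\<bar>Re z\<bar> = 1 \<or> Im z = 1 \<or> Im z = Y"
        by (auto simp: S_def in_cbox_complex_iff in_box_complex_iff)
      show "norm (g z) \<le> M * exp (9 * e)"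
      proof (cases "Im z = Y")
        case True
        have "norm z ^ 2 \<le> 1 + Y\<^sup>2"
          using z1(1) True by (simp add: cmod_power2 abs_square_le_1)
        hence "norm (f z) \<le> A * exp (B * (1 + Y\<^sup>2))"
          using pos by (intro order.trans[OF growth[OF z1(1,2)]]) auto
        moreover have "exp (- e * Re (z ^ 4)) \<le> exp (- e * (Y ^ 4 - 6 * Y ^ 2))"
          using Re4_ge[OF z1(1)] e True by simp
        ultimately have "norm (g z) \<le> A * exp (B * (1 + Y\<^sup>2)) * exp (- e * (Y ^ 4 - 6 * Y ^ 2))"
          unfolding ng using pos by (intro mult_mono) auto
        also have "\<dots> \<le> M" using Y by simp
        also have "M \<le> M * exp (9 * e)" using pos e by simp
        finally show ?thesis .
      next
        case False
        have "exp (- e * Re (z ^ 4)) \<le> exp (9 * e)"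
          using mult_left_mono[OF Re4_ge'[OF z1(1)], of e] e by simp
        thus ?thesis unfolding ng using bound[OF z1(1,2)] z1(4) False pos
          by (intro mult_mono) auto
      qed
    qed
    hence "norm (f z0) \<le> M * exp (9 * e) * exp (e * Re (z0 ^ 4))"
      unfolding ng by (simp add: exp_minus field_simps)
    also have "\<dots> = M * exp (e * (9 + Re (z0 ^ 4)))" by (simp add: algebra_simps exp_add)
    finally show ?thesis .
  qed
  \<comment> \<open>The height of the rectangle depends on \<open>e\<close>, but the inequality
    obtained at the fixed point \<open>z0\<close> no longer mentions it, so \<open>e\<close> may
    tend to 0.\<close>
  have "((\<lambda>e. M * exp (e * (9 + Re (z0 ^ 4)))) \<longlongrightarrow> M * exp (0 * (9 + Re (z0 ^ 4)))) (at_right 0)"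
    by (intro tendsto_intros)
  moreover have "\<forall>\<^sub>F e in at_right 0. norm (f z0) \<le> M * exp (e * (9 + Re (z0 ^ 4)))"
    using eps by (auto simp: eventually_at_filter)
  ultimately have "norm (f z0) \<le> M * exp (0 * (9 + Re (z0 ^ 4)))"
    by (intro tendsto_lowerbound[of _ _ "at_right 0"]) auto
  thus ?thesis by simp
qed

lemma upper_half_subset_slit: "{z. Im z > 0} \<subseteq> slit"
  by (auto simp: complex_nonpos_Reals_iff)

lemma cP_bounded: "\<exists>C. \<forall>z. Re z \<ge> 1 \<or> Im z \<ge> 1 \<longrightarrow> norm (cP z) \<le> C"
proof -
  obtain C where C: "C > 0" "\<And>z. Re z \<ge> 1 \<Longrightarrow> norm (cP z) \<le> C"
    using cP_bounded_right by blast
  have Cl: "norm (cP z) \<le> C" if "Re z \<le> -1" "Im z > 0" for z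
    using cP_reflect[OF that(2)] C(2)[of "- cnj z"] that by simp
  \<comment> \<open>The bottom edge of the half strip, where a bound comes from compactness. On the
    vertical edges \<open>C\<close> serves.\<close>
  define L where "L = closed_segment (Complex (-1) 1) (Complex 1 1)"
  have "Im z = 1" if "z \<in> L" for z
    using that by (auto simp: L_def closed_segment_def)
  hence "continuous_on L cP"
    using holomorphic_on_imp_continuous_on[OF cP_holomorphic] upper_half_subset_slit
    by (force intro: continuous_on_subset)
  hence "bounded (cP ` L)" by (intro compact_imp_bounded compact_continuous_image) (auto simp: L_def)
  then obtain D where D: "D > 0" "\<And>z. z \<in> L \<Longrightarrow> norm (cP z) \<le> D"
    by (auto simp: bounded_pos)
  have L: "z \<in> L" if "\<bar>Re z\<bar> \<le> 1" "Im z = 1" for z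
    unfolding L_def closed_segment_def using that
    by (auto intro!: exI[of _ "(Re z + 1) / 2"] simp: complex_eq_iff field_simps)
  obtain A where A: "A > 0" "\<And>z. norm z \<ge> 1 \<Longrightarrow> norm (cK z) \<le> A * exp (norm z ^ 2) \<and> norm (cH z) \<le> A * exp (norm z ^ 2)"
    using norm_cK_le_exp_square by blast
  have strip: "norm (cP z) \<le> max C D" if z: "\<bar>Re z\<bar> \<le> 1" "Im z \<ge> 1" for z
  proof (rule Phragmen_Lindelof_half_strip[of cP "A * A" 2, OF _ _ _ _ _ _ z])
    show "cP holomorphic_on {z. Im z > 0}"
      using cP_holomorphic upper_half_subset_slit holomorphic_on_subset by blast
    show "norm (cP z) \<le> A * A * exp (2 * norm z ^ 2)" if "\<bar>Re z\<bar> \<le> 1" "Im z \<ge> 1" for z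
    proof -
      have "norm z \<ge> 1" using that abs_Im_le_cmod[of z] by linarith
      hence "norm (cP z) \<le> (A * exp (norm z ^ 2)) * (A * exp (norm z ^ 2))"
        unfolding cP_def norm_mult using A by (intro mult_mono) auto
      also have "\<dots> = A * A * exp (2 * norm z ^ 2)" by (simp only: mult_2 exp_add mult_ac)
      finally show ?thesis .
    qed
    show "norm (cP z) \<le> max C D" if "\<bar>Re z\<bar> \<le> 1" "Im z \<ge> 1" "\<bar>Re z\<bar> = 1 \<or> Im z = 1" for z
      using C(2)[of z] Cl[of z] D(2)[OF L[of z]] that by (auto simp: le_max_iff_disj abs_if split: if_splits)
  qed (use A C in auto)
  have "norm (cP z) \<le> max C D" if "Re z \<ge> 1 \<or> Im z \<ge> 1" for z
    using C(2)[of z] Cl[of z] strip[of z] that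
    by (cases "Re z \<ge> 1"; cases "Re z \<le> -1") (auto simp: le_max_iff_disj)
  thus ?thesis by blast
qed

section \<open>Asymptotics in sectors\<close>

text \<open>
  The sectors are slightly larger than the closed first quadrant, which leaves room for Cauchy's
  estimate on discs of radius proportional to \<open>norm z\<close>. Describing them by two linear inequalities
  makes them convex cones.
\<close>

definition sector :: "real \<Rightarrow> complex set" where
  "sector c = {z. Re z + c * Im z \<ge> 0 \<and> Im z + c * Re z \<ge> 0}"

definition at_sector :: "real \<Rightarrow> complex filter" where
  "at_sector c = inf at_infinity (principal (sector c))"

lemma eventually_at_sector: "eventually P (at_sector c) \<longleftrightarrow> (\<exists>R. \<forall>z\<in>sector c. norm z \<ge> R \<longrightarrow> P z)"
  unfolding at_sector_def eventually_inf_principal eventually_at_infinity by auto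

text \<open>If one coordinate is negative, it is at most half as large as the other in absolute
  value; then \<open>Re z + Im z\<close> is at least one half and \<open>norm z\<close> at most
  three halves of the larger one, whence the 3. This makes a linear form a substitute for the
  norm.\<close>

lemma sector_norm_le:
  assumes "z \<in> sector c" "0 \<le> c" "c \<le> 1 / 2"
  shows "norm z / 3 \<le> Re z + Im z"
proof -
  have n: "norm z \<le> \<bar>Re z\<bar> + \<bar>Im z\<bar>" by (rule cmod_le)
  have c: "c * x \<le> x / 2" if "x \<ge> 0" for x using mult_right_mono[OF assms(3) that] by simp
  have p: "Re z + c * Im z \<ge> 0" "Im z + c * Re z \<ge> 0" using assms by (auto simp: sector_def)
  have m: "c * x \<le> 0" if "x \<le> 0" for x using assms that by (simp add: mult_nonneg_nonpos)
  consider "Re z \<ge> 0" "Im z \<ge> 0" | "Re z \<le> 0" "Im z \<ge> 0" | "Re z \<ge> 0" "Im z \<le> 0" | "Re z \<le> 0" "Im z \<le> 0"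
    by linarith
  thus ?thesis
  proof cases
    case 1 thus ?thesis using n by linarith
  next
    case 2 thus ?thesis using n p c[OF 2(2)] by linarith
  next
    case 3 thus ?thesis using n p c[OF 3(1)] by linarith
  next
    case 4 thus ?thesis using n p m[OF 4(1)] m[OF 4(2)] by linarith
  qed
qed

lemma sector_subset_slit:
  assumes "0 \<le> c" "c \<le> 1 / 2" "z \<in> sector c" "z \<noteq> 0"
  shows "z \<in> slit"
proof -
  have "norm z > 0" using assms by simp
  hence "Re z + Im z > 0" using sector_norm_le[OF assms(3,1,2)] by linarith
  thus ?thesis by (auto simp: complex_nonpos_Reals_iff)
qed

lemma of_real_in_sector: "0 \<le> c \<Longrightarrow> x \<ge> 0 \<Longrightarrow> of_real x \<in> sector c"
  by (auto simp: sector_def)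

text \<open>On \<open>sector c\<close> the linear forms defining \<open>sector d\<close> are at
  least \<open>(d - c) * (Re z + Im z)\<close>, hence at least \<open>(d - c) / 3 * norm z\<close>.
  A displacement of length e lowers them by at most 2 e, which explains the denominator 6 of the
  radius.\<close>

lemma cball_subset_sector:
  assumes "0 \<le> c" "c < d" "d \<le> 1/2" "z \<in> sector c" "w \<in> cball z ((d - c) / 6 * norm z)"
  shows "w \<in> sector d" "norm w \<ge> norm z / 2"
proof -
  define e where "e = (d - c) / 6 * norm z"
  have nw: "norm (w - z) \<le> e" using assms(5) by (simp add: e_def dist_norm norm_minus_commute)
  have R: "\<bar>Re w - Re z\<bar> \<le> e" "\<bar>Im w - Im z\<bar> \<le> e"
    using nw abs_Re_le_cmod[of "w - z"] abs_Im_le_cmod[of "w - z"] by auto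
  have e0: "e \<ge> 0" using assms by (simp add: e_def)
  have lo: "(d - c) * (Re z + Im z) \<ge> 2 * e"
    using mult_left_mono[OF sector_norm_le[OF assms(4,1)], of "d - c"] assms by (simp add: e_def)
  have p: "Re z + c * Im z \<ge> 0" "Im z + c * Re z \<ge> 0" using assms by (auto simp: sector_def)
  have aux: "x + d * y \<ge> (d - c) * (x + y)" if "x + c * y \<ge> 0" "y + c * x \<ge> 0" for x y :: real
  proof (cases "y \<ge> 0")
    case True
    have "0 \<le> (1 - d + c) * (x + c * y)" using assms that by (intro mult_nonneg_nonneg) auto
    moreover have "0 \<le> c * (d - c) * y" using assms True by (intro mult_nonneg_nonneg) auto
    ultimately show ?thesis by (simp add: algebra_simps)
  next
    case False
    have "c * y \<le> 0" using False assms by (simp add: mult_nonneg_nonpos)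
    hence x: "x \<ge> 0" using that by linarith
    have cc: "c * c \<le> 1/4" using mult_mono[of c "1/2" c "1/2"] assms by auto
    have "0 \<le> c * (y + c * x)" using assms that by (intro mult_nonneg_nonneg) auto
    moreover have "0 \<le> (1 - d + c - c * c) * x" using assms x cc by (intro mult_nonneg_nonneg) auto
    ultimately show ?thesis by (simp add: algebra_simps)
  qed
  have d2: "d * v \<ge> d * u - e" if "\<bar>v - u\<bar> \<le> e" for u v
  proof -
    have "d * (u - v) \<le> d * e" using that assms by (intro mult_left_mono) auto
    also have "\<dots> \<le> 1 * e" using assms e0 by (intro mult_right_mono) auto
    finally show ?thesis by (simp add: algebra_simps)
  qed
  show "w \<in> sector d" unfolding sector_def mem_Collect_eq
    using aux[OF p] aux[OF p(2,1)] lo R d2[OF R(1)] d2[OF R(2)] e0 by (auto simp: add.commute)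
  have "e \<le> norm z / 2" using assms mult_right_mono[of "(d-c)/6" "1/2" "norm z"] by (simp add: e_def)
  thus "norm w \<ge> norm z / 2" using nw norm_triangle_ineq3[of w z] by linarith
qed

lemma bigo_sector_iff:
  "f \<in> O[at_sector c](\<lambda>z. 1 / z ^ p) \<longleftrightarrow> (\<exists>C>0. \<exists>R\<ge>1. \<forall>z\<in>sector c. norm z \<ge> R \<longrightarrow> norm (f z) \<le> C / norm z ^ p)"
  for f :: "complex \<Rightarrow> complex"
proof
  assume "f \<in> O[at_sector c](\<lambda>z. 1 / z ^ p)"
  then obtain C where C: "C > 0" "\<forall>\<^sub>F z in at_sector c. norm (f z) \<le> C * norm (1 / z ^ p)"
    by (auto elim: landau_o.bigE)
  then obtain R where "\<forall>z\<in>sector c. norm z \<ge> R \<longrightarrow> norm (f z) \<le> C * norm (1 / z ^ p)"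
    by (auto simp: eventually_at_sector)
  thus "\<exists>C>0. \<exists>R\<ge>1. \<forall>z\<in>sector c. norm z \<ge> R \<longrightarrow> norm (f z) \<le> C / norm z ^ p"
    using C by (intro exI[of _ C] conjI exI[of _ "max R 1"]) (auto simp: norm_divide norm_power)
next
  assume "\<exists>C>0. \<exists>R\<ge>1. \<forall>z\<in>sector c. norm z \<ge> R \<longrightarrow> norm (f z) \<le> C / norm z ^ p"
  then obtain C R where "C > 0" "\<forall>z\<in>sector c. norm z \<ge> R \<longrightarrow> norm (f z) \<le> C / norm z ^ p" by blast
  thus "f \<in> O[at_sector c](\<lambda>z. 1 / z ^ p)"
    by (intro landau_o.bigI[of C]) (auto simp: eventually_at_sector norm_divide norm_power)
qed

text \<open>On discs of radius proportional to \<open>norm z\<close> Cauchy's estimate gives the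
  ordinary derivative one more power of decay, and the factor z in \<theta> takes it back. The discs
  leave \<open>sector c\<close> but stay in \<open>sector d\<close>.\<close>

lemma bigo_sector_euler_derivative:
  assumes d: "\<And>z. z \<in> slit \<Longrightarrow> (f has_field_derivative f1 z / z) (at z)"
    and c: "0 \<le> c" "c < d" "d \<le> 1/2"
    and f: "f \<in> O[at_sector d](\<lambda>z. 1 / z ^ p)"
  shows "f1 \<in> O[at_sector c](\<lambda>z. 1 / z ^ p)"
proof -
  obtain C R where CR: "C > 0" "R \<ge> 1" "\<And>z. z \<in> sector d \<Longrightarrow> norm z \<ge> R \<Longrightarrow> norm (f z) \<le> C / norm z ^ p"
    using f unfolding bigo_sector_iff by blast
  define k where "k = (d - c) / 6"
  have k: "k > 0" using c by (simp add: k_def)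
  have "norm (f1 z) \<le> (C * 2 ^ p / k) / norm z ^ p" if z: "z \<in> sector c" "norm z \<ge> 2 * R" for z
  proof -
    have nz: "z \<noteq> 0" using z CR by auto
    have sub: "w \<in> sector d" "norm w \<ge> norm z / 2" if "w \<in> cball z (k * norm z)" for w
      using cball_subset_sector[OF c z(1)] that by (auto simp: k_def)
    have slit: "w \<in> slit" if "w \<in> cball z (k * norm z)" for w
      using sub[OF that] nz c by (intro sector_subset_slit[of d]) auto
    have hol: "f holomorphic_on slit"
      using d by (intro holomorphic_on_open[THEN iffD2]) auto
    have zs: "z \<in> slit" using slit[of z] k by simp
    have "norm ((deriv ^^ 1) f z) \<le> fact 1 * (C * 2 ^ p / norm z ^ p) / (k * norm z) ^ 1"
    proof (rule Cauchy_inequality)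
      show "f holomorphic_on ball z (k * norm z)"
        by (rule holomorphic_on_subset[OF hol]) (use slit in force)
      show "continuous_on (cball z (k * norm z)) f"
        by (rule continuous_on_subset[OF holomorphic_on_imp_continuous_on[OF hol]]) (use slit in blast)
      show "0 < k * norm z" using k nz by simp
      fix w assume "norm (z - w) = k * norm z"
      hence "w \<in> cball z (k * norm z)" by (simp add: dist_norm)
      note w = sub[OF this]
      have "norm (f w) \<le> C / norm w ^ p" using w z by (intro CR) auto
      also have "\<dots> \<le> C / (norm z / 2) ^ p"
        using w nz CR by (intro divide_left_mono power_mono mult_pos_pos zero_less_power) auto
      also have "\<dots> = C * 2 ^ p / norm z ^ p" by (simp add: power_divide)
      finally show "norm (f w) \<le> C * 2 ^ p / norm z ^ p" .
    qed
    moreover have "deriv f z = f1 z / z" using d[OF zs] by (rule DERIV_imp_deriv)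
    ultimately show ?thesis using nz k by (simp add: norm_divide field_simps)
  qed
  moreover have "C * 2 ^ p / k > 0" using CR k by simp
  ultimately show ?thesis unfolding bigo_sector_iff using CR(2)
    by (intro exI[of _ "C * 2 ^ p / k"] exI[of _ "2 * R"] conjI) auto
qed

lemma convex_sector_lower: "convex {z \<in> sector c. Re z + Im z \<ge> b}"
proof -
  have "{z \<in> sector c. Re z + Im z \<ge> b} =
     {z. inner (Complex 1 c) z \<ge> 0} \<inter> {z. inner (Complex c 1) z \<ge> 0} \<inter> {z. inner (Complex 1 1) z \<ge> b}"
    by (auto simp: sector_def inner_complex_def add.commute)
  thus ?thesis by (simp add: convex_Int convex_halfspace_ge)
qed

lemma Re_plus_Im_le: "Re z + Im z \<le> 2 * norm z"
proof -
  have "Re z \<le> norm z" "Im z \<le> norm z"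
    using abs_Re_le_cmod[of z] abs_Im_le_cmod[of z] by linarith+
  thus ?thesis by simp
qed

text \<open>On the positive axis the increments of \<open>h\<close> are dominated by those of
  \<open>- C / (p * t ^ p)\<close>, which gives the limit and its rate. Any other \<open>z\<close>
  is compared with the real point \<open>norm z\<close> by the mean value inequality on the segment
  between them.\<close>

lemma bigo_sector_integrate:
  fixes h h' :: "complex \<Rightarrow> complex"
  assumes d: "\<And>z. z \<in> slit \<Longrightarrow> (h has_field_derivative h' z) (at z)"
    and p: "p > 0" and c: "0 \<le> c" "c \<le> 1/2"
    and h': "h' \<in> O[at_sector c](\<lambda>z. 1 / z ^ Suc p)"
  shows "\<exists>l. ((\<lambda>x. h (of_real x)) \<longlongrightarrow> l) at_top \<and> (\<lambda>z. h z - l) \<in> O[at_sector c](\<lambda>z. 1 / z ^ p)"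
proof -
  obtain C R where CR: "C > 0" "R \<ge> 1" "\<And>z. z \<in> sector c \<Longrightarrow> norm z \<ge> R \<Longrightarrow> norm (h' z) \<le> C / norm z ^ Suc p"
    using h' unfolding bigo_sector_iff by blast
  have real_diff: "norm (h (of_real y) - h (of_real x)) \<le> C / x ^ p" if xy: "R \<le> x" "x < y" for x y
  proof -
    have slit: "complex_of_real t \<in> slit" if "t \<ge> x" for t
      using that xy CR by (auto simp: complex_nonpos_Reals_iff)
    have "norm (h (of_real y) - h (of_real x)) \<le> (- C / (p * y ^ p)) - (- C / (p * x ^ p))"
    proof (rule differentiable_bound_general[OF xy(2), where f = "\<lambda>t. h (of_real t)" and \<phi> = "\<lambda>t. - C / (p * t ^ p)"
           and f' = "\<lambda>t. h' (of_real t)" and \<phi>' = "\<lambda>t. C / t ^ Suc p"])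
      show "continuous_on {x..y} (\<lambda>t. - C / (p * t ^ p))"
        using xy CR p by (intro continuous_intros) auto
      have "h holomorphic_on slit"
        using d by (intro holomorphic_on_open[THEN iffD2]) auto
      hence "continuous_on slit h" by (rule holomorphic_on_imp_continuous_on)
      thus "continuous_on {x..y} (\<lambda>t. h (of_real t))"
        by (rule continuous_on_compose2) (use slit in \<open>auto intro!: continuous_intros\<close>)
      fix t assume t: "x < t" "t < y"
      show "((\<lambda>t. h (of_real t)) has_vector_derivative h' (of_real t)) (at t)"
        using has_vector_derivative_real_field[OF d[OF slit[of t]]] t by (simp add: o_def)
      show "((\<lambda>t. - C / (p * t ^ p)) has_vector_derivative C / t ^ Suc p) (at t)"
        unfolding has_real_derivative_iff_has_vector_derivative[symmetric]
        using t xy CR p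
        by (auto intro!: derivative_eq_intros simp: field_simps power_Suc[symmetric] simp del: power_Suc)
           (cases p; simp add: power_add mult_ac)
      show "norm (h' (of_real t)) \<le> C / t ^ Suc p"
        using CR(3)[of "of_real t"] t xy CR(2) of_real_in_sector[of c t] c by simp
    qed
    also have "\<dots> \<le> C / (p * x ^ p)" using xy CR by simp
    also have "\<dots> \<le> C / (1 * x ^ p)"
      using xy CR p by (intro divide_left_mono mult_right_mono mult_pos_pos zero_less_power) auto
    finally show ?thesis by simp
  qed
  have lim0: "((\<lambda>x::real. C / x ^ p) \<longlongrightarrow> 0) at_top"
    using p by (intro tendsto_divide_0[OF tendsto_const] filterlim_at_top_imp_at_infinity filterlim_pow_at_top filterlim_ident) auto
  have "Cauchy (\<lambda>n. h (of_real (real n)))"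
  proof (rule CauchyI)
    fix e :: real assume e: "e > 0"
    have "\<forall>\<^sub>F x in at_top. C / x ^ p < e" using order_tendstoD(2)[OF lim0 e] .
    then obtain N where N: "\<And>x. x \<ge> N \<Longrightarrow> C / x ^ p < e" by (auto simp: eventually_at_top_linorder)
    show "\<exists>M. \<forall>m\<ge>M. \<forall>n\<ge>M. norm (h (of_real (real m)) - h (of_real (real n))) < e"
    proof (intro exI[of _ "nat \<lceil>max N R\<rceil>"] allI impI)
      fix m n assume mn: "m \<ge> nat \<lceil>max N R\<rceil>" "n \<ge> nat \<lceil>max N R\<rceil>"
      hence mn': "real m \<ge> N" "real n \<ge> N" "real m \<ge> R" "real n \<ge> R" by linarith+
      consider "m < n" | "n < m" | "m = n" by linarith
      thus "norm (h (of_real (real m)) - h (of_real (real n))) < e"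
      proof cases
        case 1
        thus ?thesis using real_diff[of "real m" "real n"] N[OF mn'(1)] mn' by (simp add: norm_minus_commute)
      next
        case 2
        thus ?thesis using real_diff[of "real n" "real m"] N[OF mn'(2)] mn' by simp
      qed (use e in auto)
    qed
  qed
  then obtain l where l: "(\<lambda>n. h (of_real (real n))) \<longlonglongrightarrow> l"
    using Cauchy_convergent_iff convergent_def by blast
  have real_l: "norm (h (of_real x) - l) \<le> C / x ^ p" if x: "x \<ge> R" for x
  proof (rule tendsto_upperbound)
    show "(\<lambda>n. norm (h (of_real x) - h (of_real (real n)))) \<longlonglongrightarrow> norm (h (of_real x) - l)"
      by (intro tendsto_intros l)
    have "\<forall>\<^sub>F n in sequentially. real n > x"
      using filterlim_real_sequentially by (auto simp: filterlim_at_top_dense)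
    thus "\<forall>\<^sub>F n in sequentially. norm (h (of_real x) - h (of_real (real n))) \<le> C / x ^ p"
      by eventually_elim (subst norm_minus_commute, rule real_diff[OF x])
  qed auto
  have "((\<lambda>x. h (of_real x) - l) \<longlongrightarrow> 0) at_top"
  proof (rule Lim_null_comparison[OF _ lim0])
    show "\<forall>\<^sub>F x in at_top. norm (h (of_real x) - l) \<le> C / x ^ p"
      using eventually_ge_at_top[of R] by eventually_elim (rule real_l)
  qed
  hence lim: "((\<lambda>x. h (of_real x)) \<longlongrightarrow> l) at_top" by (rule LIM_zero_cancel)
  define D where "D = C * 6 ^ Suc p * 2 + C"
  have "norm (h z - l) \<le> D / norm z ^ p" if z: "z \<in> sector c" "norm z \<ge> 6 * R" for z
  proof -
    have nz: "norm z > 0" using z CR by auto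
    \<comment> \<open>A convex set containing \<open>z\<close> and \<open>norm z\<close>, all of
      whose points satisfy \<open>norm w \<ge> norm z / 6\<close>, so the segment keeps away from 0.
      The 6 also explains the threshold \<open>6 * R\<close>.\<close>
    define T where "T = {w \<in> sector c. Re w + Im w \<ge> norm z / 3}"
    have T: "w \<in> slit" "norm (h' w) \<le> C / (norm z / 6) ^ Suc p" if "w \<in> T" for w
    proof -
      have w: "norm w \<ge> norm z / 6" using Re_plus_Im_le[of w] that by (simp add: T_def)
      have "w \<noteq> 0" using w nz by auto
      thus "w \<in> slit" using that c sector_subset_slit by (auto simp: T_def)
      have "norm (h' w) \<le> C / norm w ^ Suc p"
        using that w z by (intro CR) (auto simp: T_def)
      also have "\<dots> \<le> C / (norm z / 6) ^ Suc p"
        using w nz CR by (intro divide_left_mono power_mono mult_pos_pos zero_less_power) auto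
      finally show "norm (h' w) \<le> C / (norm z / 6) ^ Suc p" .
    qed
    have "norm (h z - h (of_real (norm z))) \<le> C / (norm z / 6) ^ Suc p * norm (z - of_real (norm z))"
    proof (rule field_differentiable_bound[where S = T and f' = h'])
      show "convex T" unfolding T_def by (rule convex_sector_lower)
      show "z \<in> T" using z sector_norm_le[OF z(1)] c by (simp add: T_def)
      show "complex_of_real (norm z) \<in> T" using of_real_in_sector[of c "norm z"] c by (simp add: T_def)
    qed (use T d in \<open>auto intro: has_field_derivative_at_within\<close>)
    also have "\<dots> \<le> C / (norm z / 6) ^ Suc p * (2 * norm z)"
      using norm_triangle_ineq4[of z "of_real (norm z)"] CR by (intro mult_left_mono) auto
    also have "C / (norm z / 6) ^ Suc p * (2 * norm z) = C * 6 ^ Suc p * 2 / norm z ^ p"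
      using nz by (simp add: power_divide field_simps)
    finally have 1: "norm (h z - h (of_real (norm z))) \<le> C * 6 ^ Suc p * 2 / norm z ^ p"
      .
    have "norm (h z - l) \<le> norm (h z - h (of_real (norm z))) + norm (h (of_real (norm z)) - l)"
      using norm_triangle_ineq[of "h z - h (of_real (norm z))" "h (of_real (norm z)) - l"] by simp
    also have "\<dots> \<le> C * 6 ^ Suc p * 2 / norm z ^ p + C / norm z ^ p"
      using z CR by (intro add_mono 1 real_l) auto
    finally show ?thesis by (simp add: D_def add_divide_distrib)
  qed
  moreover have "D > 0" using CR by (simp add: D_def add_pos_pos)
  ultimately have "(\<lambda>z. h z - l) \<in> O[at_sector c](\<lambda>z. 1 / z ^ p)"
    unfolding bigo_sector_iff using CR(2) by (intro exI[of _ D] exI[of _ "6 * R"] conjI) auto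
  with lim show ?thesis by blast
qed

section \<open>The expansion of \<open>cP\<close> at infinity\<close>

lemma cP_bigo_const:
  assumes "0 \<le> c" "c \<le> 1/2"
  shows "cP \<in> O[at_sector c](\<lambda>z. 1 / z ^ 0)"
proof -
  obtain C where C: "\<And>z. Re z \<ge> 1 \<or> Im z \<ge> 1 \<Longrightarrow> norm (cP z) \<le> C"
    using cP_bounded by blast
  have "norm (cP z) \<le> max C 1 / norm z ^ 0" if z: "z \<in> sector c" "norm z \<ge> 6" for z
  proof -
    have "Re z + Im z \<ge> 2" using sector_norm_le[OF z(1) assms] z by linarith
    hence "Re z \<ge> 1 \<or> Im z \<ge> 1" by linarith
    from C[OF this] show ?thesis by simp
  qed
  thus ?thesis unfolding bigo_sector_iff by (intro exI[of _ "max C 1"] exI[of _ 6] conjI) auto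
qed

lemma divide_power_derivative:
  fixes b :: complex
  assumes "z \<noteq> 0"
  shows "((\<lambda>z. b / z ^ m) has_field_derivative - of_nat m * b / z ^ m / z) (at z)"
proof (cases m)
  case (Suc k)
  show ?thesis unfolding Suc
    by (rule derivative_eq_intros refl | simp add: assms del: of_nat_Suc)+
       (use assms in \<open>simp add: field_simps del: of_nat_Suc\<close>)
qed (use assms in \<open>auto intro!: derivative_eq_intros\<close>)

lemma inverse_odd_powers_derivative:
  fixes b :: "nat \<Rightarrow> complex"
  assumes "z \<noteq> 0"
  shows "((\<lambda>z. \<Sum>n<N. b n / z ^ (2 * n + 1)) has_field_derivative
           (\<Sum>n<N. (- of_nat (2 * n + 1) * b n) / z ^ (2 * n + 1)) / z) (at z)"
  unfolding sum_divide_distrib by (intro DERIV_sum divide_power_derivative assms)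

lemma inverse_even_powers_derivative:
  fixes b :: "nat \<Rightarrow> complex"
  assumes "z \<noteq> 0"
  shows "((\<lambda>z. \<Sum>n<N. b n / z ^ (2 * (n + 1))) has_field_derivative
           (\<Sum>n<N. (- of_nat (2 * (n + 1)) * b n) / z ^ (2 * n + 1)) / z ^ 2) (at z)"
  unfolding sum_divide_distrib
proof (rule DERIV_sum)
  fix n
  have "z ^ (2 * (n + 1)) * z = z ^ (2 * n + 1) * z ^ 2" by (simp add: power2_eq_square mult_ac)
  thus "((\<lambda>z. b n / z ^ (2 * (n + 1))) has_field_derivative - of_nat (2 * (n + 1)) * b n / z ^ (2 * n + 1) / z ^ 2) (at z)"
    using divide_power_derivative[OF assms, of "b n" "2 * (n + 1)"]
    by (simp only: divide_divide_eq_left)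
qed

text \<open>\<theta> multiplies \<open>1 / z ^ (2 * n + 1)\<close> by \<open>- (2 * n + 1)\<close>.
  Each application to the error term costs part of the opening of the sector, so the hypothesis
  ranges over all openings below 1/2 and each step uses one halfway to 1/2.\<close>

lemma cP_derivs_expansion:
  assumes exp: "\<And>c. 0 \<le> c \<Longrightarrow> c < 1/2 \<Longrightarrow> (\<lambda>z. cP z - (\<Sum>n<N. b n / z ^ (2 * n + 1))) \<in> O[at_sector c](\<lambda>z. 1 / z ^ p)"
    and c: "0 \<le> c" "c < 1/2"
  shows "(\<lambda>z. cQ z - (\<Sum>n<N. (- of_nat (2 * n + 1) * b n) / z ^ (2 * n + 1))) \<in> O[at_sector c](\<lambda>z. 1 / z ^ p)" (is "?f1 \<in> _")
    and "(\<lambda>z. cU z - (\<Sum>n<N. (of_nat (2 * n + 1) ^ 2 * b n) / z ^ (2 * n + 1))) \<in> O[at_sector c](\<lambda>z. 1 / z ^ p)" (is "?f2 \<in> _")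
    and "(\<lambda>z. 4 * z ^ 2 * (cP z + cQ z) - (\<Sum>n<N. (- (of_nat (2 * n + 1) ^ 3) * b n) / z ^ (2 * n + 1))) \<in> O[at_sector c](\<lambda>z. 1 / z ^ p)" (is "?f3 \<in> _")
proof -
  have mid: "0 \<le> (c + 1/2) / 2 \<and> c < (c + 1/2) / 2 \<and> (c + 1/2) / 2 < 1/2" if "0 \<le> c" "c < 1/2" for c :: real
    using that by auto
  have step: "g1 \<in> O[at_sector c](\<lambda>z. 1 / z ^ p)"
    if "\<And>z. z \<in> slit \<Longrightarrow> (g has_field_derivative g1 z / z) (at z)"
      "\<And>c. 0 \<le> c \<Longrightarrow> c < 1/2 \<Longrightarrow> g \<in> O[at_sector c](\<lambda>z. 1 / z ^ p)" "0 \<le> c" "c < 1/2" for g g1 c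
    using mid[of c] that by (intro bigo_sector_euler_derivative[of g g1 c "(c + 1/2) / 2"]) auto
  have nz: "z \<noteq> 0" if "z \<in> slit" for z using that by auto
  have 1: "?f1 \<in> O[at_sector c](\<lambda>z. 1 / z ^ p)" if "0 \<le> c" "c < 1/2" for c
  proof (rule step[OF _ exp that])
    fix z assume z: "z \<in> slit"
    show "((\<lambda>z. cP z - (\<Sum>n<N. b n / z ^ (2 * n + 1))) has_field_derivative ?f1 z / z) (at z)"
      using DERIV_diff[OF cP_derivs(1)[OF z] inverse_odd_powers_derivative[OF nz[OF z], of b N]]
      by (simp add: diff_divide_distrib)
  qed
  have 2: "?f2 \<in> O[at_sector c](\<lambda>z. 1 / z ^ p)" if "0 \<le> c" "c < 1/2" for c
  proof (rule step[OF _ 1 that])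
    fix z assume z: "z \<in> slit"
    have eq: "- of_nat (2 * n + 1) * (- of_nat (2 * n + 1) * b n) = of_nat (2 * n + 1) ^ 2 * b n" for n
      by (simp add: power2_eq_square algebra_simps)
    show "(?f1 has_field_derivative ?f2 z / z) (at z)"
      using DERIV_diff[OF cP_derivs(2)[OF z] inverse_odd_powers_derivative[OF nz[OF z], of "\<lambda>n. - of_nat (2 * n + 1) * b n" N]]
      unfolding eq diff_divide_distrib[symmetric] .
  qed
  have 3: "?f3 \<in> O[at_sector c](\<lambda>z. 1 / z ^ p)" if "0 \<le> c" "c < 1/2" for c
  proof (rule step[OF _ 2 that])
    fix z assume z: "z \<in> slit"
    have eq: "- of_nat (2 * n + 1) * (of_nat (2 * n + 1) ^ 2 * b n) = - (of_nat (2 * n + 1) ^ 3) * b n" for n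
      by (simp add: power2_eq_square power3_eq_cube algebra_simps)
    have U: "(cU has_field_derivative 4 * z ^ 2 * (cP z + cQ z) / z) (at z)"
      by (rule DERIV_cong[OF cP_derivs(3)[OF z]]) (use nz[OF z] in \<open>simp add: power2_eq_square\<close>)
    show "(?f2 has_field_derivative ?f3 z / z) (at z)"
      using DERIV_diff[OF U inverse_odd_powers_derivative[OF nz[OF z], of "\<lambda>n. of_nat (2 * n + 1) ^ 2 * b n" N]]
      unfolding eq diff_divide_distrib[symmetric] .
  qed
  show "?f1 \<in> O[at_sector c](\<lambda>z. 1 / z ^ p)" "?f2 \<in> O[at_sector c](\<lambda>z. 1 / z ^ p)" "?f3 \<in> O[at_sector c](\<lambda>z. 1 / z ^ p)"
    using 1 2 3 c by blast+
qed

text \<open>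
  The bootstrap: \<open>(z P)' = \<theta>\<^sup>3 P / (4 z\<^sup>2)\<close>, and \<open>\<theta>\<close> preserves the order of an error term by
  Cauchy's estimate, so integrating from infinity gains a factor \<open>z\<^sup>2\<close>.
\<close>

lemma cP_expansion_step:
  assumes exp: "\<And>c. 0 \<le> c \<Longrightarrow> c < 1/2 \<Longrightarrow> (\<lambda>z. cP z - (\<Sum>n<N. b n / z ^ (2 * n + 1))) \<in> O[at_sector c](\<lambda>z. 1 / z ^ (2 * N))"
    and b': "\<And>n. b' n = b n * of_nat (2 * n + 1) ^ 3 / (8 * of_nat (n + 1))"
    and c: "0 \<le> c" "c < 1/2"
  shows "\<exists>l. ((\<lambda>x. of_real x * cP (of_real x) - (\<Sum>n<N. b' n / of_real x ^ (2 * (n + 1)))) \<longlongrightarrow> l) at_top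
           \<and> (\<lambda>z. z * cP z - (\<Sum>n<N. b' n / z ^ (2 * (n + 1))) - l) \<in> O[at_sector c](\<lambda>z. 1 / z ^ (2 * N + 1))"
proof (rule bigo_sector_integrate)
  let ?S = "\<lambda>z. \<Sum>n<N. (- (of_nat (2 * n + 1) ^ 3) * b n) / z ^ (2 * n + 1)"
  have f3: "(\<lambda>z. 4 * z ^ 2 * (cP z + cQ z) - ?S z) \<in> O[at_sector c](\<lambda>z. 1 / z ^ (2 * N))"
    by (rule cP_derivs_expansion(3)[OF exp c])
  have "(\<lambda>z. 1 / (4 * z ^ 2)) \<in> O[at_sector c](\<lambda>z. 1 / z ^ 2)"
    by (rule bigoI[of _ 1]) (auto simp: norm_divide norm_mult norm_power divide_simps)
  from landau_o.big.mult[OF f3 this]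
  show "(\<lambda>z. (4 * z ^ 2 * (cP z + cQ z) - ?S z) * (1 / (4 * z ^ 2)))
     \<in> O[at_sector c](\<lambda>z. 1 / z ^ Suc (2 * N + 1))"
    by (simp add: power2_eq_square mult_ac)
  show "0 < 2 * N + 1" "0 \<le> c" "c \<le> 1/2" using c by auto
  fix z assume z: "z \<in> slit"
  hence nz: "z \<noteq> 0" by auto
  have P: "((\<lambda>z. z * cP z) has_field_derivative cP z + cQ z) (at z)"
    by (rule derivative_eq_intros cP_derivs(1)[OF z] refl)+ (use nz in simp)
  \<comment> \<open>Integrating - (2n+1)^3 b(n) / (4 z^(2n+3)) yields (2n+1)^3 b(n) / (8 (n+1)
    z^(2n+2)); this is the origin of the recursion for \<open>b'\<close>.\<close>
  have eq: "- of_nat (2 * (n + 1)) * b' n = (- (of_nat (2 * n + 1) ^ 3) * b n) / 4" for n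
    unfolding b' by (simp add: divide_simps del: of_nat_Suc) (simp add: algebra_simps)
  have "((\<lambda>z. z * cP z - (\<Sum>n<N. b' n / z ^ (2 * (n + 1)))) has_field_derivative
     cP z + cQ z - (\<Sum>n<N. (- (of_nat (2 * n + 1) ^ 3) * b n) / 4 / z ^ (2 * n + 1)) / z ^ 2) (at z)"
    using DERIV_diff[OF P inverse_even_powers_derivative[OF nz, of b' N]] unfolding eq .
  also have "(\<Sum>n<N. (- (of_nat (2 * n + 1) ^ 3) * b n) / 4 / z ^ (2 * n + 1)) = ?S z / 4"
    unfolding sum_divide_distrib by (intro sum.cong refl) simp
  also have "cP z + cQ z - ?S z / 4 / z ^ 2 =
     (4 * z ^ 2 * (cP z + cQ z) - ?S z) * (1 / (4 * z ^ 2))"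
    using nz by (simp add: field_simps)
  finally show "((\<lambda>z. z * cP z - (\<Sum>n<N. b' n / z ^ (2 * (n + 1)))) has_field_derivative
     (4 * z ^ 2 * (cP z + cQ z) - ?S z) * (1 / (4 * z ^ 2))) (at z)" .
qed

definition IK_fps :: "complex fps" where
  "IK_fps = Abs_fps (\<lambda>m. of_nat (odd_double_fact m) ^ 3 / (2 ^ (5 * m) * fact m))"

lemma IK_fps_0 [simp]: "IK_fps $ 0 = 1"
  by (simp add: IK_fps_def odd_double_fact_def)

text \<open>The ratio of consecutive coefficients is (2n+1)^3 / (32 (n+1)); the additional power of
  4 makes it the ratio in \<open>cP_expansion_step\<close>.\<close>

lemma IK_fps_Suc: "IK_fps $ Suc n * 4 ^ Suc n = (IK_fps $ n * 4 ^ n) * of_nat (2 * n + 1) ^ 3 / (8 * of_nat (n + 1))"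
  by (simp add: IK_fps_def odd_double_fact_def power_mult_distrib field_simps power_add del: of_nat_Suc of_nat_add)

lemma inverse_powers_tendsto_0:
  assumes "p > 0"
  shows "((\<lambda>x. b / complex_of_real x ^ p) \<longlongrightarrow> 0) at_top"
proof -
  have "((\<lambda>x::real. 1 / x ^ p) \<longlongrightarrow> 0) at_top"
    using assms by (intro tendsto_divide_0[OF tendsto_const] filterlim_at_top_imp_at_infinity filterlim_pow_at_top filterlim_ident) auto
  from tendsto_mult[OF tendsto_const[of b] tendsto_of_real[OF this, where ?'a = complex]]
  show ?thesis by simp
qed

lemma bigo_sector_real_tendsto_0:
  assumes "f \<in> O[at_sector c](\<lambda>z. 1 / z ^ p)" "0 \<le> c" "p > 0"
  shows "((\<lambda>x. f (of_real x)) \<longlongrightarrow> 0) at_top"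
proof -
  obtain C R where CR: "C > 0" "R \<ge> 1" "\<And>z. z \<in> sector c \<Longrightarrow> norm z \<ge> R \<Longrightarrow> norm (f z) \<le> C / norm z ^ p"
    using assms(1) unfolding bigo_sector_iff by blast
  show ?thesis
  proof (rule Lim_null_comparison)
    show "\<forall>\<^sub>F x in at_top. norm (f (of_real x)) \<le> norm (of_real C / complex_of_real x ^ p)"
      using eventually_ge_at_top[of R]
    proof eventually_elim
      case (elim x)
      thus ?case using CR(1,2) CR(3)[of "of_real x"] of_real_in_sector[OF assms(2), of x]
        by (simp add: norm_divide norm_power)
    qed
    show "((\<lambda>x. norm (of_real C / complex_of_real x ^ p)) \<longlongrightarrow> 0) at_top"
      using inverse_powers_tendsto_0[OF assms(3)] by (rule tendsto_norm_zero)
  qed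
qed

lemma cP_expansion_exists:
  "\<exists>c0. ((\<lambda>x. of_real x * cP (of_real x)) \<longlongrightarrow> c0) at_top \<and>
     (\<forall>N c. 0 \<le> c \<longrightarrow> c < 1/2 \<longrightarrow>
        (\<lambda>z. cP z - (\<Sum>n<N. c0 * (IK_fps $ n * 4 ^ n) / z ^ (2 * n + 1))) \<in> O[at_sector c](\<lambda>z. 1 / z ^ (2 * N)))"
proof -
  \<comment> \<open>The step with no terms, fed with boundedness alone, already shows that z P(z)
    has a limit.\<close>
  obtain c0 where c0: "((\<lambda>x. of_real x * cP (of_real x)) \<longlongrightarrow> c0) at_top"
    using cP_expansion_step[where N = 0 and b = "\<lambda>_. 0" and b' = "\<lambda>_. 0" and c = 0] cP_bigo_const by auto
  define b where "b = (\<lambda>n. c0 * (IK_fps $ n * 4 ^ n))"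
  have bSuc: "b (Suc n) = b n * of_nat (2 * n + 1) ^ 3 / (8 * of_nat (n + 1))" for n
    using IK_fps_Suc[of n] by (simp add: b_def)
  have "(\<lambda>z. cP z - (\<Sum>n<N. b n / z ^ (2 * n + 1))) \<in> O[at_sector c](\<lambda>z. 1 / z ^ (2 * N))"
    if "0 \<le> c" "c < 1/2" for N c
    using that
  proof (induction N arbitrary: c)
    case 0
    thus ?case using cP_bigo_const[of c] by simp
  next
    case (Suc N)
    obtain l where l: "((\<lambda>x. of_real x * cP (of_real x) - (\<Sum>n<N. b (Suc n) / of_real x ^ (2 * (n + 1)))) \<longlongrightarrow> l) at_top"
      "(\<lambda>z. z * cP z - (\<Sum>n<N. b (Suc n) / z ^ (2 * (n + 1))) - l) \<in> O[at_sector c](\<lambda>z. 1 / z ^ (2 * N + 1))"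
      using cP_expansion_step[where N = N and b = b and b' = "\<lambda>n. b (Suc n)" and c = c, OF Suc.IH bSuc Suc.prems] by blast
    \<comment> \<open>All subtracted terms vanish at infinity, so every stage has the same constant
      of integration.\<close>
    have "((\<lambda>x. of_real x * cP (of_real x) - (\<Sum>n<N. b (Suc n) / of_real x ^ (2 * (n + 1)))) \<longlongrightarrow> c0 - (\<Sum>n<N. 0)) at_top"
      by (intro tendsto_diff c0 tendsto_sum inverse_powers_tendsto_0) auto
    hence "l = c0" using l(1) by (intro tendsto_unique[of at_top]) auto
    let ?S = "\<lambda>z. \<Sum>n<N. b (Suc n) / z ^ (2 * (n + 1))"
    have inv: "(\<lambda>z. 1 / z) \<in> O[at_sector c](\<lambda>z. 1 / z ^ 1)" by simp
    have "(\<lambda>z. (z * cP z - ?S z - l) * (1 / z)) \<in> O[at_sector c](\<lambda>z. 1 / z ^ (2 * N + 1) * (1 / z ^ 1))"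
      by (rule landau_o.big.mult[OF l(2) inv])
    also have "(\<lambda>z. 1 / z ^ (2 * N + 1) * (1 / z ^ 1)) = (\<lambda>z::complex. 1 / z ^ (2 * Suc N))"
      by (auto simp: fun_eq_iff)
    finally have "(\<lambda>z. (z * cP z - ?S z - l) * (1 / z)) \<in> O[at_sector c](\<lambda>z. 1 / z ^ (2 * Suc N))" .
    moreover have "\<forall>\<^sub>F z in at_sector c. (z * cP z - ?S z - l) * (1 / z) =
        cP z - (\<Sum>n<Suc N. b n / z ^ (2 * n + 1))"
      unfolding eventually_at_sector
    proof (intro exI[of _ 1] ballI impI)
      fix z :: complex assume "norm z \<ge> 1"
      hence nz: "z \<noteq> 0" by auto
      have "?S z * (1 / z) = (\<Sum>n<N. b (Suc n) / z ^ (2 * Suc n + 1))"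
        unfolding sum_distrib_right by (intro sum.cong refl) (use nz in \<open>simp add: field_simps\<close>)
      moreover have "l = b 0" using \<open>l = c0\<close> by (simp add: b_def)
      ultimately show "(z * cP z - ?S z - l) * (1 / z) =
          cP z - (\<Sum>n<Suc N. b n / z ^ (2 * n + 1))"
        unfolding sum.lessThan_Suc_shift left_diff_distrib using nz by simp
    qed
    ultimately show ?case
      by (subst (asm) landau_o.big.in_cong) auto
  qed
  thus ?thesis using c0 unfolding b_def by blast
qed

lemma cP_of_real:
  assumes "x > 0"
  shows "cP (of_real x) = of_real ((bessel_K0 x)\<^sup>2) + \<i> * of_real (pi * bessel_I0 x * bessel_K0 x)"
  using assms
  by (simp add: cP_def cH_def bessel_K0_eq_cK[symmetric] bessel_I0_eq_cI[symmetric] power2_eq_square algebra_simps)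

text \<open>In \<open>cP_invariant\<close> both \<open>cQ\<close> and \<open>cP * cU\<close> tend to
  0 along the positive axis, which leaves pi^2 = - 4 c0^2. The sign is settled there by Im P = pi I0
  K0 \<ge> 0.\<close>

lemma cP_expansion:
  assumes "0 \<le> c" "c < 1/2"
  shows "(\<lambda>z. cP z - (\<Sum>n<N. \<i> * of_real pi / 2 * (IK_fps $ n * 4 ^ n) / z ^ (2 * n + 1))) \<in> O[at_sector c](\<lambda>z. 1 / z ^ (2 * N))"
proof -
  obtain c0 where c0: "((\<lambda>x. of_real x * cP (of_real x)) \<longlongrightarrow> c0) at_top"
     and exp: "\<And>N c. 0 \<le> c \<Longrightarrow> c < 1/2 \<Longrightarrow>
        (\<lambda>z. cP z - (\<Sum>n<N. c0 * (IK_fps $ n * 4 ^ n) / z ^ (2 * n + 1))) \<in> O[at_sector c](\<lambda>z. 1 / z ^ (2 * N))"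
    using cP_expansion_exists by blast
  define b where "b = (\<lambda>n. c0 * (IK_fps $ n * 4 ^ n))"
  have exp1: "(\<lambda>z. cP z - (\<Sum>n<1. b n / z ^ (2 * n + 1))) \<in> O[at_sector c](\<lambda>z. 1 / z ^ (2 * 1))"
    if "0 \<le> c" "c < 1/2" for c unfolding b_def by (rule exp[OF that])
  have inv: "((\<lambda>x. k / complex_of_real x) \<longlongrightarrow> 0) at_top" for k
    using inverse_powers_tendsto_0[of 1 k] by simp
  have "((\<lambda>x. cQ (of_real x) - (- b 0 / of_real x) + (- b 0 / of_real x)) \<longlongrightarrow> 0 + 0) at_top"
    by (intro tendsto_add inv bigo_sector_real_tendsto_0[where p = 2 and c = 0])
       (use cP_derivs_expansion(1)[OF exp1, of 0] in simp_all)
  hence Q: "((\<lambda>x. cQ (of_real x)) \<longlongrightarrow> 0) at_top" by simp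
  have "((\<lambda>x. cU (of_real x) - b 0 / of_real x + b 0 / of_real x) \<longlongrightarrow> 0 + 0) at_top"
    by (intro tendsto_add inv bigo_sector_real_tendsto_0[where p = 2 and c = 0])
       (use cP_derivs_expansion(2)[OF exp1, of 0] in simp_all)
  hence U: "((\<lambda>x. cU (of_real x)) \<longlongrightarrow> 0) at_top" by simp
  have "((\<lambda>x. (of_real x * cP (of_real x)) * (1 / of_real x)) \<longlongrightarrow> c0 * 0) at_top"
    by (intro tendsto_mult c0 inv)
  moreover have "\<forall>\<^sub>F x in at_top. (of_real x * cP (of_real x)) * (1 / of_real x) = cP (of_real x)"
    using eventually_gt_at_top[of 0] by eventually_elim auto
  ultimately have "((\<lambda>x. cP (of_real x)) \<longlongrightarrow> c0 * 0) at_top"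
    by (rule Lim_transform_eventually)
  hence "((\<lambda>x. cP (of_real x)) \<longlongrightarrow> 0) at_top" by simp
  hence L2: "((\<lambda>x. 2 * cP (of_real x) * cU (of_real x) - 4 * (of_real x * cP (of_real x)) ^ 2) \<longlongrightarrow> 2 * 0 * 0 - 4 * c0 ^ 2) at_top"
    by (intro tendsto_intros U c0)
  have L1: "((\<lambda>x. cQ (of_real x) ^ 2 + of_real pi ^ 2) \<longlongrightarrow> 0 ^ 2 + of_real pi ^ 2) at_top"
    by (intro tendsto_intros Q)
  have ev: "\<forall>\<^sub>F x in at_top. cQ (of_real x) ^ 2 + of_real pi ^ 2 =
      2 * cP (of_real x) * cU (of_real x) - 4 * (of_real x * cP (of_real x)) ^ 2"
    using eventually_gt_at_top[of 0]
    by eventually_elim (subst cP_invariant, auto simp: power2_eq_square algebra_simps)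
  have "0 ^ 2 + of_real pi ^ 2 = 2 * 0 * 0 - 4 * c0 ^ 2"
    by (rule tendsto_unique[OF trivial_limit_at_top_linorder Lim_transform_eventually[OF L1 ev] L2])
  hence "(c0 - \<i> * of_real pi / 2) * (c0 + \<i> * of_real pi / 2) = 0"
    by (simp add: algebra_simps power2_eq_square)
  hence disj: "c0 = \<i> * of_real pi / 2 \<or> c0 = - \<i> * of_real pi / 2"
    by (auto simp: add_eq_0_iff)
  have "Im c0 \<ge> 0"
  proof (rule tendsto_lowerbound)
    show "((\<lambda>x. Im (of_real x * cP (of_real x))) \<longlongrightarrow> Im c0) at_top" by (intro tendsto_Im c0)
    show "\<forall>\<^sub>F x in at_top. 0 \<le> Im (of_real x * cP (of_real x))"
      using eventually_gt_at_top[of 0]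
    proof eventually_elim
      case (elim x)
      have "bessel_I0 x \<ge> 0" using bessel_I0_ge_1[of x] by linarith
      thus ?case using elim bessel_K0_nonneg[of x] by (simp add: cP_of_real del: of_real_mult)
    qed
  qed auto
  with disj have eq: "c0 = \<i> * of_real pi / 2" using pi_ge_two by auto
  show ?thesis using exp[OF assms, of N] unfolding eq .
qed

section \<open>Powers of asymptotic expansions\<close>

text \<open>An expansion in Poincare's sense in powers of \<open>w\<close>; the formal series may
  diverge. The case M = 0 says that \<open>f\<close> is bounded.\<close>

definition has_fps_asymp :: "'a filter \<Rightarrow> ('a \<Rightarrow> complex) \<Rightarrow> ('a \<Rightarrow> complex) \<Rightarrow> complex fps \<Rightarrow> bool" where
  "has_fps_asymp F w f A \<longleftrightarrow> (\<forall>M. (\<lambda>z. f z - (\<Sum>n<M. A $ n * w z ^ n)) \<in> O[F](\<lambda>z. w z ^ M))"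

lemma has_fps_asymp_1: "has_fps_asymp F w (\<lambda>_. 1) 1"
  unfolding has_fps_asymp_def
proof
  fix M :: nat
  have "(\<Sum>n<M. (1 :: complex fps) $ n * w z ^ n) = (if M = 0 then 0 else 1)" for z
  proof -
    have "(\<Sum>n<M. (1 :: complex fps) $ n * w z ^ n) = (\<Sum>n<M. if n = 0 then 1 else 0)"
      by (intro sum.cong) auto
    thus ?thesis by simp
  qed
  thus "(\<lambda>z. 1 - (\<Sum>n<M. (1 :: complex fps) $ n * w z ^ n)) \<in> O[F](\<lambda>z. w z ^ M)"
    by simp
qed

lemma has_fps_asymp_mult:
  assumes w: "w \<in> O[F](\<lambda>_. 1)" and f: "has_fps_asymp F w f A" and g: "has_fps_asymp F w g B"
  shows "has_fps_asymp F w (\<lambda>z. f z * g z) (A * B)"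
  unfolding has_fps_asymp_def
proof
  fix M
  define S where "S = (\<lambda>A z. \<Sum>n<M. A $ n * w z ^ n)"
  have w': "(\<lambda>z. w z ^ n) \<in> O[F](\<lambda>_. 1)" for n
    using landau_o.big_power[OF w, of n] by simp
  have wm: "(\<lambda>z. c * w z ^ n) \<in> O[F](\<lambda>z. w z ^ M)" if "n \<ge> M" for n c
  proof -
    have "(\<lambda>z. c * w z ^ (n - M) * w z ^ M) \<in> O[F](\<lambda>z. 1 * w z ^ M)"
      using w'[of "n - M"] by (intro landau_o.big.mult) (auto simp: landau_o.big.cmult_in_iff')
    thus ?thesis using that by (simp add: mult.assoc flip: power_add)
  qed
  have g1: "g \<in> O[F](\<lambda>_. 1)"
    using g[unfolded has_fps_asymp_def, THEN spec, of 0] by simp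
  have SA: "S A \<in> O[F](\<lambda>_. 1)"
    unfolding S_def using w' by (intro big_sum_in_bigo) (auto simp: landau_o.big.cmult_in_iff')
  have 1: "(\<lambda>z. (f z - S A z) * g z) \<in> O[F](\<lambda>z. w z ^ M * 1)"
    using f g1 unfolding has_fps_asymp_def S_def by (intro landau_o.big.mult) auto
  have 2: "(\<lambda>z. S A z * (g z - S B z)) \<in> O[F](\<lambda>z. 1 * w z ^ M)"
    using g SA unfolding has_fps_asymp_def S_def by (intro landau_o.big.mult) auto
  \<comment> \<open>The pairs with \<open>i + j \<ge> M\<close>: their terms are of order
    \<open>w ^ M\<close> because \<open>w\<close> is bounded.\<close>
  define T where "T = {..<M} \<times> {..<M} - {(i,j). i + j < M}"
  let ?V = "\<lambda>z. \<Sum>(i,j)\<in>T. (A $ i * B $ j) * w z ^ (i + j)"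
  have prod: "S A z * S B z = S (A * B) z + (?V z)" for z
  proof -
    have sub: "{(i,j). i + j < M} \<subseteq> {..<M} \<times> {..<M}" by auto
    have "S A z * S B z = (\<Sum>(i,j)\<in>{..<M} \<times> {..<M}. (A $ i * B $ j) * w z ^ (i + j))"
      unfolding S_def sum_product sum.cartesian_product
      by (intro sum.cong refl) (auto simp: power_add mult_ac)
    also have "\<dots> = (?V z) + (\<Sum>(i,j)\<in>{(i,j). i + j < M}. (A $ i * B $ j) * w z ^ (i + j))"
      unfolding T_def by (rule sum.subset_diff[OF sub]) auto
    also have "(\<Sum>(i,j)\<in>{(i,j). i + j < M}. (A $ i * B $ j) * w z ^ (i + j)) = (\<Sum>k<M. \<Sum>i\<le>k. (A $ i * B $ (k - i)) * w z ^ (i + (k - i)))"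
      by (rule sum.triangle_reindex)
    also have "\<dots> = S (A * B) z"
      unfolding S_def fps_mult_nth sum_distrib_right atLeast0AtMost
      by (intro sum.cong refl) auto
    finally show ?thesis by simp
  qed
  have 3: "(\<lambda>z. ?V z) \<in> O[F](\<lambda>z. w z ^ M)"
  proof (rule big_sum_in_bigo)
    fix x assume "x \<in> T"
    thus "(\<lambda>z. case x of (i, j) \<Rightarrow> A $ i * B $ j * w z ^ (i + j)) \<in> O[F](\<lambda>z. w z ^ M)"
      by (auto simp: T_def intro!: wm)
  qed
  have "(\<lambda>z. (f z - S A z) * g z + S A z * (g z - S B z) + (?V z)) \<in> O[F](\<lambda>z. w z ^ M)"
    using 1 2 3 by (intro sum_in_bigo) auto
  also have "(\<lambda>z. (f z - S A z) * g z + S A z * (g z - S B z) + (?V z))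
      = (\<lambda>z. f z * g z - S (A * B) z)"
  proof
    fix z
    show "(f z - S A z) * g z + S A z * (g z - S B z) + (?V z) = f z * g z - S (A * B) z"
      using prod[of z] by (simp add: algebra_simps)
  qed
  finally show "(\<lambda>z. f z * g z - (\<Sum>n<M. (A * B) $ n * w z ^ n)) \<in> O[F](\<lambda>z. w z ^ M)"
    by (simp add: S_def)
qed

lemma has_fps_asymp_power:
  assumes "w \<in> O[F](\<lambda>_. 1)" "has_fps_asymp F w f A"
  shows "has_fps_asymp F w (\<lambda>z. f z ^ N) (A ^ N)"
  by (induction N) (auto intro: has_fps_asymp_mult has_fps_asymp_1 assms)

lemma cP_fps_asymp:
  "has_fps_asymp (at_sector 0) (\<lambda>z. 4 / z ^ 2) (\<lambda>z. z * cP z / (\<i> * of_real pi / 2)) IK_fps"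
  unfolding has_fps_asymp_def
proof
  fix M
  define k where "k = \<i> * of_real pi / 2"
  have k: "k \<noteq> 0" by (simp add: k_def)
  \<comment> \<open>One term beyond the \<open>M\<close> wanted: multiplication by z costs one
    order, and \<open>cP_expansion\<close> with \<open>M\<close> terms would leave an error of order
    1 - 2M. The extra term is itself of order -2M and joins the error.\<close>
  let ?S = "\<lambda>z. \<Sum>n<Suc M. k * (IK_fps $ n * 4 ^ n) / z ^ (2 * n + 1)"
  have pw: "(4 / z ^ 2) ^ n = 4 ^ n / z ^ (2 * n)" for n and z :: complex
    by (simp add: power_divide power_mult)
  have wM: "(\<lambda>z. c / z ^ (2 * M)) \<in> O[at_sector 0](\<lambda>z. (4 / z ^ 2) ^ M)" for c
  proof -
    have "norm c * 1 \<le> norm c * 4 ^ M" by (intro mult_left_mono) auto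
    thus ?thesis unfolding pw
      by (intro bigoI[of _ "norm c"] always_eventually allI) (simp add: norm_divide norm_power divide_right_mono)
  qed
  have z1: "(\<lambda>z. 1 / z) \<in> O[at_sector 0](\<lambda>_. 1)"
    by (rule landau_o.bigI[of 1]) (auto simp: eventually_at_sector norm_divide divide_simps intro!: exI[of _ 1])
  have zz: "(\<lambda>z. z) \<in> O[at_sector 0](\<lambda>z. z)" by simp
  have "(\<lambda>z. z * (cP z - ?S z)) \<in> O[at_sector 0](\<lambda>z. z * (1 / z ^ (2 * Suc M)))"
    unfolding k_def by (rule landau_o.big.mult[OF zz cP_expansion]) auto
  also have "(\<lambda>z. z * (1 / z ^ (2 * Suc M))) = (\<lambda>z::complex. 1 / z * (1 / z ^ (2 * M)))"
    by (auto simp: fun_eq_iff divide_simps)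
  also have "(\<lambda>z. 1 / z * (1 / z ^ (2 * M))) \<in> O[at_sector 0](\<lambda>z. 1 * (4 / z ^ 2) ^ M)"
    by (intro landau_o.big.mult z1 wM)
  finally have 1: "(\<lambda>z. z * (cP z - ?S z)) \<in> O[at_sector 0](\<lambda>z. (4 / z ^ 2) ^ M)"
    by simp
  have const: "(\<lambda>_. 1 / k) \<in> O[at_sector 0](\<lambda>_. 1)" by simp
  have "(\<lambda>z. (1 / k) * (z * (cP z - ?S z) + (k * IK_fps $ M * 4 ^ M) / z ^ (2 * M))) \<in> O[at_sector 0](\<lambda>z. (4 / z ^ 2) ^ M)"
    using landau_o.big.mult[OF const sum_in_bigo(1)[OF 1 wM]] unfolding mult_1_left .
  moreover have "\<forall>\<^sub>F z in at_sector 0. (1 / k) * (z * (cP z - ?S z) + (k * IK_fps $ M * 4 ^ M) / z ^ (2 * M))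
       = z * cP z / k - (\<Sum>n<M. IK_fps $ n * (4 / z ^ 2) ^ n)"
    unfolding eventually_at_sector
  proof (intro exI[of _ 1] ballI impI)
    fix z :: complex assume "norm z \<ge> 1"
    hence nz: "z \<noteq> 0" by auto
    have s: "z * (\<Sum>n<M. k * (IK_fps $ n * 4 ^ n) / z ^ (2 * n + 1)) = k * (\<Sum>n<M. IK_fps $ n * (4 / z ^ 2) ^ n)"
      unfolding sum_distrib_left pw by (intro sum.cong refl) (use nz in simp)
    have "z * (cP z - ?S z) + (k * IK_fps $ M * 4 ^ M) / z ^ (2 * M)
       = z * cP z - z * (\<Sum>n<M. k * (IK_fps $ n * 4 ^ n) / z ^ (2 * n + 1))"
      using nz by (simp add: ring_distribs)
    also have "\<dots> = z * cP z - k * (\<Sum>n<M. IK_fps $ n * (4 / z ^ 2) ^ n)" unfolding s ..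
    finally show "(1 / k) * (z * (cP z - ?S z) + (k * IK_fps $ M * 4 ^ M) / z ^ (2 * M))
       = z * cP z / k - (\<Sum>n<M. IK_fps $ n * (4 / z ^ 2) ^ n)"
      using k by (simp add: field_simps)
  qed
  ultimately show "(\<lambda>z. z * cP z / (\<i> * of_real pi / 2) - (\<Sum>n<M. IK_fps $ n * (4 / z ^ 2) ^ n)) \<in> O[at_sector 0](\<lambda>z. (4 / z ^ 2) ^ M)"
    unfolding k_def[symmetric] by (subst (asm) landau_o.big.in_cong) auto
qed

text \<open>The condition on \<open>M\<close> makes the exponent \<open>2 * i - N - 2 * M\<close> of
  the remainder at most -2, so that a path of length proportional to R at distance of order R
  contributes O(1/R).\<close>

lemma cP_power_expansion:
  assumes M: "2 * i + 2 \<le> 2 * M + N"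
  shows "(\<lambda>z. cP z ^ N * z ^ (2 * i) - (\<i> * of_real pi / 2) ^ N * (\<Sum>n<M. (IK_fps ^ N) $ n * 4 ^ n * z powi (2 * int i - int N - 2 * int n)))
           \<in> O[at_sector 0](\<lambda>z. 1 / z ^ 2)"
proof -
  define k where "k = \<i> * of_real pi / 2"
  have k: "k \<noteq> 0" by (simp add: k_def)
  define w where "w = (\<lambda>z::complex. 4 / z ^ 2)"
  let ?W = "\<lambda>z. \<Sum>n<M. (IK_fps ^ N) $ n * w z ^ n"
  let ?S = "\<lambda>z. \<Sum>n<M. (IK_fps ^ N) $ n * 4 ^ n * z powi (2 * int i - int N - 2 * int n)"
  have pw: "(4 / z ^ 2) ^ n = 4 ^ n / z ^ (2 * n)" for n and z :: complex
    by (simp add: power_divide power_mult)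
  have w1: "w \<in> O[at_sector 0](\<lambda>_. 1)"
    unfolding w_def
    by (rule landau_o.bigI[of 4]) (auto simp: eventually_at_sector norm_divide norm_power divide_simps intro!: exI[of _ 1])
  have p: "(\<lambda>z. (z * cP z / k) ^ N - ?W z) \<in> O[at_sector 0](\<lambda>z. w z ^ M)"
    using has_fps_asymp_power[OF w1 cP_fps_asymp[folded w_def], of N] unfolding has_fps_asymp_def k_def by blast
  have q: "(\<lambda>z. k ^ N * (z ^ (2 * i) / z ^ N)) \<in> O[at_sector 0](\<lambda>z. z ^ (2 * i) / z ^ N)"
    using k by (intro landau_o.bigI[of "norm (k ^ N)"]) (auto simp: norm_mult norm_divide)
  have "(\<lambda>z. k ^ N * (z ^ (2 * i) / z ^ N) * ((z * cP z / k) ^ N - ?W z))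
     \<in> O[at_sector 0](\<lambda>z. z ^ (2 * i) / z ^ N * w z ^ M)"
    by (rule landau_o.big.mult[OF q p])
  also have "(\<lambda>z. z ^ (2 * i) / z ^ N * w z ^ M) \<in> O[at_sector 0](\<lambda>z. 1 / z ^ 2)"
  proof (rule landau_o.bigI[of "4 ^ M"])
    show "\<forall>\<^sub>F z in at_sector 0. norm (z ^ (2 * i) / z ^ N * w z ^ M) \<le> 4 ^ M * norm (1 / z ^ 2)"
      unfolding eventually_at_sector
    proof (intro exI[of _ 1] ballI impI)
      fix z :: complex assume z: "norm z \<ge> 1"
      have "norm z ^ (2 * i + 2) \<le> norm z ^ (2 * M + N)" using M z by (intro power_increasing) auto
      hence "norm z ^ (2 * i) * norm z ^ 2 \<le> norm z ^ N * norm z ^ (2 * M)"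
        by (simp only: power_add mult_ac)
      moreover have "norm z > 0" using z by linarith
      ultimately have "norm z ^ (2 * i) / (norm z ^ N * norm z ^ (2 * M)) \<le> 1 / norm z ^ 2"
        by (simp add: divide_simps)
      hence "4 ^ M * (norm z ^ (2 * i) / (norm z ^ N * norm z ^ (2 * M))) \<le> 4 ^ M * (1 / norm z ^ 2)"
        by (intro mult_left_mono) auto
      thus "norm (z ^ (2 * i) / z ^ N * w z ^ M) \<le> 4 ^ M * norm (1 / z ^ 2)"
        unfolding w_def pw by (simp add: norm_mult norm_divide norm_power mult_ac)
    qed
  qed auto
  finally have "(\<lambda>z. k ^ N * (z ^ (2 * i) / z ^ N) * ((z * cP z / k) ^ N - ?W z)) \<in> O[at_sector 0](\<lambda>z. 1 / z ^ 2)" .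
  moreover have "\<forall>\<^sub>F z in at_sector 0. k ^ N * (z ^ (2 * i) / z ^ N) * ((z * cP z / k) ^ N - ?W z) =
      cP z ^ N * z ^ (2 * i) - k ^ N * ?S z"
    unfolding eventually_at_sector
  proof (intro exI[of _ 1] ballI impI)
    fix z :: complex assume "norm z \<ge> 1"
    hence nz: "z \<noteq> 0" by auto
    have "z powi (2 * int i - int N - 2 * int n) = z ^ (2 * i) / z ^ N / z ^ (2 * n)" for n
    proof -
      have "z powi (int (2 * i) - int N - int (2 * n)) = z ^ (2 * i) / z ^ N / z ^ (2 * n)"
        using nz by (simp only: power_int_diff power_int_of_nat simp_thms)
      thus ?thesis by simp
    qed
    hence s: "(z ^ (2 * i) / z ^ N) * ?W z = ?S z"
      unfolding sum_distrib_left w_def pw by (intro sum.cong refl) simp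
    have "k ^ N * (z ^ (2 * i) / z ^ N) * (z * cP z / k) ^ N = cP z ^ N * z ^ (2 * i)"
      using nz k by (simp add: power_mult_distrib power_divide)
    thus "k ^ N * (z ^ (2 * i) / z ^ N) * ((z * cP z / k) ^ N - ?W z) =
      cP z ^ N * z ^ (2 * i) - k ^ N * ?S z"
      unfolding s[symmetric] by (simp add: right_diff_distrib mult.assoc)
  qed
  ultimately show ?thesis
    unfolding k_def[symmetric] by (subst (asm) landau_o.big.in_cong) auto
qed

lemma IK_coeff_eq: "complex_of_real (of_rat (IK_coeff k n)) = (IK_fps ^ (k div 2)) $ n"
proof -
  define A :: "rat fps" where "A = Abs_fps (\<lambda>m. of_nat (odd_double_fact m) ^ 3 / (2 ^ (5 * m) * fact m))"
  have A: "complex_of_real (of_rat (A $ n)) = IK_fps $ n" for n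
  proof -
    have "of_rat (fact n) = (fact n :: real)" by (metis of_nat_fact of_rat_of_nat_eq)
    thus ?thesis by (simp add: A_def IK_fps_def of_rat_divide of_rat_mult of_rat_power)
  qed
  have "complex_of_real (of_rat ((A ^ N) $ n)) = (IK_fps ^ N) $ n" for N n
  proof (induction N arbitrary: n)
    case (Suc N)
    thus ?case by (simp add: fps_mult_nth of_rat_sum of_rat_mult A)
  qed (auto simp: fps_one_def)
  thus ?thesis by (simp add: IK_coeff_def A_def)
qed

section \<open>Integration along the positive axis\<close>

text \<open>A logarithm is smaller than any negative power. With \<open>d\<close> free, any number
  of factors can still have an integrable singularity.\<close>

lemma norm_cK_cH_near_0:
  assumes d: "d > 0"
  shows "\<exists>C>0. \<forall>z. z \<noteq> 0 \<longrightarrow> norm z \<le> 1 \<longrightarrow> norm (cK z) \<le> C * norm z powr (- d) \<and> norm (cH z) \<le> C * norm z powr (- d)"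
proof -
  define B where "B = exp 1 + (1 / d + pi) * exp 1 + \<bar>kappa\<bar> * exp 1"
  define C where "C = B + pi * exp 1"
  have "norm (cK z) \<le> B * norm z powr (- d) \<and> norm (cH z) \<le> C * norm z powr (- d)"
    if z: "z \<noteq> 0" "norm z \<le> 1" for z
  proof -
    define p where "p = norm z powr (- d)"
    have p1: "p \<ge> 1" unfolding p_def using z d by (subst powr_minus_divide) (auto simp: powr_le1)
    have "norm z ^ 2 \<le> 1" using z by (intro power_le_one) auto
    hence e: "exp (norm z ^ 2 / 4) \<le> exp 1" by simp
    have I: "norm (cI z) \<le> exp 1" and E: "norm (cE z) \<le> exp 1"
      using norm_cI_le_exp_square[of z] norm_cE_le_exp_square[of z] e by linarith+
    have "norm (Ln z) \<le> \<bar>ln (norm z)\<bar> + pi" by (rule norm_Ln_le[OF z(1)])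
    also have "\<bar>ln (norm z)\<bar> = ln (1 / norm z)" using z by (simp add: ln_div)
    also have "\<dots> \<le> (1 / norm z) powr d / d" using z d by (intro ln_powr_bound) auto
    also have "(1 / norm z) powr d = p" using z by (simp add: p_def powr_minus_divide powr_divide)
    finally have "norm (Ln z) \<le> p / d + pi" by simp
    also have "\<dots> \<le> p / d + pi * p" using p1 by simp
    finally have L: "norm (Ln z) \<le> (1 / d + pi) * p" by (simp add: algebra_simps)
    have "norm (Ln z * cI z) \<le> ((1 / d + pi) * p) * exp 1"
      unfolding norm_mult using L I d p1 by (intro mult_mono) auto
    moreover have "\<bar>kappa\<bar> * norm (cI z) \<le> \<bar>kappa\<bar> * (exp 1 * p)"
      using I p1 mult_mono[OF I p1] by (intro mult_left_mono) auto
    moreover have "norm (cE z) \<le> exp 1 * p" using mult_mono[OF E p1] by simp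
    moreover have "norm (cK z) \<le> norm (cE z) + norm (Ln z * cI z) + \<bar>kappa\<bar> * norm (cI z)"
      unfolding cK_def cY_def
      by (rule order.trans[OF norm_triangle_ineq] add_mono norm_triangle_ineq4)+ (simp add: norm_mult)
    ultimately have K: "norm (cK z) \<le> B * p" by (simp add: B_def algebra_simps)
    have "norm (cH z) \<le> norm (cK z) + pi * norm (cI z)"
      unfolding cH_def by (rule order.trans[OF norm_triangle_ineq]) (simp add: norm_mult)
    also have "pi * norm (cI z) \<le> pi * (exp 1 * p)"
      using mult_mono[OF I p1] by (intro mult_left_mono) auto
    finally have "norm (cH z) \<le> C * p" using K by (simp add: C_def algebra_simps)
    thus ?thesis using K by (simp add: p_def)
  qed
  moreover have "B \<le> C" by (simp add: C_def)
  ultimately have "norm (cK z) \<le> C * norm z powr (- d) \<and> norm (cH z) \<le> C * norm z powr (- d)"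
    if "z \<noteq> 0" "norm z \<le> 1" for z
    using that by (meson mult_right_mono order_trans powr_ge_zero)
  moreover have "C > 0" using d by (auto simp: C_def B_def intro!: add_pos_nonneg add_nonneg_pos)
  ultimately show ?thesis by blast
qed

lemma set_integrable_lborel_of_integrable_on:
  fixes f :: "real \<Rightarrow> real"
  assumes "f integrable_on A" "\<And>x. x \<in> A \<Longrightarrow> f x \<ge> 0" "A \<in> sets borel" "f \<in> borel_measurable borel"
  shows "set_integrable lborel A f"
proof -
  have "f absolutely_integrable_on A" using assms by (intro nonnegative_absolutely_integrable_1) auto
  thus ?thesis unfolding set_integrable_def
    using assms(3,4) by (subst (asm) integrable_completion) auto
qed

lemma set_integrable_inverse_sqrt: "set_integrable lborel {0<..1} (\<lambda>x::real. x powr (-1/2))"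
  by (rule set_integrable_lborel_of_integrable_on) (auto intro: integrable_on_powr_from_0')

lemma set_integrable_inverse_square: "R > 0 \<Longrightarrow> set_integrable lborel {R<..} (\<lambda>x. 1 / x ^ 2)" for R :: real
proof (rule set_integrable_subset)
  assume R: "R > 0"
  have "(\<lambda>x. 1 / x ^ 2) integrable_on {R..}"
    using has_integral_inverse_power_to_inf[of 2 R] R by (auto simp: integrable_on_def)
  thus "set_integrable lborel {R..} (\<lambda>x. 1 / x ^ 2)"
    by (rule set_integrable_lborel_of_integrable_on) auto
qed auto

lemma set_integrable_near_0:
  fixes f :: "real \<Rightarrow> real"
  assumes cont: "continuous_on {0<..} f"
    and near0: "\<And>x. 0 < x \<Longrightarrow> x \<le> 1 \<Longrightarrow> \<bar>f x\<bar> \<le> C * x powr (-1/2)"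
  shows "set_integrable lborel {0<..R} f"
proof -
  have meas: "set_borel_measurable lborel S f" if "S \<subseteq> {0<..}" "S \<in> sets borel" for S
    using borel_measurable_continuous_on_indicator[OF that(2) continuous_on_subset[OF cont that(1)]]
    by (simp add: set_borel_measurable_def)
  have "set_integrable lborel {0<..1} f"
  proof (rule set_integrable_bound)
    show "set_integrable lborel {0<..1} (\<lambda>x. C * x powr (-1/2))"
      by (intro set_integrable_mult_right set_integrable_inverse_sqrt)
    show "set_borel_measurable lborel {0<..1} f" by (rule meas) auto
    show "AE x in lborel. x \<in> {0<..1} \<longrightarrow> norm (f x) \<le> norm (C * x powr (-1/2))"
      using near0 by (auto intro!: AE_I2 order.trans[OF near0])
  qed
  moreover have "set_integrable lborel {1..max 1 R} f"
    by (rule borel_integrable_atLeastAtMost') (use cont in \<open>auto intro: continuous_on_subset\<close>)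
  ultimately have "set_integrable lborel ({0<..1} \<union> {1..max 1 R}) f"
    by (rule set_integrable_Un) auto
  thus ?thesis by (rule set_integrable_subset) auto
qed

lemma set_integrable_Ioi:
  fixes f :: "real \<Rightarrow> real"
  assumes cont: "continuous_on {0<..} f"
    and near0: "\<And>x. 0 < x \<Longrightarrow> x \<le> 1 \<Longrightarrow> \<bar>f x\<bar> \<le> C * x powr (-1/2)"
    and inf: "f \<in> O[at_top](\<lambda>x. 1 / x ^ 2)"
  shows "set_integrable lborel {0<..} f"
proof -
  from inf obtain D where D: "D > 0" "\<forall>\<^sub>F x in at_top. norm (f x) \<le> D * norm (1 / x ^ 2)"
    by (auto elim: landau_o.bigE)
  then obtain R0 where R0: "\<And>x. x \<ge> R0 \<Longrightarrow> norm (f x) \<le> D * norm (1 / x ^ 2)"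
    by (auto simp: eventually_at_top_linorder)
  define R where "R = max R0 1"
  have "set_integrable lborel {R<..} f"
  proof (rule set_integrable_bound)
    show "set_integrable lborel {R<..} (\<lambda>x. D * (1 / x ^ 2))"
      by (intro set_integrable_mult_right set_integrable_inverse_square) (simp add: R_def)
    have "continuous_on {R<..} f" by (rule continuous_on_subset[OF cont]) (auto simp: R_def)
    thus "set_borel_measurable lborel {R<..} f"
      using borel_measurable_continuous_on_indicator[of "{R<..}" f] by (simp add: set_borel_measurable_def)
    show "AE x in lborel. x \<in> {R<..} \<longrightarrow> norm (f x) \<le> norm (D * (1 / x ^ 2))"
      using R0 D(1) by (auto intro!: AE_I2 simp: R_def abs_mult)
  qed
  moreover have "set_integrable lborel {0<..R} f" by (rule set_integrable_near_0[OF cont near0])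
  ultimately have "set_integrable lborel ({R<..} \<union> {0<..R}) f" by (intro set_integrable_Un) auto
  thus ?thesis by (rule set_integrable_subset) (auto simp: R_def)
qed

lemma tendsto_set_integral_Ioc:
  fixes f :: "real \<Rightarrow> real"
  assumes "set_integrable lborel {0<..} f"
  shows "((\<lambda>R. LBINT x:{0<..R}. f x) \<longlongrightarrow> (LBINT x:{0<..}. f x)) at_top"
proof -
  \<comment> \<open>The indicator removes the value at 0, so that the limit over closed intervals
    \<open>{0..R}\<close> can be applied.\<close>
  have 1: "(LBINT x:A. indicator {0<..} x * f x) = (LBINT x:A \<inter> {0<..}. f x)" for A
    unfolding set_lebesgue_integral_def
    by (intro Bochner_Integration.integral_cong) (auto simp: indicator_def)
  have "set_integrable lborel {0..} (\<lambda>x. indicator {0<..} x * f x)"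
  proof -
    have "(\<lambda>x. indicator {0..} x *\<^sub>R (indicator {0<..} x * f x)) = (\<lambda>x. indicator {0<..} x *\<^sub>R f x)"
      by (auto simp: indicator_def fun_eq_iff)
    thus ?thesis using assms unfolding set_integrable_def by simp
  qed
  from tendsto_set_lebesgue_integral_at_top[OF _ this]
  have "((\<lambda>R. LBINT x:{0..R}. indicator {0<..} x * f x) \<longlongrightarrow> (LBINT x:{0..}. indicator {0<..} x * f x)) at_top"
    by simp
  moreover have "{0..R} \<inter> {0<..} = {0<..R}" "{0..} \<inter> {0<..} = {0::real<..}" for R :: real by auto
  ultimately show ?thesis unfolding 1 by simp
qed

lemma slit_starlike: "starlike slit"
proof -
  have "\<real>\<^sub>\<le>\<^sub>0 = complex_of_real ` {..0}" by (auto simp: nonpos_Reals_def)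
  thus ?thesis using starlike_slotted_complex_plane_left[of 0] by simp
qed

lemma of_real_in_slit: "x > 0 \<Longrightarrow> complex_of_real x \<in> slit"
  and ii_times_in_slit: "x > 0 \<Longrightarrow> \<i> * complex_of_real x \<in> slit"
  by (auto simp: complex_nonpos_Reals_iff)

text \<open>The chord from R to \<i> R stands in for the quarter circle: it has the same end points,
  suits the mean value inequality, and its distance from 0 is still of order R.\<close>

lemma segment_quadrant:
  assumes R: "R > 0" and w: "w \<in> closed_segment (of_real R) (\<i> * of_real R)"
  shows "w \<in> sector 0" "norm w \<ge> R / 2" "norm w \<le> R" "w \<in> slit"
proof -
  obtain u where u: "0 \<le> u" "u \<le> 1" "w = (1 - u) *\<^sub>R of_real R + u *\<^sub>R (\<i> * of_real R)"
    using w by (auto simp: closed_segment_def)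
  have eq: "Re w = (1 - u) * R" "Im w = u * R" by (simp_all add: u(3))
  have nn: "Re w \<ge> 0" "Im w \<ge> 0" using u R by (auto simp: eq)
  have sum: "Re w + Im w = R" by (simp add: eq algebra_simps)
  show 1: "w \<in> sector 0" using nn by (simp add: sector_def)
  show 2: "norm w \<ge> R / 2" using Re_plus_Im_le[of w] sum by linarith
  show "norm w \<le> R" using cmod_le[of w] nn sum by simp
  show "w \<in> slit" by (rule sector_subset_slit[OF _ _ 1]) (use 2 R in auto)
qed

lemma norm_ii_chord: "R > 0 \<Longrightarrow> norm (\<i> * complex_of_real R - of_real R) \<le> 2 * R"
  using norm_triangle_ineq4[of "\<i> * complex_of_real R" "of_real R"] by (simp add: norm_mult)

lemma cP_power_near_0:
  assumes N: "N > 0"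
  shows "\<exists>C>0. \<forall>z. z \<noteq> 0 \<longrightarrow> norm z \<le> 1 \<longrightarrow> norm (cP z ^ N * z ^ (2 * i)) \<le> C * norm z powr (-1/2)"
proof -
  \<comment> \<open>\<open>cP ^ N\<close> consists of 2N factors, so the exponent 1/(4N) for each
    adds up to 1/2.\<close>
  obtain C where C: "C > 0" "\<And>z. z \<noteq> 0 \<Longrightarrow> norm z \<le> 1 \<Longrightarrow>
      norm (cK z) \<le> C * norm z powr (- (1 / (4 * N))) \<and> norm (cH z) \<le> C * norm z powr (- (1 / (4 * N)))"
    using norm_cK_cH_near_0[of "1 / (4 * N)"] N by auto
  have "norm (cP z ^ N * z ^ (2 * i)) \<le> C ^ (2 * N) * norm z powr (-1/2)" if z: "z \<noteq> 0" "norm z \<le> 1" for z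
  proof -
    define p where "p = norm z powr (- (1 / (4 * N)))"
    have "norm (cP z) \<le> (C * p) * (C * p)"
      unfolding cP_def norm_mult using C(2)[OF z] C(1) by (intro mult_mono) (auto simp: p_def)
    hence "norm (cP z) ^ N \<le> ((C * p) * (C * p)) ^ N" by (intro power_mono) auto
    also have "\<dots> = C ^ (2 * N) * p ^ (2 * N)" by (simp add: power_mult power2_eq_square power_mult_distrib mult_ac)
    also have "p ^ (2 * N) = norm z powr (-1/2)"
      unfolding p_def using N z by (subst powr_power) auto
    finally have 1: "norm (cP z) ^ N \<le> C ^ (2 * N) * norm z powr (-1/2)" .
    have "norm z ^ (2 * i) \<le> 1" using z by (intro power_le_one) auto
    hence "norm (cP z) ^ N * norm z ^ (2 * i) \<le> (C ^ (2 * N) * norm z powr (-1/2)) * 1"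
      using 1 by (intro mult_mono) auto
    thus ?thesis by (simp add: norm_mult norm_power)
  qed
  thus ?thesis using C(1) by (intro exI[of _ "C ^ (2 * N)"]) auto
qed

text \<open>On the imaginary axis the derivative of \<open>Re Phi\<close> is the real part of \<i>
  times a real number, so \<open>Re Phi\<close> is constant there. Near 0 only the difference of
  \<open>Phi\<close> at e and at \<i> e matters: a chord of length at most 2 e times an integrand of
  size e^(-1/2).\<close>

lemma integral_eq_primitive:
  fixes N i :: nat
  defines "F \<equiv> \<lambda>z. cP z ^ N * z ^ (2 * i)"
  assumes N: "N > 0"
    and Phi: "\<And>z. z \<in> slit \<Longrightarrow> (Phi has_field_derivative F z) (at z)"
    and R: "R > 0"
  shows "(LBINT x:{0<..R}. Re (F (of_real x))) = Re (Phi (of_real R)) - Re (Phi (\<i> * of_real R))"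
proof -
  obtain C where C: "C > 0" "\<And>z. z \<noteq> 0 \<Longrightarrow> norm z \<le> 1 \<Longrightarrow> norm (F z) \<le> C * norm z powr (-1/2)"
    using cP_power_near_0[OF N, of i] unfolding F_def by blast
  have holF: "F holomorphic_on slit"
    unfolding F_def by (intro holomorphic_intros cP_holomorphic)
  have contF: "continuous_on slit F" using holF by (rule holomorphic_on_imp_continuous_on)
  have contR: "continuous_on {0<..} (\<lambda>x. Re (F (of_real x)))"
    by (intro continuous_intros continuous_on_compose2[OF contF]) (use of_real_in_slit in auto)
  have int: "set_integrable lborel {0<..R} (\<lambda>x. Re (F (of_real x)))"
  proof (rule set_integrable_near_0[OF contR])
    fix x :: real assume "0 < x" "x \<le> 1"
    thus "\<bar>Re (F (of_real x))\<bar> \<le> C * x powr (-1/2)"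
      using C(2)[of "of_real x"] abs_Re_le_cmod[of "F (of_real x)"] by simp
  qed
  have axis: "Re (Phi (\<i> * of_real y)) = Re (Phi (\<i> * of_real R))" if "y > 0" for y
  proof -
    have "((\<lambda>y. Re (Phi (\<i> * of_real y))) has_real_derivative 0) (at y)" if y: "y > 0" for y
    proof -
      have "F (\<i> * of_real y) \<in> \<real>"
      proof -
        have "(\<i> * complex_of_real y) ^ (2 * i) = of_real ((- (y\<^sup>2)) ^ i)"
          by (simp add: power_mult power_mult_distrib)
        thus ?thesis unfolding F_def using cP_imaginary_axis[OF y] by auto
      qed
      hence "Im (F (\<i> * of_real y)) = 0" by (simp add: complex_is_Real_iff)
      moreover have "((\<lambda>y. Phi (\<i> * of_real y)) has_vector_derivative (\<i> * F (\<i> * of_real y))) (at y)"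
      proof -
        have "((\<lambda>y. \<i> * complex_of_real y) has_vector_derivative \<i> * of_real 1) (at y)"
          by (intro has_vector_derivative_mult_right has_vector_derivative_of_real DERIV_ident)
        from field_vector_diff_chain_at[OF this Phi[OF ii_times_in_slit[OF y]]]
        show ?thesis by (simp add: o_def)
      qed
      hence "((\<lambda>y. Re (Phi (\<i> * of_real y))) has_vector_derivative Re (\<i> * F (\<i> * of_real y))) (at y)"
        by (rule bounded_linear.has_vector_derivative[OF bounded_linear_Re])
      ultimately show ?thesis by (simp add: has_real_derivative_iff_has_vector_derivative)
    qed
    thus ?thesis
      using DERIV_isconst3[of 0 "max y R + 1" y R "\<lambda>y. Re (Phi (\<i> * of_real y))"] that R by auto
  qed
  have FTC: "(LBINT x:{e..R}. Re (F (of_real x))) = Re (Phi (of_real R)) - Re (Phi (of_real e))" if e: "0 < e" "e \<le> R" for e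
    unfolding set_lebesgue_integral_def
  proof (rule integral_FTC_atLeastAtMost[OF e(2)])
    fix x assume x: "e \<le> x" "x \<le> R"
    have "((\<lambda>x. Phi (of_real x)) has_vector_derivative F (of_real x)) (at x within {e..R})"
      using has_vector_derivative_real_field[OF Phi[OF of_real_in_slit[of x]]] e x
      by (simp add: o_def has_vector_derivative_at_within)
    thus "((\<lambda>x. Re (Phi (of_real x))) has_vector_derivative Re (F (of_real x))) (at x within {e..R})"
      by (rule bounded_linear.has_vector_derivative[OF bounded_linear_Re])
  qed (use contR e in \<open>auto intro: continuous_on_subset\<close>)
  have small: "norm (Phi (\<i> * of_real e) - Phi (of_real e)) \<le> C * (e / 2) powr (-1/2) * (2 * e)" if e: "0 < e" "e \<le> 1" for e
  proof -
    have "norm (Phi (\<i> * of_real e) - Phi (of_real e)) \<le> C * (e / 2) powr (-1/2) * norm (\<i> * of_real e - complex_of_real e)"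
    proof (rule field_differentiable_bound[where f' = F])
      fix w assume w: "w \<in> closed_segment (complex_of_real e) (\<i> * of_real e)"
      note q = segment_quadrant[OF e(1) w]
      show "(Phi has_field_derivative F w) (at w within closed_segment (complex_of_real e) (\<i> * of_real e))"
        by (rule has_field_derivative_at_within[OF Phi[OF q(4)]])
      have "norm (F w) \<le> C * norm w powr (-1/2)" using q e by (intro C) auto
      also have "norm w powr (-1/2) \<le> (e / 2) powr (-1/2)" using q e by (intro powr_mono2') auto
      finally show "norm (F w) \<le> C * (e / 2) powr (-1/2)" using C(1) by simp
    qed auto
    also have "\<dots> \<le> C * (e / 2) powr (-1/2) * (2 * e)"
      using norm_ii_chord[OF e(1)] C(1) by (intro mult_left_mono) auto
    finally show ?thesis .
  qed
  have "((\<lambda>e. Phi (\<i> * of_real e) - Phi (of_real e)) \<longlongrightarrow> 0) (at_right 0)"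
  proof (rule Lim_null_comparison)
    show "\<forall>\<^sub>F e in at_right 0. norm (Phi (\<i> * of_real e) - Phi (of_real e)) \<le> C * (e / 2) powr (-1/2) * (2 * e)"
      using eventually_at_right_real[OF zero_less_one] by eventually_elim (rule small; simp)
    show "((\<lambda>e. C * (e / 2) powr (-1/2) * (2 * e)) \<longlongrightarrow> 0) (at_right 0)"
      by real_asymp
  qed
  from tendsto_Re[OF this]
  have "((\<lambda>e. Re (Phi (\<i> * of_real e) - Phi (of_real e))) \<longlongrightarrow> 0) (at_right 0)" by simp
  moreover have "\<forall>\<^sub>F e in at_right 0. Re (Phi (\<i> * of_real e) - Phi (of_real e)) = Re (Phi (\<i> * of_real R)) - Re (Phi (of_real e))"
    using eventually_at_right_less[of "0::real"] by eventually_elim (simp add: axis)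
  ultimately have lim1: "((\<lambda>e. Re (Phi (\<i> * of_real R)) - Re (Phi (of_real e))) \<longlongrightarrow> 0) (at_right 0)"
    by (rule Lim_transform_eventually)
  have lim2: "((\<lambda>e. Re (Phi (of_real R)) - Re (Phi (of_real e))) \<longlongrightarrow> (LBINT x:{0<..R}. Re (F (of_real x)))) (at_right 0)"
  proof (rule Lim_transform_eventually)
    show "((\<lambda>e. LBINT x:{e..R}. Re (F (of_real x))) \<longlongrightarrow> (LBINT x:{0<..R}. Re (F (of_real x)))) (at_right 0)"
      by (rule tendsto_set_lebesgue_integral_at_right[OF R _ int]) auto
    show "\<forall>\<^sub>F e in at_right 0. (LBINT x:{e..R}. Re (F (of_real x))) = Re (Phi (of_real R)) - Re (Phi (of_real e))"
      using eventually_at_right_real[OF R] by eventually_elim (auto intro!: FTC)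
  qed
  have "((\<lambda>e. (Re (Phi (of_real R)) - Re (Phi (of_real e))) - (Re (Phi (\<i> * of_real R)) - Re (Phi (of_real e))))
     \<longlongrightarrow> (LBINT x:{0<..R}. Re (F (of_real x))) - 0) (at_right 0)"
    by (intro tendsto_diff lim1 lim2)
  hence "((\<lambda>e::real. Re (Phi (of_real R)) - Re (Phi (\<i> * of_real R))) \<longlongrightarrow> (LBINT x:{0<..R}. Re (F (of_real x)))) (at_right 0)"
    by simp
  thus ?thesis by (subst (asm) tendsto_const_iff) auto
qed

text \<open>What remains after the explicit part is O(1/z^2), and its primitive changes by O(1/R)
  along the chord. Only differences between R and \<i> R occur, so additive constants of the
  primitives cancel.\<close>

lemma integral_asymp:
  fixes N i M :: nat
  assumes N: "N > 0" and M: "2 * i + 2 \<le> 2 * M + N"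
    and Psi: "\<And>z. z \<in> slit \<Longrightarrow> (Psi has_field_derivative
        (\<i> * of_real pi / 2) ^ N * (\<Sum>n<M. (IK_fps ^ N) $ n * 4 ^ n * z powi (2 * int i - int N - 2 * int n))) (at z)"
  shows "((\<lambda>R. (LBINT x:{0<..R}. Re (cP (of_real x) ^ N * of_real x ^ (2 * i))) -
            (Re (Psi (of_real R)) - Re (Psi (\<i> * of_real R)))) \<longlongrightarrow> 0) at_top"
proof -
  define F where "F = (\<lambda>z. cP z ^ N * z ^ (2 * i))"
  define E where "E = (\<lambda>z. (\<i> * of_real pi / 2) ^ N * (\<Sum>n<M. (IK_fps ^ N) $ n * 4 ^ n * z powi (2 * int i - int N - 2 * int n)))"
  have holF: "F holomorphic_on slit"
    unfolding F_def by (intro holomorphic_intros cP_holomorphic)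
  obtain Phi where Phi: "\<And>z. z \<in> slit \<Longrightarrow> (Phi has_field_derivative F z) (at z)"
    using holomorphic_starlike_primitive[of slit F "{}"] slit_starlike holF
    by (auto simp: holomorphic_on_imp_continuous_on holomorphic_on_imp_differentiable_at open_Compl)
  let ?d = "\<lambda>R. (Phi (\<i> * of_real R) - Psi (\<i> * of_real R)) - (Phi (of_real R) - Psi (of_real R))"
  have "(\<lambda>z. F z - E z) \<in> O[at_sector 0](\<lambda>z. 1 / z ^ 2)"
    unfolding F_def E_def by (rule cP_power_expansion[OF M])
  then obtain C R0 where C: "C > 0" "R0 \<ge> 1" "\<And>z. z \<in> sector 0 \<Longrightarrow> norm z \<ge> R0 \<Longrightarrow> norm (F z - E z) \<le> C / norm z ^ 2"
    unfolding bigo_sector_iff by blast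
  have bound: "norm (?d R) \<le> C / (R / 2) ^ 2 * (2 * R)"
    if R: "R \<ge> 2 * R0" for R
  proof -
    have R': "R > 0" using R C by linarith
    have "norm (?d R)
        \<le> C / (R / 2) ^ 2 * norm (\<i> * of_real R - complex_of_real R)"
    proof (rule field_differentiable_bound[where f' = "\<lambda>z. F z - E z"])
      fix w assume w: "w \<in> closed_segment (complex_of_real R) (\<i> * of_real R)"
      note q = segment_quadrant[OF R' w]
      show "((\<lambda>z. Phi z - Psi z) has_field_derivative F w - E w) (at w within closed_segment (complex_of_real R) (\<i> * of_real R))"
        unfolding E_def by (rule has_field_derivative_at_within[OF DERIV_diff[OF Phi[OF q(4)] Psi[OF q(4)]]])
      have "norm (F w - E w) \<le> C / norm w ^ 2" using q R by (intro C) auto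
      also have "\<dots> \<le> C / (R / 2) ^ 2"
        using q R' C by (intro divide_left_mono power_mono mult_pos_pos zero_less_power) auto
      finally show "norm (F w - E w) \<le> C / (R / 2) ^ 2" .
    qed auto
    also have "\<dots> \<le> C / (R / 2) ^ 2 * (2 * R)"
      using norm_ii_chord[OF R'] C(1) by (intro mult_left_mono) auto
    finally show ?thesis .
  qed
  show ?thesis
  proof (rule Lim_null_comparison)
    show "\<forall>\<^sub>F R in at_top. norm ((LBINT x:{0<..R}. Re (cP (of_real x) ^ N * of_real x ^ (2 * i))) -
            (Re (Psi (of_real R)) - Re (Psi (\<i> * of_real R)))) \<le> C / (R / 2) ^ 2 * (2 * R)"
      using eventually_ge_at_top[of "2 * R0"]
    proof eventually_elim
      case (elim R)
      hence R: "R > 0" using C by linarith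
      have "(LBINT x:{0<..R}. Re (cP (of_real x) ^ N * of_real x ^ (2 * i))) = Re (Phi (of_real R)) - Re (Phi (\<i> * of_real R))"
        by (rule integral_eq_primitive[OF N Phi[unfolded F_def] R])
      hence "(LBINT x:{0<..R}. Re (cP (of_real x) ^ N * of_real x ^ (2 * i))) - (Re (Psi (of_real R)) - Re (Psi (\<i> * of_real R)))
         = - Re (?d R)"
        by simp
      also have "norm \<dots> \<le> norm (?d R)"
        using abs_Re_le_cmod by (simp del: minus_complex.simps)
      also note bound[OF elim]
      finally show ?case .
    qed
    show "((\<lambda>R. C / (R / 2) ^ 2 * (2 * R)) \<longlongrightarrow> 0) at_top" by real_asymp
  qed
qed

section \<open>Moments\<close>

lemma bessel_K0_eq_Re: "x > 0 \<Longrightarrow> bessel_K0 x = Re (cK (of_real x))"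
  using bessel_K0_eq_cK[of x] by (metis Re_complex_of_real)

lemma bessel_I0_eq_Re: "bessel_I0 x = Re (cI (of_real x))"
  using bessel_I0_eq_cI[of x] by (metis Re_complex_of_real)

lemma bessel_sys_continuous_on: "bessel_sys slit f f1 \<Longrightarrow> continuous_on {0<..} (\<lambda>x. Re (f (of_real x)))"
proof -
  assume f: "bessel_sys slit f f1"
  have "f holomorphic_on slit"
    using f by (intro holomorphic_on_open[THEN iffD2]) (auto simp: bessel_sys_def)
  hence "continuous_on slit f" by (rule holomorphic_on_imp_continuous_on)
  hence "continuous_on {0<..} (\<lambda>x. f (of_real x))"
    by (rule continuous_on_compose2) (use of_real_in_slit in \<open>auto intro!: continuous_intros\<close>)
  thus ?thesis by (rule continuous_on_Re)
qed

lemma continuous_on_bessel_I0: "continuous_on {0<..} bessel_I0"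
  using bessel_sys_continuous_on[OF cI_sys_slit] by (simp add: bessel_I0_eq_Re[symmetric])

lemma continuous_on_bessel_K0: "continuous_on {0<..} bessel_K0"
  using bessel_sys_continuous_on[OF cK_sys]
  by (rule continuous_on_eq) (simp add: bessel_K0_eq_Re)

lemma continuous_on_IKM_integrand: "continuous_on {0<..} (IKM_integrand k a b)"
  unfolding IKM_integrand_def[abs_def]
  by (intro continuous_intros continuous_on_bessel_I0 continuous_on_bessel_K0)

lemma bessel_I0_bound: "0 < x \<Longrightarrow> x \<le> 1 \<Longrightarrow> \<bar>bessel_I0 x\<bar> \<le> exp 1"
proof -
  assume x: "0 < x" "x \<le> 1"
  have "\<bar>bessel_I0 x\<bar> \<le> norm (cI (of_real x))" unfolding bessel_I0_eq_Re by (rule abs_Re_le_cmod)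
  also have "\<dots> \<le> exp (norm (complex_of_real x) ^ 2 / 4)" by (rule norm_cI_le_exp_square)
  also have "x ^ 2 \<le> 1" using x by (intro power_le_one) auto
  hence "exp (norm (complex_of_real x) ^ 2 / 4) \<le> exp 1" by simp
  finally show ?thesis .
qed

lemma IKM_integrand_near_0:
  "\<exists>C. \<forall>x. 0 < x \<longrightarrow> x \<le> 1 \<longrightarrow> \<bar>IKM_integrand k a b x\<bar> \<le> C * x powr (-1/2)"
proof -
  define m where "m = k - a"
  \<comment> \<open>Chosen so that \<open>m\<close> factors K0 together have an exponent
    \<open>m * d\<close> below 1/2; the 1 in the denominator covers m = 0.\<close>
  define d where "d = 1 / (2 * (real m + 1))"
  have d: "d > 0" by (simp add: d_def)
  obtain C where C: "C > 0" "\<And>z. z \<noteq> 0 \<Longrightarrow> norm z \<le> 1 \<Longrightarrow> norm (cK z) \<le> C * norm z powr (- d)"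
    using norm_cK_cH_near_0[OF d] by blast
  have "\<bar>IKM_integrand k a b x\<bar> \<le> exp 1 ^ a * C ^ m * x powr (-1/2)" if x: "0 < x" "x \<le> 1" for x
  proof -
    have "\<bar>bessel_K0 x\<bar> \<le> norm (cK (of_real x))"
      unfolding bessel_K0_eq_Re[OF x(1)] by (rule abs_Re_le_cmod)
    also have "\<dots> \<le> C * x powr (- d)" using C(2)[of "of_real x"] x by simp
    finally have "\<bar>bessel_K0 x\<bar> ^ m \<le> (C * x powr (- d)) ^ m" by (intro power_mono) auto
    also have "\<dots> = C ^ m * (x powr (- d)) ^ m" by (rule power_mult_distrib)
    also have "(x powr (- d)) ^ m = x powr (real m * - d)" using x by (subst powr_power) auto
    also have "x powr (real m * - d) \<le> x powr (-1/2)"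
      using x by (intro powr_mono') (auto simp: d_def field_simps)
    finally have K: "\<bar>bessel_K0 x\<bar> ^ m \<le> C ^ m * x powr (-1/2)" using C(1) by simp
    have I: "\<bar>bessel_I0 x\<bar> ^ a \<le> exp 1 ^ a" using bessel_I0_bound[OF x] by (intro power_mono) auto
    have X: "x ^ b \<le> 1" using x by (intro power_le_one) auto
    have "\<bar>IKM_integrand k a b x\<bar> = \<bar>bessel_I0 x\<bar> ^ a * \<bar>bessel_K0 x\<bar> ^ m * x ^ b"
      using x by (simp add: IKM_integrand_def m_def abs_mult power_abs)
    also have "\<dots> \<le> (exp 1 ^ a * (C ^ m * x powr (-1/2))) * 1"
      using I K X x C(1) by (intro mult_mono) auto
    finally show ?thesis by (simp add: mult_ac)
  qed
  thus ?thesis by blast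
qed

text \<open>On the positive axis pi I0 K0 is the imaginary part of \<open>cP\<close>, so the decay
  is read off from the leading term of its expansion.\<close>

lemma bessel_I0_K0_bigo: "(\<lambda>x. bessel_I0 x * bessel_K0 x) \<in> O[at_top](\<lambda>x. 1 / x)"
proof -
  have a: "(\<lambda>z. cP z - \<i> * of_real pi / 2 / z) \<in> O[at_sector 0](\<lambda>z. 1 / z ^ 2)"
    using cP_expansion[of 0 1] by simp
  then obtain C R where CR: "C > 0" "R \<ge> 1" "\<And>z. z \<in> sector 0 \<Longrightarrow> norm z \<ge> R \<Longrightarrow> norm (cP z - \<i> * of_real pi / 2 / z) \<le> C / norm z ^ 2"
    unfolding bigo_sector_iff by blast
  show ?thesis
  proof (rule landau_o.bigI[of "(C + pi / 2) / pi"])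
    show "(C + pi / 2) / pi > 0" using CR by (simp add: add_pos_pos)
    show "\<forall>\<^sub>F x in at_top. norm (bessel_I0 x * bessel_K0 x) \<le> (C + pi / 2) / pi * norm (1 / x)"
      using eventually_ge_at_top[of R]
    proof eventually_elim
      case (elim x)
      hence x: "x \<ge> 1" using CR by linarith
      have "pi * \<bar>bessel_I0 x * bessel_K0 x\<bar> = \<bar>Im (cP (of_real x))\<bar>"
        using x by (simp add: cP_of_real abs_mult del: of_real_mult)
      also have "\<dots> \<le> norm (cP (of_real x))" by (rule abs_Im_le_cmod)
      also have "\<dots> \<le> norm (cP (of_real x) - \<i> * of_real pi / 2 / of_real x) + norm (\<i> * of_real pi / 2 / complex_of_real x)"
        using norm_triangle_ineq[of "cP (of_real x) - \<i> * of_real pi / 2 / of_real x" "\<i> * of_real pi / 2 / of_real x"] by simp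
      also have "norm (cP (of_real x) - \<i> * of_real pi / 2 / of_real x) \<le> C / norm (complex_of_real x) ^ 2"
        using elim x by (intro CR of_real_in_sector) auto
      also have "C / norm (complex_of_real x) ^ 2 \<le> C / x"
        using x CR by (auto simp: power2_eq_square intro!: divide_left_mono)
      also have "norm (\<i> * of_real pi / 2 / complex_of_real x) = pi / 2 / x"
        using x by (simp add: norm_divide norm_mult)
      finally have "pi * \<bar>bessel_I0 x * bessel_K0 x\<bar> \<le> (C + pi / 2) / x"
        by (simp add: add_divide_distrib)
      thus ?case using x by (simp add: field_simps)
    qed
  qed
qed

lemma bessel_K0_bigo: "bessel_K0 \<in> O[at_top](\<lambda>x. exp (- x))"
proof -
  obtain C where C: "\<And>z. Re z \<ge> 1 \<Longrightarrow> norm (cK z) \<le> C * exp (- Re z)" using norm_cK_le by blast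
  show ?thesis
  proof (rule bigoI[of _ C])
    show "\<forall>\<^sub>F x in at_top. norm (bessel_K0 x) \<le> C * norm (exp (- x))"
      using eventually_ge_at_top[of 1]
    proof eventually_elim
      case (elim x)
      thus ?case using C[of "of_real x"] abs_Re_le_cmod[of "cK (of_real x)"] by (simp add: bessel_K0_eq_Re)
    qed
  qed
qed

lemma IKM_integrand_split:
  "2 * a \<le> k \<Longrightarrow> IKM_integrand k a b x = (bessel_I0 x * bessel_K0 x) ^ a * bessel_K0 x ^ (k - 2 * a) * x ^ b"
proof -
  assume "2 * a \<le> k"
  hence "k - a = a + (k - 2 * a)" by simp
  hence "bessel_K0 x ^ (k - a) = bessel_K0 x ^ a * bessel_K0 x ^ (k - 2 * a)"
    by (simp only: power_add)
  thus ?thesis by (simp only: IKM_integrand_def power_mult_distrib mult_ac)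
qed

lemma IKM_converges_bigo:
  assumes "IKM_integrand k a b \<in> O[at_top](\<lambda>x. 1 / x ^ 2)"
  shows "IKM_converges k a b"
  using IKM_integrand_near_0[of k a b] set_integrable_Ioi[OF continuous_on_IKM_integrand _ assms]
  unfolding IKM_converges_def by blast

text \<open>After each I0 is paired with a K0, at least one K0 is left, and its exponential decay
  beats every power.\<close>

lemma IKM_converges_exponential:
  assumes "2 * a < k"
  shows "IKM_converges k a b"
proof (rule IKM_converges_bigo)
  obtain m where m: "k - 2 * a = Suc m" using assms by (cases "k - 2 * a") auto
  have IK: "(\<lambda>x. bessel_I0 x * bessel_K0 x) \<in> O[at_top](\<lambda>x. 1)"
    by (rule landau_o.big_trans[OF bessel_I0_K0_bigo]) real_asymp
  have K: "bessel_K0 \<in> O[at_top](\<lambda>x. 1)"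
    by (rule landau_o.big_trans[OF bessel_K0_bigo]) real_asymp
  have "(\<lambda>x. (bessel_I0 x * bessel_K0 x) ^ a * (bessel_K0 x ^ m * bessel_K0 x) * x ^ b) \<in> O[at_top](\<lambda>x. 1 ^ a * (1 ^ m * exp (- x)) * x ^ b)"
    by (intro landau_o.big.mult landau_o.big_power IK K bessel_K0_bigo) simp
  also have "(\<lambda>x::real. 1 ^ a * (1 ^ m * exp (- x)) * x ^ b) \<in> O[at_top](\<lambda>x. 1 / x ^ 2)"
    by simp real_asymp
  also have "(\<lambda>x. (bessel_I0 x * bessel_K0 x) ^ a * (bessel_K0 x ^ m * bessel_K0 x) * x ^ b) = IKM_integrand k a b"
    by (intro ext) (simp only: IKM_integrand_split[OF less_imp_le[OF assms]] m power_Suc2)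
  finally show "IKM_integrand k a b \<in> O[at_top](\<lambda>x. 1 / x ^ 2)" .
qed

text \<open>With equally many I0 and K0 the exponentials cancel and the integrand has size x^(b-a),
  with b - a at most -2.\<close>

lemma IKM_converges_critical:
  assumes "b + 2 \<le> a"
  shows "IKM_converges (2 * a) a b"
proof (rule IKM_converges_bigo)
  have "(\<lambda>x. (bessel_I0 x * bessel_K0 x) ^ a * x ^ b) \<in> O[at_top](\<lambda>x. (1 / x) ^ a * x ^ b)"
    by (intro landau_o.big.mult landau_o.big_power bessel_I0_K0_bigo) simp
  also have "(\<lambda>x::real. (1 / x) ^ a * x ^ b) \<in> O[at_top](\<lambda>x. 1 / x ^ 2)"
  proof (rule bigoI[of _ 1])
    show "\<forall>\<^sub>F x in at_top. norm ((1 / x) ^ a * x ^ b) \<le> 1 * norm (1 / x ^ 2 :: real)"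
      using eventually_ge_at_top[of 1]
    proof eventually_elim
      case (elim x)
      have "x ^ (b + 2) \<le> x ^ a" using assms elim by (intro power_increasing) auto
      thus ?case using elim by (simp add: power_add field_simps power2_eq_square)
    qed
  qed
  also have "(\<lambda>x. (bessel_I0 x * bessel_K0 x) ^ a * x ^ b) = IKM_integrand (2 * a) a b"
    by (intro ext) (simp add: IKM_integrand_split)
  finally show "IKM_integrand (2 * a) a b \<in> O[at_top](\<lambda>x. 1 / x ^ 2)" .
qed

lemma IKM_integrand_integrable_Ioc: "set_integrable lborel {0<..R} (IKM_integrand k a b)"
  using IKM_integrand_near_0[of k a b] set_integrable_near_0[OF continuous_on_IKM_integrand] by blast

section \<open>The real part of the power as a combination of moment integrands\<close>

lemma Re_power_binomial:
  "Re ((of_real x + \<i> * of_real y) ^ N) = (\<Sum>j = 0..N div 2. real (N choose (2 * j)) * (- 1) ^ j * y ^ (2 * j) * x ^ (N - 2 * j))"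
proof -
  let ?t = "\<lambda>a. of_nat (N choose a) * (\<i> * of_real y) ^ a * of_real x ^ (N - a) :: complex"
  have pow: "(\<i> * complex_of_real y) ^ (2 * j) = of_real ((- 1) ^ j * y ^ (2 * j))" for j
    by (simp add: power_mult power_mult_distrib) (rule power_minus)
  have even: "Re (?t (2 * j))
     = real (N choose (2 * j)) * (- 1) ^ j * y ^ (2 * j) * x ^ (N - 2 * j)" for j
  proof -
    have "?t (2 * j)
       = complex_of_real (real (N choose (2 * j)) * ((- 1) ^ j * y ^ (2 * j)) * x ^ (N - 2 * j))"
      unfolding pow by simp
    thus ?thesis by (simp only: Re_complex_of_real mult.assoc)
  qed
  have odd: "Re (?t a) = 0" if a_odd: "odd a" for a
  proof -
    obtain j where a: "a = 2 * j + 1" using a_odd by (rule oddE)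
    have "?t a
       = \<i> * complex_of_real (real (N choose a) * ((- 1) ^ j * y ^ (2 * j)) * y * x ^ (N - a))"
      unfolding a power_add pow by simp
    thus ?thesis by (simp only: Re_i_times Im_complex_of_real minus_zero)
  qed
  have "(of_real x + \<i> * of_real y) ^ N = (\<Sum>a\<le>N. ?t a)"
    by (subst add.commute) (rule binomial_ring)
  hence "Re ((of_real x + \<i> * of_real y) ^ N) = (\<Sum>a\<le>N. Re (?t a))"
    by (simp only: Re_sum)
  also have "\<dots> = (\<Sum>a\<in>(\<lambda>j. 2 * j) ` {0..N div 2}. Re (?t a))"
  proof (rule sum.mono_neutral_right)
    show "\<forall>a\<in>{..N} - (\<lambda>j. 2 * j) ` {0..N div 2}. Re (?t a) = 0"
    proof
      fix a assume a: "a \<in> {..N} - (\<lambda>j. 2 * j) ` {0..N div 2}"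
      have "odd a"
      proof
        assume "even a"
        then obtain j where "a = 2 * j" by (rule evenE)
        with a show False by auto
      qed
      thus "Re (?t a) = 0" by (rule odd)
    qed
  qed auto
  also have "\<dots> = (\<Sum>j = 0..N div 2. Re (?t (2 * j)))"
    by (subst sum.reindex) (auto simp: inj_on_def)
  finally show ?thesis unfolding even .
qed

lemma Re_cP_power:
  assumes x: "x > 0"
  shows "Re (cP (of_real x) ^ N * of_real x ^ (2 * i)) =
    (\<Sum>j = 0..N div 2. real (N choose (2 * j)) * (- 1) ^ j * pi ^ (2 * j) * IKM_integrand (2 * N) (2 * j) (2 * i) x)"
proof -
  have "cP (of_real x) = of_real (bessel_K0 x) * (of_real (bessel_K0 x) + \<i> * of_real (pi * bessel_I0 x))"
    using x by (simp add: cP_def cH_def bessel_K0_eq_cK[symmetric] bessel_I0_eq_cI[symmetric])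
  hence "cP (of_real x) ^ N * of_real x ^ (2 * i)
     = of_real (bessel_K0 x ^ N * x ^ (2 * i)) * (of_real (bessel_K0 x) + \<i> * of_real (pi * bessel_I0 x)) ^ N"
    by (simp add: power_mult_distrib mult_ac)
  hence "Re (cP (of_real x) ^ N * of_real x ^ (2 * i))
     = (bessel_K0 x ^ N * x ^ (2 * i)) * Re ((of_real (bessel_K0 x) + \<i> * of_real (pi * bessel_I0 x)) ^ N)"
    by (simp only: Re_complex_of_real Im_complex_of_real times_complex.simps mult_zero_left diff_zero)
  also have "\<dots> = (\<Sum>j = 0..N div 2. real (N choose (2 * j)) * (- 1) ^ j * pi ^ (2 * j) * IKM_integrand (2 * N) (2 * j) (2 * i) x)"
    unfolding Re_power_binomial sum_distrib_left
  proof (rule sum.cong)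
    fix j assume "j \<in> {0..N div 2}"
    hence "2 * N - 2 * j = N + (N - 2 * j)" by auto
    thus "bessel_K0 x ^ N * x ^ (2 * i) * (real (N choose (2 * j)) * (- 1) ^ j * (pi * bessel_I0 x) ^ (2 * j) * bessel_K0 x ^ (N - 2 * j))
       = real (N choose (2 * j)) * (- 1) ^ j * pi ^ (2 * j) * IKM_integrand (2 * N) (2 * j) (2 * i) x"
      by (simp add: IKM_integrand_def power_mult_distrib power_add mult_ac)
  qed auto
  finally show ?thesis .
qed

lemma integral_Re_cP_power:
  "(LBINT x:{0<..R}. Re (cP (of_real x) ^ N * of_real x ^ (2 * i))) =
    (\<Sum>j = 0..N div 2. real (N choose (2 * j)) * (- 1) ^ j * pi ^ (2 * j) * (LBINT x:{0<..R}. IKM_integrand (2 * N) (2 * j) (2 * i) x))"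
proof -
  have "(LBINT x:{0<..R}. Re (cP (of_real x) ^ N * of_real x ^ (2 * i))) =
     (LBINT x:{0<..R}. (\<Sum>j = 0..N div 2. real (N choose (2 * j)) * (- 1) ^ j * pi ^ (2 * j) * IKM_integrand (2 * N) (2 * j) (2 * i) x))"
    by (rule set_lebesgue_integral_cong, simp, intro allI impI, rule Re_cP_power) simp
  also have "\<dots> = (\<Sum>j = 0..N div 2. (LBINT x:{0<..R}. real (N choose (2 * j)) * (- 1) ^ j * pi ^ (2 * j) * IKM_integrand (2 * N) (2 * j) (2 * i) x))"
    using IKM_integrand_integrable_Ioc unfolding set_lebesgue_integral_def set_integrable_def
    by (simp add: sum_distrib_left mult.left_commute[of "indicator _ _"])
  also have "\<dots> = (\<Sum>j = 0..N div 2. real (N choose (2 * j)) * (- 1) ^ j * pi ^ (2 * j) * (LBINT x:{0<..R}. IKM_integrand (2 * N) (2 * j) (2 * i) x))"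
    by (simp only: set_integral_mult_right)
  finally show ?thesis .
qed

lemma IKM_limit:
  "IKM_converges k a b \<Longrightarrow> ((\<lambda>R. LBINT x:{0<..R}. IKM_integrand k a b x) \<longlongrightarrow> IKM k a b) at_top"
  unfolding IKM_converges_def IKM_def by (rule tendsto_set_integral_Ioc)

section \<open>Contributions of the end points R and \<i> R\<close>

lemma i_pi_half_power_even: "(\<i> * complex_of_real pi / 2) ^ (2 * m) = of_real ((- 1) ^ m * (pi / 2) ^ (2 * m))"
proof -
  have "(\<i> * complex_of_real pi / 2) ^ 2 = of_real (- 1 * (pi / 2) ^ 2)"
    by (simp add: power_mult_distrib power_divide)
  thus ?thesis
    unfolding power_mult by (simp only: of_real_power[symmetric] power_mult_distrib)
qed

lemma i_pi_half_power_odd: "(\<i> * complex_of_real pi / 2) ^ (2 * m + 1) = \<i> * of_real ((- 1) ^ m * (pi / 2) ^ (2 * m + 1))"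
  unfolding power_add i_pi_half_power_even by simp

lemma i_times_power_even: "(\<i> * complex_of_real R) ^ (2 * q) = of_real ((- 1) ^ q * R ^ (2 * q))"
proof -
  have "(\<i> * complex_of_real R) ^ 2 = of_real (- 1 * R ^ 2)"
    by (simp add: power_mult_distrib)
  thus ?thesis
    unfolding power_mult by (simp only: of_real_power[symmetric] power_mult_distrib)
qed

lemma i_times_power_odd: "(\<i> * complex_of_real R) ^ (2 * q + 1) = \<i> * of_real ((- 1) ^ q * R ^ (2 * q + 1))"
  unfolding power_add i_times_power_even by simp

lemma complex_power_derivative:
  "((\<lambda>z. z ^ n) has_field_derivative of_nat n * z ^ (n - 1)) (at (z :: complex))"
  by (auto intro!: derivative_eq_intros)

text \<open>The constant in front is real and the primitive has odd powers only. At \<i> R these are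
  purely imaginary, so the real part comes from R alone.\<close>

lemma integral_asymp_even:
  fixes r i :: nat
  shows "((\<lambda>R. (LBINT x:{0<..R}. Re (cP (of_real x) ^ (2 * r + 2) * of_real x ^ (2 * i))) -
            (- 1) ^ (r + 1) * (pi / 2) ^ (2 * r + 2) *
            (\<Sum>n<i - r. of_rat (IK_coeff (4 * r + 4) n) * 4 ^ n * R ^ (2 * (i - r - 1 - n) + 1) / real (2 * (i - r - 1 - n) + 1)))
          \<longlongrightarrow> 0) at_top"
proof -
  \<comment> \<open>\<open>2 * q n\<close> is the exponent of the n-th term for
    \<open>n < i - r\<close>. For \<open>i \<ge> r\<close> the first omitted exponent is -2; no
    exponent equals -1, so no logarithm occurs. For \<open>i \<le> r\<close> the sum is
    empty.\<close>
  define q where "q = (\<lambda>n. i - r - 1 - n)"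
  define c where "c = (\<lambda>n. of_rat (IK_coeff (4 * r + 4) n) * 4 ^ n :: real)"
  define k where "k = (- 1) ^ (r + 1) * (pi / 2) ^ (2 * r + 2)"
  define Psi where "Psi = (\<lambda>z::complex. of_real k * (\<Sum>n<i - r. of_real (c n) * z ^ (2 * q n + 1) / of_nat (2 * q n + 1)))"
  have c: "complex_of_real (c n) = (IK_fps ^ (2 * r + 2)) $ n * 4 ^ n" for n
    using IK_coeff_eq[of "4 * r + 4" n] by (simp add: c_def)
  have k: "(\<i> * complex_of_real pi / 2) ^ (2 * r + 2) = of_real k"
    using i_pi_half_power_even[of "r + 1"] by (simp add: k_def)
  have "((\<lambda>R. (LBINT x:{0<..R}. Re (cP (of_real x) ^ (2 * r + 2) * of_real x ^ (2 * i))) -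
          (Re (Psi (of_real R)) - Re (Psi (\<i> * of_real R)))) \<longlongrightarrow> 0) at_top"
  proof (rule integral_asymp[where M = "i - r"])
    fix z assume "z \<in> slit"
    have pw: "z powi (2 * int i - int (2 * r + 2) - 2 * int n) = z ^ (2 * q n)" if "n < i - r" for n
    proof -
      have "2 * int i - int (2 * r + 2) - 2 * int n = int (2 * q n)" using that by (simp add: q_def)
      thus ?thesis by (simp only: power_int_of_nat)
    qed
    have "(Psi has_field_derivative of_real k * (\<Sum>n<i - r. of_real (c n) * z ^ (2 * q n))) (at z)"
      unfolding Psi_def
    proof (intro DERIV_cmult DERIV_sum)
      fix n
      have "((\<lambda>z. of_real (c n) * z ^ (2 * q n + 1) / of_nat (2 * q n + 1)) has_field_derivative
         of_real (c n) * (of_nat (2 * q n + 1) * z ^ (2 * q n + 1 - 1)) / of_nat (2 * q n + 1)) (at z)"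
        by (intro DERIV_cdivide DERIV_cmult complex_power_derivative)
      also have "of_real (c n) * (of_nat (2 * q n + 1) * z ^ (2 * q n + 1 - 1)) / of_nat (2 * q n + 1) = of_real (c n) * z ^ (2 * q n)"
        using of_nat_neq_0[of "2 * q n", where ?'a = complex] by (simp del: of_nat_Suc)
      finally show "((\<lambda>z. of_real (c n) * z ^ (2 * q n + 1) / of_nat (2 * q n + 1)) has_field_derivative of_real (c n) * z ^ (2 * q n)) (at z)" .
    qed
    also have "(\<Sum>n<i - r. of_real (c n) * z ^ (2 * q n)) =
        (\<Sum>n<i - r. (IK_fps ^ (2 * r + 2)) $ n * 4 ^ n * z powi (2 * int i - int (2 * r + 2) - 2 * int n))"
      by (intro sum.cong refl) (simp only: pw lessThan_iff c)
    finally show "(Psi has_field_derivative (\<i> * of_real pi / 2) ^ (2 * r + 2) *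
        (\<Sum>n<i - r. (IK_fps ^ (2 * r + 2)) $ n * 4 ^ n * z powi (2 * int i - int (2 * r + 2) - 2 * int n))) (at z)"
      unfolding k .
  qed auto
  moreover have "Re (Psi (of_real R)) - Re (Psi (\<i> * of_real R)) =
      k * (\<Sum>n<i - r. c n * R ^ (2 * q n + 1) / real (2 * q n + 1))" for R
  proof -
    have "of_real (c n) * of_real R ^ (2 * q n + 1) / of_nat (2 * q n + 1) = complex_of_real (c n * R ^ (2 * q n + 1) / real (2 * q n + 1))" for n
      by simp
    hence "Psi (of_real R) = of_real (k * (\<Sum>n<i - r. c n * R ^ (2 * q n + 1) / real (2 * q n + 1)))"
      unfolding Psi_def by simp
    moreover have "of_real (c n) * (\<i> * of_real R) ^ (2 * q n + 1) / of_nat (2 * q n + 1)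
        = \<i> * complex_of_real (c n * ((- 1) ^ q n * R ^ (2 * q n + 1)) / real (2 * q n + 1))" for n
      unfolding i_times_power_odd by simp
    hence "Psi (\<i> * of_real R) = \<i> * of_real (k * (\<Sum>n<i - r. c n * ((- 1) ^ q n * R ^ (2 * q n + 1)) / real (2 * q n + 1)))"
      unfolding Psi_def sum_distrib_left[symmetric] by (simp only: of_real_mult of_real_sum sum_distrib_left mult.left_commute)
    ultimately show ?thesis by (simp only: Re_complex_of_real Re_i_times Im_complex_of_real)
  qed
  ultimately show ?thesis by (simp add: k_def c_def q_def)
qed

text \<open>The constant in front is purely imaginary and the powers in the primitive are even,
  hence real at both R and \<i> R: they contribute nothing. Only the logarithm does, through the
  argument pi/2 of \<i> R, which also raises the power of pi/2 by one.\<close>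

lemma integral_asymp_odd:
  fixes r i :: nat
  shows "((\<lambda>R. LBINT x:{0<..R}. Re (cP (of_real x) ^ (2 * r + 1) * of_real x ^ (2 * i)))
          \<longlongrightarrow> (if i < r then 0 else (- 1) ^ r * (pi / 2) ^ (2 * r + 2) * of_rat (IK_coeff (4 * r + 2) (i - r)) * 4 ^ (i - r))) at_top"
proof -
  define c where "c = (\<lambda>n. of_rat (IK_coeff (4 * r + 2) n) * 4 ^ n :: real)"
  define k where "k = (- 1) ^ r * (pi / 2) ^ (2 * r + 1)"
  define l where "l = (if i < r then 0 else c (i - r))"
  define Psi where "Psi = (\<lambda>z. \<i> * of_real k * ((\<Sum>n<i - r. of_real (c n) * z ^ (2 * (i - r - n)) / of_nat (2 * (i - r - n))) + of_real l * Ln z))"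
  have c: "complex_of_real (c n) = (IK_fps ^ (2 * r + 1)) $ n * 4 ^ n" for n
    using IK_coeff_eq[of "4 * r + 2" n] by (simp add: c_def)
  have k: "(\<i> * complex_of_real pi / 2) ^ (2 * r + 1) = \<i> * of_real k"
    using i_pi_half_power_odd[of r] by (simp add: k_def)
  \<comment> \<open>For \<open>i \<ge> r\<close> the last term kept is the one in 1/z, with index
    \<open>i - r\<close>. For \<open>i < r\<close> the subtraction is truncated and the sum is
    empty.\<close>
  define M where "M = Suc i - r"
  have "((\<lambda>R. (LBINT x:{0<..R}. Re (cP (of_real x) ^ (2 * r + 1) * of_real x ^ (2 * i))) -
          (Re (Psi (of_real R)) - Re (Psi (\<i> * of_real R)))) \<longlongrightarrow> 0) at_top"
  proof (rule integral_asymp[where M = M])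
    fix z assume z: "z \<in> slit"
    hence nz: "z \<noteq> 0" by auto
    have pw: "z powi (2 * int i - int (2 * r + 1) - 2 * int n) = z ^ (2 * (i - r - n) - 1)" if "n < i - r" for n
    proof -
      have "2 * int i - int (2 * r + 1) - 2 * int n = int (2 * (i - r - n) - 1)" using that by simp
      thus ?thesis by (simp only: power_int_of_nat)
    qed
    have "(Psi has_field_derivative \<i> * of_real k * ((\<Sum>n<i - r. of_real (c n) * z ^ (2 * (i - r - n) - 1)) + of_real l * (1 / z))) (at z)"
      unfolding Psi_def
    proof (intro DERIV_cmult DERIV_add DERIV_sum)
      show "(Ln has_field_derivative 1 / z) (at z)"
        using z by (auto intro!: derivative_eq_intros simp: field_simps)
      fix n assume "n \<in> {..<i - r}"
      hence pos: "2 * (i - r - n) \<noteq> 0" by simp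
      have "((\<lambda>z. of_real (c n) * z ^ (2 * (i - r - n)) / of_nat (2 * (i - r - n))) has_field_derivative
         of_real (c n) * (of_nat (2 * (i - r - n)) * z ^ (2 * (i - r - n) - 1)) / of_nat (2 * (i - r - n))) (at z)"
        by (intro DERIV_cdivide DERIV_cmult complex_power_derivative)
      also have "of_real (c n) * (of_nat (2 * (i - r - n)) * z ^ (2 * (i - r - n) - 1)) / of_nat (2 * (i - r - n)) = of_real (c n) * z ^ (2 * (i - r - n) - 1)"
        using pos by (simp del: of_nat_mult mult_eq_0_iff)
      finally show "((\<lambda>z. of_real (c n) * z ^ (2 * (i - r - n)) / of_nat (2 * (i - r - n))) has_field_derivative of_real (c n) * z ^ (2 * (i - r - n) - 1)) (at z)" .
    qed
    also have "(\<Sum>n<i - r. of_real (c n) * z ^ (2 * (i - r - n) - 1)) + of_real l * (1 / z) =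
        (\<Sum>n<M. (IK_fps ^ (2 * r + 1)) $ n * 4 ^ n * z powi (2 * int i - int (2 * r + 1) - 2 * int n))"
    proof (cases "i < r")
      case True
      thus ?thesis by (simp add: l_def M_def)
    next
      case False
      hence M: "M = Suc (i - r)" by (simp add: M_def)
      have "2 * int i - int (2 * r + 1) - 2 * int (i - r) = - 1" using False by simp
      hence e: "z powi (2 * int i - int (2 * r + 1) - 2 * int (i - r)) = 1 / z"
        by (simp only: power_int_minus power_int_1_right inverse_eq_divide)
      have s: "(\<Sum>n<i - r. of_real (c n) * z ^ (2 * (i - r - n) - 1)) =
        (\<Sum>n<i - r. (IK_fps ^ (2 * r + 1)) $ n * 4 ^ n * z powi (2 * int i - int (2 * r + 1) - 2 * int n))"
        by (intro sum.cong refl) (simp only: pw lessThan_iff c)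
      show ?thesis unfolding M sum.lessThan_Suc s e using False by (simp add: l_def c)
    qed
    finally show "(Psi has_field_derivative (\<i> * of_real pi / 2) ^ (2 * r + 1) *
        (\<Sum>n<M. (IK_fps ^ (2 * r + 1)) $ n * 4 ^ n * z powi (2 * int i - int (2 * r + 1) - 2 * int n))) (at z)"
      unfolding k .
  qed (auto simp: M_def)
  moreover have "\<forall>\<^sub>F R in at_top. Re (Psi (of_real R)) - Re (Psi (\<i> * of_real R)) = k * l * (pi / 2)"
    using eventually_gt_at_top[of 0]
  proof eventually_elim
    case (elim R)
    have "of_real (c n) * of_real R ^ (2 * m) / of_nat (2 * m) = complex_of_real (c n * R ^ (2 * m) / real (2 * m))" for n m
      by simp
    hence "(\<Sum>n<i - r. of_real (c n) * of_real R ^ (2 * (i - r - n)) / of_nat (2 * (i - r - n)))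
       = complex_of_real (\<Sum>n<i - r. c n * R ^ (2 * (i - r - n)) / real (2 * (i - r - n)))"
      by (simp only: of_real_sum)
    hence 1: "Psi (of_real R) = \<i> * of_real (k * ((\<Sum>n<i - r. c n * R ^ (2 * (i - r - n)) / real (2 * (i - r - n))) + l * ln R))"
      unfolding Psi_def using elim by (simp only: Ln_of_real of_real_mult of_real_add mult.assoc)
    have "of_real (c n) * (\<i> * of_real R) ^ (2 * m) / of_nat (2 * m) = complex_of_real (c n * ((- 1) ^ m * R ^ (2 * m)) / real (2 * m))" for n m
      unfolding i_times_power_even by simp
    hence s: "(\<Sum>n<i - r. of_real (c n) * (\<i> * of_real R) ^ (2 * (i - r - n)) / of_nat (2 * (i - r - n)))
       = complex_of_real (\<Sum>n<i - r. c n * ((- 1) ^ (i - r - n) * R ^ (2 * (i - r - n))) / real (2 * (i - r - n)))"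
      (is "_ = complex_of_real ?S") by (simp only: of_real_sum)
    have Ln: "Ln (\<i> * of_real R) = of_real (ln R) + \<i> * of_real (pi / 2)"
      using Ln_times_ii[of "of_real R"] elim by (simp add: Ln_of_real)
    have 2: "Psi (\<i> * of_real R) = \<i> * of_real (k * (?S + l * ln R)) - of_real (k * l * (pi / 2))"
      unfolding Psi_def s Ln by (simp add: algebra_simps)
    show ?case unfolding 1 2 by (simp only: Re_i_times Im_complex_of_real minus_complex.simps Re_complex_of_real)
  qed
  ultimately have "((\<lambda>R. (LBINT x:{0<..R}. Re (cP (of_real x) ^ (2 * r + 1) * of_real x ^ (2 * i))) - k * l * (pi / 2)) \<longlongrightarrow> 0) at_top"
    by (elim Lim_transform_eventually) (auto elim: eventually_mono)
  hence "((\<lambda>R. LBINT x:{0<..R}. Re (cP (of_real x) ^ (2 * r + 1) * of_real x ^ (2 * i))) \<longlongrightarrow> k * l * (pi / 2)) at_top"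
    by (rule LIM_zero_cancel)
  also have "k * l * (pi / 2) = (if i < r then 0 else (- 1) ^ r * (pi / 2) ^ (2 * r + 2) * of_rat (IK_coeff (4 * r + 2) (i - r)) * 4 ^ (i - r))"
    by (simp add: k_def l_def c_def)
  finally show ?thesis .
qed

text \<open>All terms with \<open>j \<le> r\<close> converge. The term j = r + 1 has binomial
  coefficient 1 and sign opposite to \<open>h\<close>; the asymptotics of the whole sum therefore
  show that its truncated integral minus the counterterms converges, and give the limit at the same
  time.\<close>

lemma IKM_relations_even:
  fixes r k i :: nat
  assumes k: "k = 4 * r + 4"
  shows "(\<forall>j \<le> r. IKM_converges k (2 * j) (2 * i)) \<and>
        (if i \<le> r then IKM_converges k (2 * r + 2) (2 * i) else IKM_reg_converges r i) \<and>
        (\<Sum>j = 0..r. real (k div 2 choose (2 * j)) * (- 1) ^ j * pi ^ (2 * j) * IKM k (2 * j) (2 * i))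
        = (if i \<le> r
           then (- 1) ^ r * pi ^ (2 * r + 2) * IKM k (2 * r + 2) (2 * i)
           else (- 1) ^ r * pi ^ (2 * r + 2) * IKM_reg r i)"
proof -
  define w where "w = (\<lambda>n j. real (n choose (2 * j)) * (- 1) ^ j * pi ^ (2 * j))"
  have conv: "IKM_converges k (2 * j) (2 * i)" if "j \<le> r" for j
    by (rule IKM_converges_exponential) (use that k in simp)
  define S where "S = (\<Sum>j = 0..r. w (k div 2) j * IKM k (2 * j) (2 * i))"
  define J where "J = (\<lambda>R. LBINT x:{0<..R}. IKM_integrand k (2 * r + 2) (2 * i) x)"
  define D where "D = (\<lambda>R::real. \<Sum>n<i - r. of_rat (IK_coeff (4 * r + 4) n) * 4 ^ n * R ^ (2 * (i - r - 1 - n) + 1) / real (2 * (i - r - 1 - n) + 1))"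
  define h where "h = (- 1) ^ r * pi ^ (2 * r + 2)"
  have h0: "h \<noteq> 0" by (simp add: h_def)
  let ?T = "\<lambda>R. \<Sum>j = 0..r. w (k div 2) j * (LBINT x:{0<..R}. IKM_integrand k (2 * j) (2 * i) x)"
  have int_eq: "(LBINT x:{0<..R}. Re (cP (of_real x) ^ (2 * r + 2) * of_real x ^ (2 * i))) =
      (?T R) - h * J R" for R
  proof -
    have eqs: "(2 * r + 2) div 2 = Suc r" "2 * (2 * r + 2) = k" "k div 2 = 2 * r + 2" "2 * Suc r = 2 * r + 2"
      using k by auto
    show ?thesis
      unfolding integral_Re_cP_power eqs(1) sum.atLeast0_atMost_Suc
      unfolding eqs(2-) w_def by (simp add: h_def J_def)
  qed
  have "((\<lambda>R. (?T R) -
      ((?T R) - h * J R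
         - (- 1) ^ (r + 1) * (pi / 2) ^ (2 * r + 2) * D R)) \<longlongrightarrow> S - 0) at_top"
    unfolding S_def
  proof (intro tendsto_diff tendsto_sum tendsto_mult tendsto_const IKM_limit conv)
    show "((\<lambda>R. (?T R) - h * J R
         - (- 1) ^ (r + 1) * (pi / 2) ^ (2 * r + 2) * D R) \<longlongrightarrow> 0) at_top"
      using integral_asymp_even[of r i] unfolding int_eq D_def .
  qed auto
  \<comment> \<open>The power of pi goes into \<open>h\<close>; the denominator becomes part of the
    power of 2 in the counterterms.\<close>
  moreover have "(- 1) ^ (r + 1) * (pi / 2) ^ (2 * r + 2) * D R = - h * (D R / 2 ^ (2 * r + 2))" for R
    by (simp add: h_def power_divide)
  ultimately have "((\<lambda>R. (1 / h) * (h * (J R - D R / 2 ^ (2 * r + 2)))) \<longlongrightarrow> (1 / h) * S) at_top"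
    by (intro tendsto_mult tendsto_const) (simp add: algebra_simps)
  hence lim: "((\<lambda>R. J R - D R / 2 ^ (2 * r + 2)) \<longlongrightarrow> S / h) at_top"
    using h0 by simp
  have conv': "\<forall>j \<le> r. IKM_converges k (2 * j) (2 * i)" using conv by blast
  show ?thesis
  proof (cases "i \<le> r")
    case True
    have c: "IKM_converges k (2 * r + 2) (2 * i)"
    proof -
      have "2 * (2 * r + 2) = k" using k by simp
      thus ?thesis using IKM_converges_critical[of "2 * i" "2 * r + 2"] True by (simp only:)
    qed
    \<comment> \<open>Here \<open>D\<close> is the empty sum: there are no counterterms.\<close>
    have "(J \<longlongrightarrow> S / h) at_top" using lim True by (simp add: D_def)
    moreover have "(J \<longlongrightarrow> IKM k (2 * r + 2) (2 * i)) at_top"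
      unfolding J_def by (rule IKM_limit[OF c])
    ultimately have "S / h = IKM k (2 * r + 2) (2 * i)"
      by (rule tendsto_unique[OF trivial_limit_at_top_linorder])
    hence "S = h * IKM k (2 * r + 2) (2 * i)" using h0 by (simp add: field_simps)
    thus ?thesis using True c conv' by (simp add: S_def h_def w_def)
  next
    case False
    have integrand: "IKM_integrand k (2 * r + 2) (2 * i) = (\<lambda>s. (bessel_I0 s * bessel_K0 s) ^ (2 * r + 2) * s ^ (2 * i))"
    proof
      fix s
      have "2 * (2 * r + 2) \<le> k" "k - 2 * (2 * r + 2) = 0" using k by auto
      thus "IKM_integrand k (2 * r + 2) (2 * i) s = (bessel_I0 s * bessel_K0 s) ^ (2 * r + 2) * s ^ (2 * i)"
        by (simp only: IKM_integrand_split power_0 mult_1_right)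
    qed
    let ?\<gamma> = "\<lambda>m. real_of_rat (IK_coeff (4 * r + 4) (i - r - 1 - m))"
    \<comment> \<open>The regularized moment is indexed by the power of \<open>t\<close>,
      \<open>D\<close> by the index of the coefficient: n = i - r - 1 - m. The powers of 2 agree
      because 2n - (2r + 2) = - (k - 2i + 2m).\<close>
    have D: "(\<Sum>m = 0..i - r - 1. ?\<gamma> m * t ^ (2 * m + 1)
        / (2 powi (int (4 * r + 4) - 2 * int i + 2 * int m) * real (2 * m + 1))) = D t / 2 ^ (2 * r + 2)" for t :: real
    proof -
      have bij: "bij_betw (\<lambda>m. i - r - 1 - m) {0..i - r - 1} {..<i - r}"
        by (rule bij_betwI[of _ _ _ "\<lambda>m. i - r - 1 - m"]) (use False in auto)
      have "D t / 2 ^ (2 * r + 2) = (\<Sum>m = 0..i - r - 1. ?\<gamma> m * 4 ^ (i - r - 1 - m) * t ^ (2 * (i - r - 1 - (i - r - 1 - m)) + 1) / real (2 * (i - r - 1 - (i - r - 1 - m)) + 1) / 2 ^ (2 * r + 2))"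
        unfolding D_def sum_divide_distrib by (rule sum.reindex_bij_betw[OF bij, symmetric])
      also have "\<dots> = (\<Sum>m = 0..i - r - 1. ?\<gamma> m * t ^ (2 * m + 1)
        / (2 powi (int (4 * r + 4) - 2 * int i + 2 * int m) * real (2 * m + 1)))"
      proof (rule sum.cong)
        fix m assume m: "m \<in> {0..i - r - 1}"
        have e1: "i - r - 1 - (i - r - 1 - m) = m" using m by auto
        have e: "int (4 * r + 4) - 2 * int i + 2 * int m = int (2 * r + 2) - int (2 * (i - r - 1 - m))"
          using m False by auto
        have "(2::real) powi (int (4 * r + 4) - 2 * int i + 2 * int m) = 2 ^ (2 * r + 2) / 2 ^ (2 * (i - r - 1 - m))"
          unfolding e power_int_diff[OF disjI1[OF zero_neq_numeral[symmetric]]] power_int_of_nat ..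
        moreover have "(2::real) ^ (2 * (i - r - 1 - m)) = 4 ^ (i - r - 1 - m)" by (simp add: power_mult)
        ultimately have e2: "(2::real) powi (int (4 * r + 4) - 2 * int i + 2 * int m) = 2 ^ (2 * r + 2) / 4 ^ (i - r - 1 - m)" by simp
        show "?\<gamma> m * 4 ^ (i - r - 1 - m) * t ^ (2 * (i - r - 1 - (i - r - 1 - m)) + 1) / real (2 * (i - r - 1 - (i - r - 1 - m)) + 1) / 2 ^ (2 * r + 2)
           = ?\<gamma> m * t ^ (2 * m + 1) / (2 powi (int (4 * r + 4) - 2 * int i + 2 * int m) * real (2 * m + 1))"
          unfolding e1 e2 by (simp add: divide_simps)
      qed simp
      finally show ?thesis ..
    qed
    have "IKM_reg_truncated r i = (\<lambda>R. J R - D R / 2 ^ (2 * r + 2))"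
      unfolding IKM_reg_truncated_def[abs_def] D J_def integrand ..
    hence L: "(IKM_reg_truncated r i \<longlongrightarrow> S / h) at_top" using lim by simp
    have "IKM_reg_converges r i"
      unfolding IKM_reg_converges_def
      using L IKM_integrand_integrable_Ioc[of _ k "2 * r + 2" "2 * i", unfolded integrand] by blast
    moreover have "IKM_reg r i = S / h"
      unfolding IKM_reg_def using L by (intro tendsto_Lim) auto
    hence "S = h * IKM_reg r i" using h0 by simp
    ultimately show ?thesis using False conv' by (simp add: S_def h_def w_def)
  qed
qed

lemma IKM_converges_below:
  assumes "k = 4 * r + 2" "j \<le> r"
  shows "IKM_converges k (2 * j) (2 * i)"
  by (rule IKM_converges_exponential) (use assms in simp)

text \<open>For N = 2r + 1 the binomial sum stops at j = r, where K0 is still in the majority, so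
  every term converges to its moment and the limit of the whole is the sum itself.\<close>

lemma IKM_relations_odd:
  fixes r k i :: nat
  assumes k: "k = 4 * r + 2"
  shows "(\<Sum>j = 0..r. real (k div 2 choose (2 * j)) * (- 1) ^ j * pi ^ (2 * j) * IKM k (2 * j) (2 * i)) =
    (if i < r then 0 else (- 1) ^ r * (pi / 2) ^ (2 * r + 2) * of_rat (IK_coeff k (i - r)) * 4 ^ (i - r))"
proof (rule tendsto_unique[OF trivial_limit_at_top_linorder])
  have eqs: "(2 * r + 1) div 2 = r" "2 * (2 * r + 1) = k" "k div 2 = 2 * r + 1" using k by auto
  show "((\<lambda>R. \<Sum>j = 0..r. real (k div 2 choose (2 * j)) * (- 1) ^ j * pi ^ (2 * j) * (LBINT x:{0<..R}. IKM_integrand k (2 * j) (2 * i) x)) \<longlongrightarrow>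
      (\<Sum>j = 0..r. real (k div 2 choose (2 * j)) * (- 1) ^ j * pi ^ (2 * j) * IKM k (2 * j) (2 * i))) at_top"
    by (intro tendsto_sum tendsto_mult tendsto_const IKM_limit IKM_converges_below[OF k]) auto
  show "((\<lambda>R. \<Sum>j = 0..r. real (k div 2 choose (2 * j)) * (- 1) ^ j * pi ^ (2 * j) * (LBINT x:{0<..R}. IKM_integrand k (2 * j) (2 * i) x)) \<longlongrightarrow>
      (if i < r then 0 else (- 1) ^ r * (pi / 2) ^ (2 * r + 2) * of_rat (IK_coeff k (i - r)) * 4 ^ (i - r))) at_top"
    using integral_asymp_odd[of r i] unfolding integral_Re_cP_power eqs k[symmetric] .
qed

theorem corollary28:
  fixes r :: nat
  shows
    "(\<forall>k. k = 4 * r + 4 \<longrightarrow>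
       (\<forall>i \<le> (k - 1) div 2.
          (\<forall>j \<le> r. IKM_converges k (2 * j) (2 * i)) \<and>
          (if i \<le> r then IKM_converges k (2 * r + 2) (2 * i) else IKM_reg_converges r i) \<and>
          (\<Sum>j = 0..r. real ((k div 2) choose (2 * j)) * (- 1) ^ j * pi ^ (2 * j) * IKM k (2 * j) (2 * i))
          = (if i \<le> r
             then (- 1) ^ r * pi ^ (2 * r + 2) * IKM k (2 * r + 2) (2 * i)
             else (- 1) ^ r * pi ^ (2 * r + 2) * IKM_reg r i)))
     \<and>
     (\<forall>k. k = 4 * r + 2 \<longrightarrow>
       (\<forall>i \<le> 2 * r. \<forall>j \<le> r. IKM_converges k (2 * j) (2 * i)) \<and>
       (\<forall>i. i < r \<longrightarrow>
          (\<Sum>j = 0..r. real ((k div 2) choose (2 * j)) * (- 1) ^ j * pi ^ (2 * j) * IKM k (2 * j) (2 * i))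
          = 0) \<and>
       (\<forall>i. r + 1 \<le> i \<and> i \<le> 2 * r \<longrightarrow>
          (\<Sum>j = 0..r. real ((k div 2) choose (2 * j)) * (- 1) ^ j * pi ^ (2 * j) * IKM k (2 * j) (2 * i))
          = of_rat (IK_coeff k (i - r)) * 2 ^ (2 * i - 2 * r) *
            (\<Sum>j = 0..r. real ((k div 2) choose (2 * j)) * (- 1) ^ j * pi ^ (2 * j) * IKM k (2 * j) (2 * r))))"
proof (intro conjI allI impI)
  fix k i assume k: "k = 4 * r + 2"
  let ?S = "\<lambda>i. \<Sum>j = 0..r. real ((k div 2) choose (2 * j)) * (- 1) ^ j * pi ^ (2 * j) * IKM k (2 * j) (2 * i)"
  show "?S i = 0" if "i < r"
    using that unfolding IKM_relations_odd[OF k] by simp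
  \<comment> \<open>With this, the closed form at i = r is the common factor (-1)^r (pi/2)^(2r+2),
    and the closed form at i is its multiple by \<gamma>(k, i-r) 4^(i-r).\<close>
  have "IK_coeff k 0 = 1"
    by (simp add: IK_coeff_def fps_power_zeroth odd_double_fact_def)
  moreover have "(2::real) ^ (2 * i - 2 * r) = 4 ^ (i - r)"
    by (simp add: power_mult flip: right_diff_distrib')
  ultimately show "?S i = of_rat (IK_coeff k (i - r)) * 2 ^ (2 * i - 2 * r) * ?S r"
    if "r + 1 \<le> i \<and> i \<le> 2 * r"
    using that unfolding IKM_relations_odd[OF k] by simp
qed (blast intro: IKM_converges_below
       IKM_relations_even[THEN conjunct1, rule_format]
       IKM_relations_even[THEN conjunct2, THEN conjunct1]
       IKM_relations_even[THEN conjunct2, THEN conjunct2])+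

end
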